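(* Let $G$ be a finite group and let $p$ be a prime. Then $$u_{p}(G)=|G|_{p}\cdot|G:G'|_{p'}$$ holds if and only if $G$ has a normal $p$-complement $N$ with $[N,G]=N'$.
   Context: $\mathrm{Irr}(G)$ denotes the set of complex irreducible characters of the finite group $G$; $G'$ and $N'$ are the derived (commutator) subgroups of $G$ and $N$, and $[N,G]$ is the subgroup generated by all commutators $[n,g]$ with $n\in N$, $g\in G$. For a positive integer $n$ and a prime $p$, write $n=n_p\cdot n_{p'}$, where $n_p$ is the largest power of $p$ dividing $n$ and $n_{p'}$ is coprime to $p$. A normal $p$-complement of $G$ is a normal subgroup $N$ of $G$ with $|N|$ coprime to $p$ and $|G:N|$ a power of $p$. The invariant $u_p(G)$ is defined by $$u_{p}(G)=\sum_{\chi\in\mathrm{Irr}(G),\ \chi(1)_{p'}=1}\chi(1)^2 ,$$ the sum being over the irreducible characters whose degree is a power of $p$ (including $p^0=1$). *)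

theory Defs
  imports
    "HOL-Algebra.Coset"
    "HOL-Algebra.Generated_Groups"
    "HOL-Computational_Algebra.Primes"
    "Jordan_Normal_Form.VS_Connect"
begin

section \<open>Complex irreducible characters\<close>

definition GL :: "nat \<Rightarrow> complex mat monoid" where
  "GL n = units_of (ring_mat TYPE(complex) n ())"

definition mat_trace :: "complex mat \<Rightarrow> complex" where
  "mat_trace A = (\<Sum>i<dim_row A. A $$ (i, i))"

definition invariant_subspace ::
    "('a, 'b) monoid_scheme \<Rightarrow> nat \<Rightarrow> ('a \<Rightarrow> complex mat) \<Rightarrow> complex vec set \<Rightarrow> bool" where
  "invariant_subspace G n \<rho> W \<longleftrightarrow>
     subspace class_ring W (module_vec TYPE(complex) n) \<and>
     (\<forall>g \<in> carrier G. \<forall>w \<in> W. \<rho> g *\<^sub>v w \<in> W)"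

definition irreducible_rep ::
    "('a, 'b) monoid_scheme \<Rightarrow> nat \<Rightarrow> ('a \<Rightarrow> complex mat) \<Rightarrow> bool" where
  "irreducible_rep G n \<rho> \<longleftrightarrow>
     \<rho> \<in> hom G (GL n) \<and> n > 0 \<and>
     (\<forall>W. invariant_subspace G n \<rho> W \<longrightarrow> W = {0\<^sub>v n} \<or> W = carrier_vec n)"

text \<open>Characters are restricted to the carrier, so that two of them are equal as HOL functions
  exactly when they agree on \<open>G\<close>.\<close>

definition character_of :: "('a, 'b) monoid_scheme \<Rightarrow> ('a \<Rightarrow> complex mat) \<Rightarrow> 'a \<Rightarrow> complex" where
  "character_of G \<rho> = restrict (\<lambda>g. mat_trace (\<rho> g)) (carrier G)"

definition Irr :: "('a, 'b) monoid_scheme \<Rightarrow> ('a \<Rightarrow> complex) set" where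
  "Irr G = {character_of G \<rho> | n \<rho>. irreducible_rep G n \<rho>}"

text \<open>The complex number \<open>\<chi>(1)\<close> read as a natural number; see \<open>of_nat_char_degree\<close> below.\<close>

definition char_degree :: "('a, 'b) monoid_scheme \<Rightarrow> ('a \<Rightarrow> complex) \<Rightarrow> nat" where
  "char_degree G \<chi> = (THE d. \<chi> \<one>\<^bsub>G\<^esub> = of_nat d)"

lemma of_nat_char_degree:
  assumes "group G" "\<chi> \<in> Irr G"
  shows "of_nat (char_degree G \<chi>) = \<chi> \<one>\<^bsub>G\<^esub>"
proof -
  interpret group G by fact
  obtain n \<rho> where \<rho>: "irreducible_rep G n \<rho>" and \<chi>: "\<chi> = character_of G \<rho>"
    using assms(2) by (auto simp: Irr_def)
  have "ring (ring_mat TYPE(complex) n ())"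
    by (rule ring_mat)
  then have "group (GL n)"
    unfolding GL_def by (intro monoid.units_group ring.is_monoid)
  then have "\<rho> \<one>\<^bsub>G\<^esub> = \<one>\<^bsub>GL n\<^esub>"
    using \<rho> hom_one[of \<rho> G "GL n"] by (auto simp: irreducible_rep_def)
  then have "\<chi> \<one>\<^bsub>G\<^esub> = of_nat n"
    by (simp add: \<chi> character_of_def mat_trace_def GL_def units_of_def ring_mat_def)
  then show ?thesis
    by (simp add: char_degree_def)
qed

section \<open>Arithmetical parts and the invariant\<close>

definition p_part :: "nat \<Rightarrow> nat \<Rightarrow> nat" where
  "p_part p n = p ^ multiplicity p n"

definition p'_part :: "nat \<Rightarrow> nat \<Rightarrow> nat" where
  "p'_part p n = n div p_part p n"

definition u_inv :: "nat \<Rightarrow> ('a, 'b) monoid_scheme \<Rightarrow> nat" where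
  "u_inv p G = (\<Sum>\<chi> | \<chi> \<in> Irr G \<and> p'_part p (char_degree G \<chi>) = 1. (char_degree G \<chi>)\<^sup>2)"

section \<open>Normal complements and commutators\<close>

definition group_index :: "('a, 'b) monoid_scheme \<Rightarrow> 'a set \<Rightarrow> nat" where
  "group_index G H = card (rcosets\<^bsub>G\<^esub> H)"

definition normal_p_complement :: "nat \<Rightarrow> ('a, 'b) monoid_scheme \<Rightarrow> 'a set \<Rightarrow> bool" where
  "normal_p_complement p G N \<longleftrightarrow>
     N \<lhd> G \<and> coprime (card N) p \<and> (\<exists>k. group_index G N = p ^ k)"

text \<open>Same commutator convention as in \<^const>\<open>derived\<close>, so that
  \<open>commutator_subgroup G H H = derived G H\<close>.\<close>

definition commutator_subgroup :: "('a, 'b) monoid_scheme \<Rightarrow> 'a set \<Rightarrow> 'a set \<Rightarrow> 'a set" where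
  "commutator_subgroup G H K = generate G
     (\<Union>h \<in> H. \<Union>k \<in> K. {h \<otimes>\<^bsub>G\<^esub> k \<otimes>\<^bsub>G\<^esub> inv\<^bsub>G\<^esub> h \<otimes>\<^bsub>G\<^esub> inv\<^bsub>G\<^esub> k})"

end

theory Submission
  imports Defs "Jordan_Normal_Form.Spectral_Radius" "HOL-Algebra.Sylow"
    "HOL-Algebra.Multiplicative_Group" "HOL-Algebra.Zassenhaus"
begin

text \<open>
  Call an irreducible character admissible if its degree is a power of \<open>p\<close>, so that \<open>u_inv p G\<close> is the
  sum of the squares of the admissible degrees.

  \<^bold>\<open>Index p.\<close> Let \<open>\<omega>\<close> be a linear character of \<open>G\<close> of order \<open>p\<close> and \<open>K\<close> its kernel, a normal subgroup
  of index \<open>p\<close>.  An irreducible character \<open>\<chi>\<close> of \<open>G\<close> restricts to \<open>K\<close> either irreducibly or as a sum of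
  \<open>p\<close> conjugate irreducible characters (\<open>degree_ratio\<close>), so \<open>\<chi>\<close> is admissible exactly when the constituents
  of its restriction are.  The restriction of the regular character of \<open>G\<close> is \<open>p\<close> times that of \<open>K\<close>;
  comparing the admissible parts of both gives \<open>u_inv p G = p * u_inv p K\<close> (\<open>u_inv_kernel\<close>).

  \<^bold>\<open>Reduction modulo p.\<close> A nonlinear admissible character contributes a multiple of \<open>p\<close>, so \<open>u_inv p G\<close> is
  congruent modulo \<open>p\<close> to the number of linear characters, which is the index of the derived subgroup
  (\<open>u_inv_cong_linear\<close>, \<open>card_linear_chars\<close>).  If \<open>p\<close> does not divide the group order, the two are equal,
  because degrees divide the group order (\<open>char_degree_dvd_order\<close>).

  \<^bold>\<open>A complement exists.\<close> Descend from \<open>G\<close> through kernels as above until the number of linear characters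
  of the subgroup \<open>N\<close> reached is prime to \<open>p\<close> (\<open>descent_to_p_perfect\<close>).  Then
  \<open>u_inv p G = |G:N| * u_inv p N\<close> and \<open>u_inv p N\<close> is prime to \<open>p\<close>.  If the equation of the theorem holds,
  comparison of the \<open>p\<close>-parts shows that \<open>|G:N|\<close> is the full \<open>p\<close>-part of \<open>|G|\<close>, so \<open>N\<close> has order prime to
  \<open>p\<close>.  All elements of order prime to \<open>p\<close> lie in every kernel on the way, so \<open>N\<close> consists exactly of
  them and is normal.

  \<^bold>\<open>The criterion for a given complement.\<close> Let \<open>N\<close> be a normal \<open>p\<close>-complement.  The \<open>p\<close>-group \<open>G/N\<close>
  provides linear characters of order \<open>p\<close> for a descent from \<open>G\<close> to \<open>N\<close>, so that
  \<open>u_inv p G = |G:N| * |N:N'|\<close> (\<open>u_inv_of_complement\<close>).  On the other side, the \<open>p'\<close>-part of \<open>|G:G'|\<close> is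
  \<open>|N:[N,G]|\<close> (\<open>abelianization_of_complement\<close>).  Hence the equation of the theorem says that \<open>N'\<close> and
  \<open>[N,G]\<close> have the same order, and since \<open>N'\<close> is contained in \<open>[N,G]\<close>, that they coincide.

  The character theory is done with the bilinear pairing that sums \<open>f g * h (inv g)\<close>.  It agrees with
  the Hermitian product on characters, but needs no unitary structure; and as only traces
  matter, composition series replace complete reducibility.
\<close>

section \<open>Matrix representations\<close>

text \<open>These are the homomorphisms into \<open>GL n\<close> (\<open>matrix_rep_iff_hom\<close>).  Unlike an irreducible
  representation, one of these may have degree 0.\<close>

definition matrix_rep :: "('a, 'b) monoid_scheme \<Rightarrow> nat \<Rightarrow> ('a \<Rightarrow> complex mat) \<Rightarrow> bool" where
  "matrix_rep G n \<rho> \<longleftrightarrow> (\<forall>g\<in>carrier G. \<rho> g \<in> carrier_mat n n) \<and>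
     (\<forall>g\<in>carrier G. \<forall>h\<in>carrier G. \<rho> (g \<otimes>\<^bsub>G\<^esub> h) = \<rho> g * \<rho> h) \<and> \<rho> \<one>\<^bsub>G\<^esub> = 1\<^sub>m n"

lemma matrix_rep_iff_hom:
  assumes "group G"
  shows "matrix_rep G n \<rho> \<longleftrightarrow> \<rho> \<in> hom G (GL n)"
proof -
  interpret group G by fact
  have ring: "ring (ring_mat TYPE(complex) n ())" by (rule ring_mat)
  show ?thesis
  proof
    assume r: "matrix_rep G n \<rho>"
    have "\<rho> g \<in> Units (ring_mat TYPE(complex) n ())" if g: "g \<in> carrier G" for g
    proof -
      have "\<rho> g * \<rho> (inv\<^bsub>G\<^esub> g) = 1\<^sub>m n" "\<rho> (inv\<^bsub>G\<^esub> g) * \<rho> g = 1\<^sub>m n"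
        using r g unfolding matrix_rep_def by (metis inv_closed r_inv l_inv)+
      moreover have "\<rho> g \<in> carrier_mat n n" "\<rho> (inv\<^bsub>G\<^esub> g) \<in> carrier_mat n n"
        using r g unfolding matrix_rep_def by auto
      ultimately show ?thesis unfolding Units_def ring_mat_def by auto
    qed
    then show "\<rho> \<in> hom G (GL n)"
      using r unfolding hom_def GL_def units_of_def matrix_rep_def by (auto simp: ring_mat_def)
  next
    assume h: "\<rho> \<in> hom G (GL n)"
    have grp: "group (GL n)"
      unfolding GL_def by (intro monoid.units_group ring.is_monoid ring)
    have "\<rho> \<one>\<^bsub>G\<^esub> = \<one>\<^bsub>GL n\<^esub>" using hom_one[OF h is_group grp] .
    then show "matrix_rep G n \<rho>"
      using h unfolding hom_def GL_def units_of_def matrix_rep_def Units_def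
      by (auto simp: ring_mat_def)
  qed
qed

lemma subspace_vecI:
  assumes "W \<subseteq> carrier_vec n" "0\<^sub>v n \<in> W"
    "\<And>v w. v \<in> W \<Longrightarrow> w \<in> W \<Longrightarrow> v + w \<in> W"
    "\<And>c v. v \<in> W \<Longrightarrow> c \<cdot>\<^sub>v v \<in> W"
  shows "VectorSpace.subspace class_ring W (module_vec TYPE(complex) n)"
proof -
  interpret vec_space "TYPE(complex)" n .
  show ?thesis
    unfolding VectorSpace.subspace_def submodule_def using assms vec_vs
    by (auto simp: module_vec_simps intro!: vec_module)
qed

lemma subspace_vecD:
  assumes "VectorSpace.subspace class_ring W (module_vec TYPE(complex) n)"
  shows "W \<subseteq> carrier_vec n" "0\<^sub>v n \<in> W"
    "\<And>v w. v \<in> W \<Longrightarrow> w \<in> W \<Longrightarrow> v + w \<in> W"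
    "\<And>c v. v \<in> W \<Longrightarrow> c \<cdot>\<^sub>v v \<in> W"
proof -
  have s: "submodule class_ring W (module_vec TYPE(complex) n)"
    using assms unfolding VectorSpace.subspace_def by auto
  show W: "W \<subseteq> carrier_vec n" and "0\<^sub>v n \<in> W"
    "\<And>v w. v \<in> W \<Longrightarrow> w \<in> W \<Longrightarrow> v + w \<in> W"
    "\<And>c v. v \<in> W \<Longrightarrow> c \<cdot>\<^sub>v v \<in> W"
    using s unfolding submodule_def by (auto simp: module_vec_simps class_ring_simps)
qed

text \<open>A basis of \<open>W\<close>, being maximal independent inside \<open>W\<close>, extends to a basis of the whole space.  The
  matrix \<open>P\<close> has this basis as its columns, so that \<open>W\<close> becomes the span of the first \<open>k\<close> unit vectors.\<close>

lemma adapted_basis: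
  assumes sub: "VectorSpace.subspace class_ring W (module_vec TYPE(complex) n)"
  obtains k P Q where "k \<le> n" "P \<in> carrier_mat n n" "Q \<in> carrier_mat n n"
    "P * Q = 1\<^sub>m n" "Q * P = 1\<^sub>m n"
    "W = (\<lambda>c. P *\<^sub>v c) ` {c \<in> carrier_vec n. \<forall>i<n. k \<le> i \<longrightarrow> c $ i = 0}"
proof -
  interpret vec_space "TYPE(complex)" n .
  note W = subspace_vecD[OF sub]
  have cV: "carrier V = carrier_vec n" by (simp add: module_vec_simps)
  obtain A where Afin: "finite A" and Amax: "maximal A (\<lambda>S. S \<subseteq> W \<and> lin_indpt S)"
  proof -
    have "finite S \<and> card S \<le> n" if "S \<subseteq> W \<and> lin_indpt S" for S
      using li_le_dim[OF fin_dim, of S] that W(1) dim_is_n cV by auto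
    moreover have "{} \<subseteq> W \<and> lin_indpt {}" by (auto simp: lin_dep_def)
    ultimately show thesis
      using that maximal_exists[of "\<lambda>S. S \<subseteq> W \<and> lin_indpt S" n "{}"] by blast
  qed
  have AW: "A \<subseteq> W" and Ali: "lin_indpt A" using Amax by (auto simp: maximal_def)
  have spanA: "w \<in> span A" if w: "w \<in> W" for w
  proof (cases "w \<in> A")
    case True then show ?thesis using in_own_span[of A] AW W(1) by auto
  next
    case False
    have "lin_dep (A \<union> {w})"
      using Amax w AW False unfolding maximal_def by auto
    then show ?thesis
      using lin_dep_iff_in_span[of A w] AW W(1) Ali w False by auto
  qed
  obtain B where Bfin: "finite B" and
    Bmax: "maximal B (\<lambda>S. A \<subseteq> S \<and> S \<subseteq> carrier_vec n \<and> lin_indpt S)"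
  proof -
    have "finite S \<and> card S \<le> n" if "A \<subseteq> S \<and> S \<subseteq> carrier_vec n \<and> lin_indpt S" for S
      using li_le_dim[OF fin_dim, of S] that dim_is_n cV by auto
    moreover have "A \<subseteq> A \<and> A \<subseteq> carrier_vec n \<and> lin_indpt A" using AW W(1) Ali by auto
    ultimately show thesis
      using that maximal_exists[of "\<lambda>S. A \<subseteq> S \<and> S \<subseteq> carrier_vec n \<and> lin_indpt S" n A] by blast
  qed
  have AB: "A \<subseteq> B" and Bc: "B \<subseteq> carrier_vec n" and Bli: "lin_indpt B"
    using Bmax by (auto simp: maximal_def)
  have "maximal B (\<lambda>S. S \<subseteq> carrier_vec n \<and> lin_indpt S)"
    using Bmax unfolding maximal_def by blast
  then have Bbasis: "basis B" using max_li_is_basis[of B] by simp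
  have cardB: "card B = n" using dim_basis[OF Bfin Bbasis] dim_is_n by simp
  have spanB: "span B = carrier_vec n" using Bbasis unfolding basis_def by (simp add: cV)
  obtain as where as: "set as = A" "distinct as" using finite_distinct_list[OF Afin] by auto
  obtain cs where cs: "set cs = B - A" "distinct cs"
    using finite_distinct_list[of "B - A"] Bfin by auto
  define bs where "bs = as @ cs"
  have bs: "set bs = B" "distinct bs" using as cs AB by (auto simp: bs_def)
  have lbs: "length bs = n" using bs cardB distinct_card by fastforce
  define k where "k = length as"
  have kn: "k \<le> n" using lbs by (simp add: k_def bs_def)
  define P where "P = mat_of_cols n bs"
  have P: "P \<in> carrier_mat n n" using lbs by (simp add: P_def mat_of_cols_def)
  have colP: "col P i = bs ! i" if "i < n" for i
  proof -
    have "bs ! i \<in> carrier_vec n" using that lbs bs(1) Bc nth_mem[of i bs] by auto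
    then show ?thesis using that lbs by (simp add: P_def)
  qed
  have dimbs: "\<forall>w\<in>set bs. dim_vec w = n" using bs Bc by auto
  have coord: "\<exists>c\<in>carrier_vec n. P *\<^sub>v c = v" if v: "v \<in> carrier_vec n" for v
  proof -
    have "v \<in> span B" using v spanB by simp
    then obtain a where "v = lincomb a B"
      using finite_in_span[of B v] Bfin Bc by auto
    then have "v = lincomb_list (\<lambda>i. if \<exists>j<i. bs!i = bs!j then 0 else a (bs ! i)) bs"
      using lincomb_as_lincomb_list[of bs a] bs Bc by simp
    then have "v = P *\<^sub>v vec n (\<lambda>i. if \<exists>j<i. bs!i = bs!j then 0 else a (bs ! i))"
      using lincomb_list_as_mat_mult[OF dimbs] lbs P_def by simp
    then show ?thesis by (intro bexI[of _ "vec n _"]) auto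
  qed
  have "\<forall>i<n. \<exists>c\<in>carrier_vec n. P *\<^sub>v c = unit_vec n i" using coord by simp
  then obtain y where y: "\<And>i. i < n \<Longrightarrow> y i \<in> carrier_vec n \<and> P *\<^sub>v y i = unit_vec n i" by metis
  define Q where "Q = mat_of_cols n (map y [0..<n])"
  have Q: "Q \<in> carrier_mat n n" by (simp add: Q_def mat_of_cols_def)
  have colQ: "col Q i = y i" if "i < n" for i
    using that y by (simp add: Q_def)
  have PQ: "P * Q = 1\<^sub>m n"
  proof (rule mat_col_eqI)
    fix i assume "i < dim_col (1\<^sub>m n)"
    then have i: "i < n" by simp
    have "col (P * Q) i = P *\<^sub>v y i" using col_mult2[OF P Q i] colQ[OF i] by simp
    then show "col (P * Q) i = col (1\<^sub>m n) i" using y[OF i] i by simp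
  qed (use P Q in auto)
  have QP: "Q * P = 1\<^sub>m n" using mat_mult_left_right_inverse[OF P Q PQ] .
  let ?C = "{c \<in> carrier_vec n. \<forall>i<n. k \<le> i \<longrightarrow> c $ i = 0}"
  have "W = (\<lambda>c. P *\<^sub>v c) ` ?C"
  proof (intro equalityI subsetI)
    fix w assume "w \<in> W"
    then have "w \<in> span A" by (rule spanA)
    then obtain a where w: "w = lincomb a A"
      using finite_in_span[of A w] Afin AW W(1) by auto
    define a' where "a' v = (if v \<in> A then a v else 0)" for v
    have "w = lincomb a' A" unfolding w lincomb_def
      by (intro finsum_cong2) (use AW W(1) in \<open>auto simp: a'_def\<close>)
    also have "\<dots> = lincomb a' B"
    proof -
      have "lincomb a' (A \<union> (B - A)) = lincomb a' A"
        by (rule lincomb_clean) (use AW W(1) Bc Bfin Afin in \<open>auto simp: a'_def class_ring_simps\<close>)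
      then show ?thesis using AB by (simp add: Un_absorb1)
    qed
    also have "\<dots> = lincomb_list (\<lambda>i. if \<exists>j<i. bs!i = bs!j then 0 else a' (bs ! i)) bs"
      using lincomb_as_lincomb_list[of bs a'] bs Bc by simp
    also have "\<dots> = P *\<^sub>v vec n (\<lambda>i. if \<exists>j<i. bs!i = bs!j then 0 else a' (bs ! i))"
      using lincomb_list_as_mat_mult[OF dimbs] lbs P_def by simp
    finally have weq: "w = P *\<^sub>v vec n (\<lambda>i. if \<exists>j<i. bs!i = bs!j then 0 else a' (bs ! i))" .
    have "bs ! i \<notin> A" if "i < n" "k \<le> i" for i
    proof -
      have "i - k < length cs" using that lbs by (simp add: bs_def k_def)
      then have "cs ! (i - k) \<in> B - A" using cs(1) nth_mem by blast
      then show ?thesis using that by (simp add: bs_def nth_append k_def)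
    qed
    then have "vec n (\<lambda>i. if \<exists>j<i. bs!i = bs!j then 0 else a' (bs ! i)) \<in> ?C"
      by (auto simp: a'_def)
    then show "w \<in> (\<lambda>c. P *\<^sub>v c) ` ?C" using weq by blast
  next
    fix w assume "w \<in> (\<lambda>c. P *\<^sub>v c) ` ?C"
    then obtain c where c: "c \<in> ?C" and w: "w = P *\<^sub>v c" by auto
    have "vec n (\<lambda>i. c $ i) = c" using c by (intro eq_vecI) auto
    then have "w = lincomb_list (\<lambda>i. c $ i) bs"
      using lincomb_list_as_mat_mult[OF dimbs, of "\<lambda>i. c $ i"] lbs w P_def by simp
    also have "\<dots> \<in> W"
    proof -
      have S: "M.sumlist (map (\<lambda>i. c $ i \<cdot>\<^sub>v bs ! i) js) \<in> W" if "set js \<subseteq> {..<n}" for js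
        using that
      proof (induction js)
        case Nil then show ?case using W(2) by simp
      next
        case (Cons i js)
        have "c $ i \<cdot>\<^sub>v bs ! i \<in> W"
        proof (cases "i < k")
          case True
          then have "bs ! i \<in> W" using AW as by (auto simp: bs_def nth_append k_def)
          then show ?thesis using W(4) by simp
        next
          case False
          then have "c $ i = 0" using c Cons by auto
          moreover have "bs ! i \<in> carrier_vec n" using Cons lbs bs Bc by auto
          ultimately show ?thesis using W(2) by simp
        qed
        then show ?case using Cons W(3) by simp
      qed
      have "set [0..<length bs] \<subseteq> {..<n}" using lbs by auto
      from S[OF this] show ?thesis unfolding lincomb_list_def .
    qed
    finally show "w \<in> W" .
  qed
  then show thesis using that kn P Q PQ QP by blast
qed

lemma trace_mult_comm:
  assumes "A \<in> carrier_mat n m" "B \<in> carrier_mat m n"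
  shows "mat_trace (A * B) = mat_trace (B * A)"
proof -
  have "mat_trace (A * B) = (\<Sum>i<n. \<Sum>j<m. A $$ (i,j) * B $$ (j,i))"
    using assms by (auto simp: mat_trace_def scalar_prod_def atLeast0LessThan intro!: sum.cong)
  also have "\<dots> = (\<Sum>j<m. \<Sum>i<n. B $$ (j,i) * A $$ (i,j))"
    by (subst sum.swap) (simp add: mult.commute)
  also have "\<dots> = mat_trace (B * A)"
    using assms by (auto simp: mat_trace_def scalar_prod_def atLeast0LessThan intro!: sum.cong)
  finally show ?thesis .
qed

lemma invariant_subspace_iff:
  "invariant_subspace G n \<rho> W \<longleftrightarrow> W \<subseteq> carrier_vec n \<and> 0\<^sub>v n \<in> W \<and>
     (\<forall>v\<in>W. \<forall>w\<in>W. v + w \<in> W) \<and> (\<forall>c. \<forall>v\<in>W. c \<cdot>\<^sub>v v \<in> W) \<and>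
     (\<forall>g\<in>carrier G. \<forall>w\<in>W. \<rho> g *\<^sub>v w \<in> W)"
  unfolding invariant_subspace_def
  using subspace_vecI[of W n] subspace_vecD[of W n] by blast

lemma irreducible_rep_iff:
  assumes "group G"
  shows "irreducible_rep G n \<rho> \<longleftrightarrow> matrix_rep G n \<rho> \<and> n > 0 \<and>
     (\<forall>W. invariant_subspace G n \<rho> W \<longrightarrow> W = {0\<^sub>v n} \<or> W = carrier_vec n)"
  unfolding irreducible_rep_def matrix_rep_iff_hom[OF assms] by blast

text \<open>In a basis adapted to an invariant subspace all \<open>\<rho> g\<close> are block upper triangular.  The two diagonal
  blocks are the representations on the subspace and on the quotient, and the trace only sees them.\<close>

lemma reducible_trace_split:
  assumes r: "matrix_rep G n \<rho>" and inv: "invariant_subspace G n \<rho> W"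
    and W0: "W \<noteq> {0\<^sub>v n}" and W1: "W \<noteq> carrier_vec n"
  obtains k \<alpha> \<delta> where "0 < k" "k < n" "matrix_rep G k \<alpha>" "matrix_rep G (n - k) \<delta>"
    "\<And>g. g \<in> carrier G \<Longrightarrow> mat_trace (\<rho> g) = mat_trace (\<alpha> g) + mat_trace (\<delta> g)"
proof -
  have sub: "VectorSpace.subspace class_ring W (module_vec TYPE(complex) n)"
    using inv by (simp add: invariant_subspace_def)
  obtain k P Q where k: "k \<le> n"
    and P: "P \<in> carrier_mat n n" and Q: "Q \<in> carrier_mat n n"
    and PQ: "P * Q = 1\<^sub>m n" and QP: "Q * P = 1\<^sub>m n"
    and W: "W = (\<lambda>c. P *\<^sub>v c) ` {c \<in> carrier_vec n. \<forall>i<n. k \<le> i \<longrightarrow> c $ i = 0}"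
    by (rule adapted_basis[OF sub])
  have k0: "0 < k"
  proof (rule ccontr)
    assume "\<not> 0 < k"
    then have C: "{c \<in> carrier_vec n. \<forall>i<n. k \<le> i \<longrightarrow> c $ i = 0} = {0\<^sub>v n}"
      by (auto intro!: eq_vecI)
    have "P *\<^sub>v 0\<^sub>v n = 0\<^sub>v n" using P by (intro eq_vecI) auto
    then have "W = {0\<^sub>v n}" unfolding W C by simp
    then show False using W0 by contradiction
  qed
  have kn: "k < n"
  proof (rule ccontr)
    assume "\<not> k < n"
    then have "W = (\<lambda>c. P *\<^sub>v c) ` carrier_vec n" using W by auto
    moreover have "(\<lambda>c. P *\<^sub>v c) ` carrier_vec n = carrier_vec n"
    proof (intro equalityI subsetI)
      fix v :: "complex vec" assume v: "v \<in> carrier_vec n"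
      have "v = P *\<^sub>v (Q *\<^sub>v v)"
        using assoc_mult_mat_vec[OF P Q v] PQ v by simp
      then show "v \<in> (\<lambda>c. P *\<^sub>v c) ` carrier_vec n" using Q v by auto
    qed (use P in auto)
    ultimately show False using W1 by simp
  qed
  have \<rho>c: "\<rho> g \<in> carrier_mat n n" if "g \<in> carrier G" for g
    using r that by (simp add: matrix_rep_def)
  define M where "M g = Q * (\<rho> g * P)" for g
  have Mc: "M g \<in> carrier_mat n n" if "g \<in> carrier G" for g
    using P Q \<rho>c[OF that] by (simp add: M_def)
  have Mone: "M \<one>\<^bsub>G\<^esub> = 1\<^sub>m n" using r QP P by (simp add: M_def matrix_rep_def)
  have Mmult: "M (g \<otimes>\<^bsub>G\<^esub> h) = M g * M h" if g: "g \<in> carrier G" and h: "h \<in> carrier G" for g h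
  proof -
    have "M g * M h = Q * ((\<rho> g * P) * (Q * (\<rho> h * P)))"
      unfolding M_def using P Q \<rho>c[OF g] \<rho>c[OF h] by (intro assoc_mult_mat) auto
    also have "(\<rho> g * P) * (Q * (\<rho> h * P)) = \<rho> g * (P * (Q * (\<rho> h * P)))"
      using P Q \<rho>c[OF g] \<rho>c[OF h] by (intro assoc_mult_mat) auto
    also have "P * (Q * (\<rho> h * P)) = (P * Q) * (\<rho> h * P)"
      using P Q \<rho>c[OF h] by (intro assoc_mult_mat[symmetric]) auto
    also have "\<dots> = \<rho> h * P" using PQ P \<rho>c[OF h] by simp
    also have "\<rho> g * (\<rho> h * P) = (\<rho> g * \<rho> h) * P"
      using P \<rho>c[OF g] \<rho>c[OF h] by (intro assoc_mult_mat[symmetric]) auto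
    finally show ?thesis using r g h by (simp add: M_def matrix_rep_def)
  qed
  have Mtrace: "mat_trace (M g) = mat_trace (\<rho> g)" if g: "g \<in> carrier G" for g
  proof -
    have "mat_trace (M g) = mat_trace ((\<rho> g * P) * Q)"
      unfolding M_def using P Q \<rho>c[OF g] by (intro trace_mult_comm) auto
    also have "(\<rho> g * P) * Q = \<rho> g * (P * Q)"
      using P Q \<rho>c[OF g] by (intro assoc_mult_mat) auto
    finally show ?thesis using PQ \<rho>c[OF g] by simp
  qed
  \<comment> \<open>The lower left block vanishes because \<open>W\<close> is invariant.\<close>
  have Mzero: "M g $$ (i, j) = 0" if g: "g \<in> carrier G" and ij: "k \<le> i" "i < n" "j < k" for g i j
  proof -
    have j: "j < n" using ij kn by simp
    have "P *\<^sub>v unit_vec n j \<in> W" unfolding W using ij j by auto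
    then have "\<rho> g *\<^sub>v (P *\<^sub>v unit_vec n j) \<in> W" using inv g by (auto simp: invariant_subspace_iff)
    then obtain c where c: "c \<in> carrier_vec n" "\<forall>i<n. k \<le> i \<longrightarrow> c $ i = 0"
      and e: "\<rho> g *\<^sub>v (P *\<^sub>v unit_vec n j) = P *\<^sub>v c" unfolding W by auto
    have "M g *\<^sub>v unit_vec n j = Q *\<^sub>v ((\<rho> g * P) *\<^sub>v unit_vec n j)"
      unfolding M_def using P Q \<rho>c[OF g] by (intro assoc_mult_mat_vec) auto
    also have "(\<rho> g * P) *\<^sub>v unit_vec n j = P *\<^sub>v c"
      using e assoc_mult_mat_vec[OF \<rho>c[OF g] P] by simp
    also have "Q *\<^sub>v (P *\<^sub>v c) = c"
      using assoc_mult_mat_vec[OF Q P c(1)] QP c by simp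
    finally have "M g *\<^sub>v unit_vec n j = c" .
    then have "(M g *\<^sub>v unit_vec n j) $ i = 0" using c(2) ij by simp
    then show ?thesis using Mc[OF g] ij j by simp
  qed
  define \<alpha> where "\<alpha> g = mat k k (\<lambda>(i,j). M g $$ (i,j))" for g
  define \<delta> where "\<delta> g = mat (n-k) (n-k) (\<lambda>(i,j). M g $$ (i+k,j+k))" for g
  have split: "(\<Sum>l<n. f l) = (\<Sum>l<k. f l) + (\<Sum>l<n-k. f (l+k))" for f :: "nat \<Rightarrow> complex"
  proof -
    have "(\<Sum>l<n. f l) = (\<Sum>l<k. f l) + (\<Sum>l\<in>{k..<n}. f l)"
      using k by (metis finite_lessThan lessThan_minus_lessThan lessThan_subset_iff sum.subset_diff add.commute)
    also have "(\<Sum>l\<in>{k..<n}. f l) = (\<Sum>l<n-k. f (l+k))"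
      using sum.shift_bounds_nat_ivl[of f 0 k "n-k"] k by (simp add: atLeast0LessThan)
    finally show ?thesis .
  qed
  have entry: "(M g * M h) $$ (i,j) = (\<Sum>l<n. M g $$ (i,l) * M h $$ (l,j))"
    if "g \<in> carrier G" "h \<in> carrier G" "i < n" "j < n" for g h i j
    using Mc[OF that(1)] Mc[OF that(2)] that
    by (auto simp: scalar_prod_def atLeast0LessThan)
  have \<alpha>: "matrix_rep G k \<alpha>" unfolding matrix_rep_def
  proof (intro conjI ballI)
    fix g h assume g: "g \<in> carrier G" and h: "h \<in> carrier G"
    show "\<alpha> (g \<otimes>\<^bsub>G\<^esub> h) = \<alpha> g * \<alpha> h"
    proof (rule eq_matI)
      fix i j assume "i < dim_row (\<alpha> g * \<alpha> h)" "j < dim_col (\<alpha> g * \<alpha> h)"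
      then have ij: "i < k" "j < k" by (auto simp: \<alpha>_def)
      have "\<alpha> (g \<otimes>\<^bsub>G\<^esub> h) $$ (i,j) = (\<Sum>l<n. M g $$ (i,l) * M h $$ (l,j))"
        using ij kn entry[OF g h] by (simp add: \<alpha>_def Mmult[OF g h])
      also have "\<dots> = (\<Sum>l<k. M g $$ (i,l) * M h $$ (l,j))"
        unfolding split using Mzero[OF h] ij by (auto intro!: sum.neutral)
      also have "\<dots> = (\<alpha> g * \<alpha> h) $$ (i,j)"
        using ij by (auto simp: \<alpha>_def scalar_prod_def atLeast0LessThan intro!: sum.cong)
      finally show "\<alpha> (g \<otimes>\<^bsub>G\<^esub> h) $$ (i,j) = (\<alpha> g * \<alpha> h) $$ (i,j)" .
    qed (auto simp: \<alpha>_def)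
  qed (use kn in \<open>auto simp: \<alpha>_def Mone\<close>)
  have \<delta>: "matrix_rep G (n - k) \<delta>" unfolding matrix_rep_def
  proof (intro conjI ballI)
    fix g h assume g: "g \<in> carrier G" and h: "h \<in> carrier G"
    show "\<delta> (g \<otimes>\<^bsub>G\<^esub> h) = \<delta> g * \<delta> h"
    proof (rule eq_matI)
      fix i j assume "i < dim_row (\<delta> g * \<delta> h)" "j < dim_col (\<delta> g * \<delta> h)"
      then have ij: "i < n - k" "j < n - k" by (auto simp: \<delta>_def)
      have "\<delta> (g \<otimes>\<^bsub>G\<^esub> h) $$ (i,j) = (\<Sum>l<n. M g $$ (i+k,l) * M h $$ (l,j+k))"
        using ij kn entry[OF g h] by (simp add: \<delta>_def Mmult[OF g h])
      also have "\<dots> = (\<Sum>l<n-k. M g $$ (i+k,l+k) * M h $$ (l+k,j+k))"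
        unfolding split using Mzero[OF g] ij by (auto intro!: sum.neutral)
      also have "\<dots> = (\<delta> g * \<delta> h) $$ (i,j)"
        using ij by (auto simp: \<delta>_def scalar_prod_def atLeast0LessThan intro!: sum.cong)
      finally show "\<delta> (g \<otimes>\<^bsub>G\<^esub> h) $$ (i,j) = (\<delta> g * \<delta> h) $$ (i,j)" .
    qed (auto simp: \<delta>_def)
  qed (use kn in \<open>auto simp: \<delta>_def Mone\<close>)
  have "mat_trace (\<rho> g) = mat_trace (\<alpha> g) + mat_trace (\<delta> g)" if g: "g \<in> carrier G" for g
  proof -
    have "mat_trace (\<rho> g) = (\<Sum>i<n. M g $$ (i,i))"
      using Mtrace[OF g] Mc[OF g] by (simp add: mat_trace_def)
    then show ?thesis unfolding split by (simp add: \<alpha>_def \<delta>_def mat_trace_def)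
  qed
  with k0 kn \<alpha> \<delta> that show thesis by blast
qed

text \<open>Every representation has a composition series; its character is the sum of those of the factors.\<close>

lemma rep_trace_decomposition:
  assumes G: "group G" and r: "matrix_rep G n \<rho>"
  shows "\<exists>\<chi>s. set \<chi>s \<subseteq> Irr G \<and> (\<forall>g\<in>carrier G. mat_trace (\<rho> g) = (\<Sum>\<chi>\<leftarrow>\<chi>s. \<chi> g))"
  using r
proof (induction n arbitrary: \<rho> rule: less_induct)
  case (less n)
  consider "n = 0" | "irreducible_rep G n \<rho>" | "n > 0" "\<not> irreducible_rep G n \<rho>" by blast
  then show ?case
  proof cases
    case 1
    then have "\<forall>g\<in>carrier G. mat_trace (\<rho> g) = 0"
      using less.prems by (auto simp: matrix_rep_def mat_trace_def)
    then show ?thesis by (intro exI[of _ "[]"]) auto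
  next
    case 2
    then have "character_of G \<rho> \<in> Irr G" by (auto simp: Irr_def)
    then show ?thesis by (intro exI[of _ "[character_of G \<rho>]"]) (auto simp: character_of_def)
  next
    case 3
    then obtain W where "invariant_subspace G n \<rho> W" "W \<noteq> {0\<^sub>v n}" "W \<noteq> carrier_vec n"
      using less.prems by (auto simp: irreducible_rep_iff[OF G])
    from reducible_trace_split[OF less.prems this] obtain k \<alpha> \<delta>
      where k: "0 < k" "k < n" and \<alpha>: "matrix_rep G k \<alpha>" and \<delta>: "matrix_rep G (n - k) \<delta>"
        and tr: "\<And>g. g \<in> carrier G \<Longrightarrow> mat_trace (\<rho> g) = mat_trace (\<alpha> g) + mat_trace (\<delta> g)"
      by metis
    obtain xs where "set xs \<subseteq> Irr G" "\<forall>g\<in>carrier G. mat_trace (\<alpha> g) = (\<Sum>\<chi>\<leftarrow>xs. \<chi> g)"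
      using less.IH[OF k(2) \<alpha>] by auto
    moreover obtain ys where "set ys \<subseteq> Irr G" "\<forall>g\<in>carrier G. mat_trace (\<delta> g) = (\<Sum>\<chi>\<leftarrow>ys. \<chi> g)"
      using less.IH[OF _ \<delta>] k by auto
    ultimately show ?thesis by (intro exI[of _ "xs @ ys"]) (auto simp: tr)
  qed
qed

section \<open>Schur's lemma and orthogonality\<close>

lemma eq_mat_by_unit_vecs:
  fixes A B :: "complex mat"
  assumes "A \<in> carrier_mat n m" "B \<in> carrier_mat n m"
    "\<And>j. j < m \<Longrightarrow> A *\<^sub>v unit_vec m j = B *\<^sub>v unit_vec m j"
  shows "A = B"
proof (rule eq_matI)
  fix i j assume ij: "i < dim_row B" "j < dim_col B"
  then have "(A *\<^sub>v unit_vec m j) $ i = (B *\<^sub>v unit_vec m j) $ i" using assms by auto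
  then show "A $$ (i,j) = B $$ (i,j)" using assms(1,2) ij by auto
qed (use assms in auto)

lemma vec_minus_eq_zero:
  fixes v w :: "complex vec"
  assumes v: "v \<in> carrier_vec n" and w: "w \<in> carrier_vec n" and eq: "v - w = 0\<^sub>v n"
  shows "v = w"
proof (rule eq_vecI)
  fix i assume "i < dim_vec w"
  then have i: "i < n" using w by simp
  have "(v - w) $ i = 0\<^sub>v n $ i" using eq by simp
  then show "v $ i = w $ i" using v w i by simp
qed (use v w in auto)

text \<open>Schur's lemma.  The kernel of \<open>X\<close> is invariant and not everything, so it is zero; the image is
  invariant and not zero, so it is everything.  The inverse is built from preimages of the unit
  vectors; that it is two-sided, although \<open>n = m\<close> is not known beforehand, follows from injectivity.\<close>

lemma schur_invertible:
  assumes G: "group G" and \<rho>: "irreducible_rep G n \<rho>" and \<sigma>: "irreducible_rep G m \<sigma>"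
    and X: "X \<in> carrier_mat n m" and comm: "\<And>g. g \<in> carrier G \<Longrightarrow> \<rho> g * X = X * \<sigma> g"
    and X0: "X \<noteq> 0\<^sub>m n m"
  obtains Y where "Y \<in> carrier_mat m n" "X * Y = 1\<^sub>m n" "Y * X = 1\<^sub>m m"
proof -
  have \<rho>c: "\<rho> g \<in> carrier_mat n n" and \<sigma>c: "\<sigma> g \<in> carrier_mat m m" if "g \<in> carrier G" for g
    using \<rho> \<sigma> that by (auto simp: irreducible_rep_iff[OF G] matrix_rep_def)
  have commv: "\<rho> g *\<^sub>v (X *\<^sub>v v) = X *\<^sub>v (\<sigma> g *\<^sub>v v)"
    if g: "g \<in> carrier G" and v: "v \<in> carrier_vec m" for g v
    using assoc_mult_mat_vec[OF \<rho>c[OF g] X v] assoc_mult_mat_vec[OF X \<sigma>c[OF g] v] comm[OF g] by simp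
  obtain j0 where j0: "j0 < m" "X *\<^sub>v unit_vec m j0 \<noteq> 0\<^sub>v n"
    using eq_mat_by_unit_vecs[OF X, of "0\<^sub>m n m"] X0 by fastforce
  define K where "K = {v \<in> carrier_vec m. X *\<^sub>v v = 0\<^sub>v n}"
  have X00: "X *\<^sub>v 0\<^sub>v m = 0\<^sub>v n" using X by (intro eq_vecI) auto
  have cz: "c \<cdot>\<^sub>v 0\<^sub>v n = (0\<^sub>v n :: complex vec)" for c by (intro eq_vecI) auto
  have "invariant_subspace G m \<sigma> K"
    unfolding invariant_subspace_iff K_def
  proof (intro conjI ballI allI)
    fix g w assume g: "g \<in> carrier G" and w: "w \<in> {v \<in> carrier_vec m. X *\<^sub>v v = 0\<^sub>v n}"
    have "\<rho> g *\<^sub>v 0\<^sub>v n = 0\<^sub>v n" using \<rho>c[OF g] by (intro eq_vecI) auto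
    then show "\<sigma> g *\<^sub>v w \<in> {v \<in> carrier_vec m. X *\<^sub>v v = 0\<^sub>v n}"
      using commv[OF g, of w] w \<sigma>c[OF g] by auto
  next
    fix v w assume "v \<in> {v \<in> carrier_vec m. X *\<^sub>v v = 0\<^sub>v n}" "w \<in> {v \<in> carrier_vec m. X *\<^sub>v v = 0\<^sub>v n}"
    then show "v + w \<in> {v \<in> carrier_vec m. X *\<^sub>v v = 0\<^sub>v n}"
      using mult_add_distrib_mat_vec[OF X, of v w] by simp
  next
    fix c v assume "v \<in> {v \<in> carrier_vec m. X *\<^sub>v v = 0\<^sub>v n}"
    then show "c \<cdot>\<^sub>v v \<in> {v \<in> carrier_vec m. X *\<^sub>v v = 0\<^sub>v n}"
      using mult_mat_vec[OF X, of v c] cz[of c] by simp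
  next
    show "{v \<in> carrier_vec m. X *\<^sub>v v = 0\<^sub>v n} \<subseteq> carrier_vec m" by blast
    show "0\<^sub>v m \<in> {v \<in> carrier_vec m. X *\<^sub>v v = 0\<^sub>v n}" using X00 by simp
  qed
  moreover have "K \<noteq> carrier_vec m" using j0 unit_vec_carrier[of m j0] unfolding K_def by blast
  ultimately have K: "K = {0\<^sub>v m}" using \<sigma> by (auto simp: irreducible_rep_iff[OF G])
  define I where "I = (\<lambda>v. X *\<^sub>v v) ` carrier_vec m"
  have "invariant_subspace G n \<rho> I"
    unfolding invariant_subspace_iff
  proof (intro conjI ballI allI)
    show "0\<^sub>v n \<in> I" unfolding I_def using X00 by (metis imageI zero_carrier_vec)
    show "I \<subseteq> carrier_vec n" unfolding I_def using X by auto
  next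
    fix g w assume g: "g \<in> carrier G" and w: "w \<in> I"
    then show "\<rho> g *\<^sub>v w \<in> I" unfolding I_def using commv[OF g] \<sigma>c[OF g] by auto
  next
    fix v w assume "v \<in> I" "w \<in> I"
    then obtain v' w' where "v' \<in> carrier_vec m" "w' \<in> carrier_vec m" "v = X *\<^sub>v v'" "w = X *\<^sub>v w'"
      unfolding I_def by auto
    then show "v + w \<in> I" unfolding I_def
      using mult_add_distrib_mat_vec[OF X, of v' w'] by (intro image_eqI[of _ _ "v' + w'"]) simp_all
  next
    fix c v assume "v \<in> I"
    then obtain v' where "v' \<in> carrier_vec m" "v = X *\<^sub>v v'" unfolding I_def by auto
    then show "c \<cdot>\<^sub>v v \<in> I" unfolding I_def
      using mult_mat_vec[OF X, of v' c] by (intro image_eqI[of _ _ "c \<cdot>\<^sub>v v'"]) simp_all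
  qed
  moreover have "I \<noteq> {0\<^sub>v n}" using j0 unfolding I_def by (metis image_eqI singletonD unit_vec_carrier)
  ultimately have I: "I = carrier_vec n" using \<rho> by (auto simp: irreducible_rep_iff[OF G])
  have "\<forall>i<n. \<exists>v\<in>carrier_vec m. X *\<^sub>v v = unit_vec n i"
  proof (intro allI impI)
    fix i assume "i < n"
    have "unit_vec n i \<in> I" using I by simp
    then show "\<exists>v\<in>carrier_vec m. X *\<^sub>v v = unit_vec n i" unfolding I_def by auto
  qed
  then obtain y where y: "\<And>i. i < n \<Longrightarrow> y i \<in> carrier_vec m \<and> X *\<^sub>v y i = unit_vec n i" by metis
  define Y where "Y = mat_of_cols m (map y [0..<n])"
  have Y: "Y \<in> carrier_mat m n" by (simp add: Y_def mat_of_cols_def)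
  have colY: "col Y i = y i" if "i < n" for i
    using that y by (simp add: Y_def)
  have XY: "X * Y = 1\<^sub>m n"
  proof (rule mat_col_eqI)
    fix i assume "i < dim_col (1\<^sub>m n)"
    then have i: "i < n" by simp
    have "col (X * Y) i = X *\<^sub>v y i" using col_mult2[OF X Y i] colY[OF i] by simp
    then show "col (X * Y) i = col (1\<^sub>m n) i" using y[OF i] i by simp
  qed (use X Y in auto)
  have YX: "Y * X = 1\<^sub>m m"
  proof (rule eq_mat_by_unit_vecs)
    fix j assume j: "j < m"
    let ?u = "unit_vec m j" and ?w = "(Y * X) *\<^sub>v unit_vec m j"
    have w: "?w \<in> carrier_vec m" using X Y by auto
    have "X *\<^sub>v ?w = (X * (Y * X)) *\<^sub>v ?u"
      using X Y by (intro assoc_mult_mat_vec[symmetric, of _ n m _ m]) auto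
    also have "X * (Y * X) = (X * Y) * X" using assoc_mult_mat[OF X Y X] by simp
    also have "\<dots> = X" using X XY by simp
    finally have e: "X *\<^sub>v ?w = X *\<^sub>v ?u" .
    have "X *\<^sub>v (?w - ?u) = X *\<^sub>v ?w - X *\<^sub>v ?u"
      using X w by (intro mult_minus_distrib_mat_vec) auto
    also have "\<dots> = 0\<^sub>v n" unfolding e using X by (intro eq_vecI) auto
    finally have "?w - ?u \<in> K" unfolding K_def using w by auto
    then have "?w - ?u = 0\<^sub>v m" using K by simp
    then have "?w = ?u" using vec_minus_eq_zero[OF w unit_vec_carrier] by blast
    then show "(Y * X) *\<^sub>v ?u = 1\<^sub>m m *\<^sub>v ?u" by simp
  qed (use X Y in auto)
  show thesis using that Y XY YX by blast
qed

lemma schur_characters_eq: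
  assumes G: "group G" and \<rho>: "irreducible_rep G n \<rho>" and \<sigma>: "irreducible_rep G m \<sigma>"
    and X: "X \<in> carrier_mat n m" and comm: "\<And>g. g \<in> carrier G \<Longrightarrow> \<rho> g * X = X * \<sigma> g"
    and X0: "X \<noteq> 0\<^sub>m n m"
  shows "character_of G \<rho> = character_of G \<sigma>"
proof -
  obtain Y where Y: "Y \<in> carrier_mat m n" and XY: "X * Y = 1\<^sub>m n" and YX: "Y * X = 1\<^sub>m m"
    by (rule schur_invertible[OF assms])
  have "mat_trace (\<rho> g) = mat_trace (\<sigma> g)" if g: "g \<in> carrier G" for g
  proof -
    have \<rho>c: "\<rho> g \<in> carrier_mat n n" and \<sigma>c: "\<sigma> g \<in> carrier_mat m m"
      using \<rho> \<sigma> g by (auto simp: irreducible_rep_iff[OF G] matrix_rep_def)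
    have "\<rho> g = \<rho> g * (X * Y)" using XY \<rho>c by simp
    also have "\<dots> = (\<rho> g * X) * Y" using assoc_mult_mat[OF \<rho>c X Y] by simp
    also have "\<dots> = X * (\<sigma> g * Y)" using comm[OF g] assoc_mult_mat[OF X \<sigma>c Y] by simp
    finally have "mat_trace (\<rho> g) = mat_trace ((\<sigma> g * Y) * X)"
      using trace_mult_comm[OF X, of "\<sigma> g * Y"] \<sigma>c Y by simp
    also have "(\<sigma> g * Y) * X = \<sigma> g * (Y * X)" using assoc_mult_mat[OF \<sigma>c Y X] .
    finally show ?thesis using YX \<sigma>c by simp
  qed
  then show ?thesis by (auto simp: character_of_def restrict_def)
qed

text \<open>Subtract an eigenvalue: the difference still intertwines and is not invertible, so it vanishes.\<close>

lemma schur_scalar: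
  assumes G: "group G" and \<rho>: "irreducible_rep G n \<rho>"
    and X: "X \<in> carrier_mat n n" and comm: "\<And>g. g \<in> carrier G \<Longrightarrow> \<rho> g * X = X * \<rho> g"
  obtains c where "X = c \<cdot>\<^sub>m 1\<^sub>m n"
proof -
  have n: "n > 0" using \<rho> by (simp add: irreducible_rep_def)
  obtain c where "eigenvalue X c"
    using spectrum_non_empty[OF X n] by (auto simp: spectrum_def)
  then obtain v where v: "v \<in> carrier_vec n" "v \<noteq> 0\<^sub>v n" "X *\<^sub>v v = c \<cdot>\<^sub>v v"
    using X by (auto simp: eigenvalue_def eigenvector_def)
  define Z where "Z = X - c \<cdot>\<^sub>m 1\<^sub>m n"
  have Z: "Z \<in> carrier_mat n n" using X by (auto simp: Z_def intro!: minus_carrier_mat)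
  have Zc: "\<rho> g * Z = Z * \<rho> g" if g: "g \<in> carrier G" for g
  proof -
    have \<rho>c: "\<rho> g \<in> carrier_mat n n"
      using \<rho> g by (auto simp: irreducible_rep_iff[OF G] matrix_rep_def)
    have "\<rho> g * Z = \<rho> g * X - \<rho> g * (c \<cdot>\<^sub>m 1\<^sub>m n)"
      unfolding Z_def using \<rho>c X by (intro mult_minus_distrib_mat) auto
    also have "\<rho> g * (c \<cdot>\<^sub>m 1\<^sub>m n) = (c \<cdot>\<^sub>m 1\<^sub>m n) * \<rho> g"
      proof -
      have "\<rho> g * (c \<cdot>\<^sub>m 1\<^sub>m n) = c \<cdot>\<^sub>m (\<rho> g * 1\<^sub>m n)"
        by (rule mult_smult_distrib[OF \<rho>c, of _ n]) simp
      moreover have "(c \<cdot>\<^sub>m 1\<^sub>m n) * \<rho> g = c \<cdot>\<^sub>m (1\<^sub>m n * \<rho> g)"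
        by (rule mult_smult_assoc_mat[OF _ \<rho>c, of _ n]) simp
      ultimately show ?thesis using \<rho>c by simp
    qed
    also have "\<rho> g * X = X * \<rho> g" using comm[OF g] .
    also have "X * \<rho> g - (c \<cdot>\<^sub>m 1\<^sub>m n) * \<rho> g = Z * \<rho> g"
      unfolding Z_def using \<rho>c X by (intro minus_mult_distrib_mat[symmetric]) auto
    finally show ?thesis .
  qed
  have Zv: "Z *\<^sub>v v = 0\<^sub>v n"
  proof -
    have "Z *\<^sub>v v = X *\<^sub>v v - (c \<cdot>\<^sub>m 1\<^sub>m n) *\<^sub>v v"
      unfolding Z_def using X v by (intro minus_mult_distrib_mat_vec) auto
    also have "(c \<cdot>\<^sub>m 1\<^sub>m n) *\<^sub>v v = c \<cdot>\<^sub>v v" using v by (intro eq_vecI) (auto)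
    finally show ?thesis using v by auto
  qed
  have "Z = 0\<^sub>m n n"
  proof (rule ccontr)
    assume "Z \<noteq> 0\<^sub>m n n"
    then obtain Y where Y: "Y \<in> carrier_mat n n" "Y * Z = 1\<^sub>m n"
      using schur_invertible[OF G \<rho> \<rho> Z Zc] by blast
    have "v = (Y * Z) *\<^sub>v v" using Y v by simp
    also have "\<dots> = Y *\<^sub>v (Z *\<^sub>v v)" by (rule assoc_mult_mat_vec[OF Y(1) Z v(1)])
    also have "\<dots> = 0\<^sub>v n" unfolding Zv using Y by (intro eq_vecI) auto
    finally show False using v by simp
  qed
  then have "X = c \<cdot>\<^sub>m 1\<^sub>m n" using X unfolding Z_def by (auto simp: mat_eq_iff)
  then show thesis by (rule that)
qed

locale finite_group = group +
  assumes fin [simp]: "finite (carrier G)"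
begin

abbreviation (input) "N\<^sub>G \<equiv> of_nat (card (carrier G)) :: complex"

lemma carrier_not_empty [simp]: "carrier G \<noteq> {}" using one_closed by blast

lemma card_pos: "card (carrier G) > 0" using one_closed by (auto simp: card_gt_0_iff)

lemma sum_reindex_mult: "h \<in> carrier G \<Longrightarrow> (\<Sum>g\<in>carrier G. f (h \<otimes> g)) = (\<Sum>g\<in>carrier G. f g)"
  for f :: "'a \<Rightarrow> complex"
  by (rule sum.reindex_bij_witness[of _ "\<lambda>g. inv h \<otimes> g" "\<lambda>g. h \<otimes> g"])
     (auto simp: m_assoc[symmetric])

lemma sum_reindex_inv: "(\<Sum>g\<in>carrier G. f (inv g)) = (\<Sum>g\<in>carrier G. f g)"
  for f :: "'a \<Rightarrow> complex"
  by (rule sum.reindex_bij_witness[of _ "\<lambda>g. inv g" "\<lambda>g. inv g"]) auto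

lemma rep_entry:
  assumes "matrix_rep G n \<rho>" "g \<in> carrier G" "h \<in> carrier G" "i < n" "j < n"
  shows "\<rho> (g \<otimes> h) $$ (i,j) = (\<Sum>l<n. \<rho> g $$ (i,l) * \<rho> h $$ (l,j))"
proof -
  have "\<rho> g \<in> carrier_mat n n" "\<rho> h \<in> carrier_mat n n" "\<rho> (g \<otimes> h) = \<rho> g * \<rho> h"
    using assms by (auto simp: matrix_rep_def)
  then show ?thesis using assms by (simp add: scalar_prod_def atLeast0LessThan)
qed

text \<open>Averaging the matrix unit \<open>E\<^sub>j\<^sub>k\<close> over the group, \<open>X = \<Sum> \<rho> g * E\<^sub>j\<^sub>k * \<sigma> (inv g)\<close>, gives an intertwiner.\<close>

lemma coefficient_intertwiner:
  assumes \<rho>: "matrix_rep G n \<rho>" and \<sigma>: "matrix_rep G m \<sigma>" and j: "j < n" and k: "k < m"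
    and h: "h \<in> carrier G"
  defines "X \<equiv> mat n m (\<lambda>(i,l). \<Sum>g\<in>carrier G. \<rho> g $$ (i,j) * \<sigma> (inv g) $$ (k,l))"
  shows "\<rho> h * X = X * \<sigma> h"
proof (rule eq_matI)
  have \<rho>c: "\<rho> h \<in> carrier_mat n n" and \<sigma>c: "\<sigma> h \<in> carrier_mat m m"
    using \<rho> \<sigma> h by (auto simp: matrix_rep_def)
  fix i l assume "i < dim_row (X * \<sigma> h)" "l < dim_col (X * \<sigma> h)"
  then have i: "i < n" and l: "l < m" using \<sigma>c by (auto simp: X_def)
  have "(\<rho> h * X) $$ (i,l) = (\<Sum>q<n. \<rho> h $$ (i,q) * (\<Sum>g\<in>carrier G. \<rho> g $$ (q,j) * \<sigma> (inv g) $$ (k,l)))"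
    using i l \<rho>c by (simp add: X_def scalar_prod_def atLeast0LessThan)
  also have "\<dots> = (\<Sum>g\<in>carrier G. (\<Sum>q<n. \<rho> h $$ (i,q) * \<rho> g $$ (q,j)) * \<sigma> (inv g) $$ (k,l))"
    by (simp add: sum_distrib_left sum_distrib_right mult.assoc) (rule sum.swap)
  also have "\<dots> = (\<Sum>g\<in>carrier G. \<rho> (h \<otimes> g) $$ (i,j) * \<sigma> (inv g) $$ (k,l))"
    using rep_entry[OF \<rho> h _ i j] by simp
  also have "\<dots> = (\<Sum>g\<in>carrier G. \<rho> (h \<otimes> g) $$ (i,j) * \<sigma> (inv (h \<otimes> g) \<otimes> h) $$ (k,l))"
    using h by (intro sum.cong) (auto simp: inv_mult_group m_assoc)
  also have "\<dots> = (\<Sum>g\<in>carrier G. \<rho> g $$ (i,j) * \<sigma> (inv g \<otimes> h) $$ (k,l))"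
    using sum_reindex_mult[OF h, of "\<lambda>g. \<rho> g $$ (i,j) * \<sigma> (inv g \<otimes> h) $$ (k,l)"] .
  also have "\<dots> = (\<Sum>g\<in>carrier G. \<rho> g $$ (i,j) * (\<Sum>q<m. \<sigma> (inv g) $$ (k,q) * \<sigma> h $$ (q,l)))"
    using rep_entry[OF \<sigma> _ h k l] by simp
  also have "\<dots> = (\<Sum>q<m. (\<Sum>g\<in>carrier G. \<rho> g $$ (i,j) * \<sigma> (inv g) $$ (k,q)) * \<sigma> h $$ (q,l))"
    by (simp add: sum_distrib_left sum_distrib_right mult.assoc) (rule sum.swap)
  also have "\<dots> = (X * \<sigma> h) $$ (i,l)"
    using i l \<sigma>c by (simp add: X_def scalar_prod_def atLeast0LessThan)
  finally show "(\<rho> h * X) $$ (i,l) = (X * \<sigma> h) $$ (i,l)" .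
qed (use \<rho> \<sigma> h in \<open>auto simp: X_def matrix_rep_def\<close>)

lemma irreducible_repD: "irreducible_rep G n \<rho> \<Longrightarrow> matrix_rep G n \<rho>" "irreducible_rep G n \<rho> \<Longrightarrow> n > 0"
  by (auto simp: irreducible_rep_iff[OF is_group])

lemma schur_orthogonality_distinct:
  assumes \<rho>: "irreducible_rep G n \<rho>" and \<sigma>: "irreducible_rep G m \<sigma>"
    and ne: "character_of G \<rho> \<noteq> character_of G \<sigma>" and "i < n" "j < n" "k < m" "l < m"
  shows "(\<Sum>g\<in>carrier G. \<rho> g $$ (i,j) * \<sigma> (inv g) $$ (k,l)) = 0"
proof -
  let ?X = "mat n m (\<lambda>(i,l). \<Sum>g\<in>carrier G. \<rho> g $$ (i,j) * \<sigma> (inv g) $$ (k,l))"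
  have "?X = 0\<^sub>m n m"
    using schur_characters_eq[OF is_group \<rho> \<sigma>, of ?X] ne
      coefficient_intertwiner[OF irreducible_repD(1)[OF \<rho>] irreducible_repD(1)[OF \<sigma>] assms(5,6)] by auto
  then have "?X $$ (i,l) = 0\<^sub>m n m $$ (i,l)" by (rule arg_cong)
  then show ?thesis using assms by simp
qed

text \<open>The intertwiner is a scalar by Schur's lemma, and its trace determines the scalar.\<close>

lemma schur_orthogonality_same:
  assumes \<rho>: "irreducible_rep G n \<rho>" and ij: "i < n" "j < n" "k < n" "l < n"
  shows "(\<Sum>g\<in>carrier G. \<rho> g $$ (i,j) * \<rho> (inv g) $$ (k,l)) = (if i = l \<and> j = k then N\<^sub>G / of_nat n else 0)"
proof -
  note r = irreducible_repD(1)[OF \<rho>] and n = irreducible_repD(2)[OF \<rho>]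
  let ?f = "\<lambda>i l. \<Sum>g\<in>carrier G. \<rho> g $$ (i,j) * \<rho> (inv g) $$ (k,l)"
  let ?X = "mat n n (\<lambda>(i,l). ?f i l)"
  have X: "?X \<in> carrier_mat n n" by simp
  obtain c where c: "?X = c \<cdot>\<^sub>m 1\<^sub>m n"
    by (rule schur_scalar[OF is_group \<rho> X coefficient_intertwiner[OF r r ij(2,3)]])
  have entry: "?f i l = (if i = l then c else 0)" if "i < n" "l < n" for i l
  proof -
    have "?X $$ (i,l) = (c \<cdot>\<^sub>m 1\<^sub>m n) $$ (i,l)" using c by (rule arg_cong)
    then show ?thesis using that by simp
  qed
  have "of_nat n * c = (\<Sum>i<n. ?f i i)" using entry by simp
  also have "\<dots> = (\<Sum>g\<in>carrier G. \<Sum>i<n. \<rho> (inv g) $$ (k,i) * \<rho> g $$ (i,j))"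
    by (subst sum.swap) (simp add: mult.commute)
  also have "\<dots> = (\<Sum>g\<in>carrier G. \<rho> (inv g \<otimes> g) $$ (k,j))"
    by (intro sum.cong refl) (simp only: rep_entry[OF r _ _ ij(3,2)] inv_closed)
  also have "\<dots> = (\<Sum>g\<in>carrier G. if j = k then 1 else 0)"
    using r ij by (intro sum.cong) (auto simp: matrix_rep_def)
  also have "\<dots> = (if j = k then N\<^sub>G else 0)" by simp
  finally have "c = (if j = k then N\<^sub>G / of_nat n else 0)" using n by (auto simp: field_simps)
  then show ?thesis using entry[OF ij(1,4)] by simp
qed

lemma IrrE:
  assumes "\<chi> \<in> Irr G"
  obtains n \<rho> where "irreducible_rep G n \<rho>" "\<chi> = character_of G \<rho>"
    "\<And>g. g \<in> carrier G \<Longrightarrow> \<chi> g = (\<Sum>i<n. \<rho> g $$ (i,i))"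
proof -
  obtain n \<rho> where r: "irreducible_rep G n \<rho>" "\<chi> = character_of G \<rho>" using assms by (auto simp: Irr_def)
  then have "\<chi> g = (\<Sum>i<n. \<rho> g $$ (i,i))" if "g \<in> carrier G" for g
    using that irreducible_repD(1)[OF r(1)] by (auto simp: character_of_def mat_trace_def matrix_rep_def)
  then show thesis using that r by blast
qed

lemma Irr_orthogonal:
  assumes "\<chi> \<in> Irr G" "\<psi> \<in> Irr G"
  shows "(\<Sum>g\<in>carrier G. \<chi> g * \<psi> (inv g)) = (if \<chi> = \<psi> then N\<^sub>G else 0)"
proof -
  obtain n \<rho> where \<rho>: "irreducible_rep G n \<rho>" "\<chi> = character_of G \<rho>"
    and \<chi>: "\<And>g. g \<in> carrier G \<Longrightarrow> \<chi> g = (\<Sum>i<n. \<rho> g $$ (i,i))" by (rule IrrE[OF assms(1)]) metis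
  have ex: "\<exists>m \<sigma>. irreducible_rep G m \<sigma> \<and> \<psi> = character_of G \<sigma> \<and>
      (\<forall>g\<in>carrier G. \<psi> g = (\<Sum>i<m. \<sigma> g $$ (i,i))) \<and> (\<chi> = \<psi> \<longrightarrow> m = n \<and> \<sigma> = \<rho>)"
  proof (cases "\<chi> = \<psi>")
    case True then show ?thesis using \<rho> \<chi> by blast
  next
    case False then show ?thesis using IrrE[OF assms(2)] by metis
  qed
  then obtain m \<sigma> where \<sigma>: "irreducible_rep G m \<sigma>" "\<psi> = character_of G \<sigma>"
    and \<psi>: "\<And>g. g \<in> carrier G \<Longrightarrow> \<psi> g = (\<Sum>i<m. \<sigma> g $$ (i,i))" and same: "\<chi> = \<psi> \<Longrightarrow> m = n \<and> \<sigma> = \<rho>"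
    by blast
  have "(\<Sum>g\<in>carrier G. \<chi> g * \<psi> (inv g)) =
      (\<Sum>g\<in>carrier G. \<Sum>i<n. \<Sum>k<m. \<rho> g $$ (i,i) * \<sigma> (inv g) $$ (k,k))"
    by (intro sum.cong) (auto simp: \<chi> \<psi> sum_product)
  also have "\<dots> = (\<Sum>i<n. \<Sum>k<m. \<Sum>g\<in>carrier G. \<rho> g $$ (i,i) * \<sigma> (inv g) $$ (k,k))"
    by (subst sum.swap) (intro sum.cong refl, rule sum.swap)
  also have "\<dots> = (if \<chi> = \<psi> then N\<^sub>G else 0)"
  proof (cases "\<chi> = \<psi>")
    case True
    then have "m = n" "\<sigma> = \<rho>" using same by auto
    then have "(\<Sum>i<n. \<Sum>k<m. \<Sum>g\<in>carrier G. \<rho> g $$ (i,i) * \<sigma> (inv g) $$ (k,k)) =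
      (\<Sum>i<n. \<Sum>k<n. if i = k then N\<^sub>G / of_nat n else 0)"
      using schur_orthogonality_same[OF \<rho>(1)] by (intro sum.cong) auto
    then show ?thesis using True irreducible_repD(2)[OF \<rho>(1)] by simp
  next
    case False
    then show ?thesis using schur_orthogonality_distinct[OF \<rho>(1) \<sigma>(1)] \<rho>(2) \<sigma>(2) by simp
  qed
  finally show ?thesis .
qed

lemma Irr_one: assumes "\<chi> \<in> Irr G" shows "\<chi> \<one> = of_nat (char_degree G \<chi>)" "char_degree G \<chi> > 0"
proof -
  show e: "\<chi> \<one> = of_nat (char_degree G \<chi>)" using of_nat_char_degree[OF is_group assms] by simp
  obtain n \<rho> where \<rho>: "irreducible_rep G n \<rho>"
    and \<chi>: "\<And>g. g \<in> carrier G \<Longrightarrow> \<chi> g = (\<Sum>i<n. \<rho> g $$ (i,i))" using IrrE[OF assms] by metis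
  have "\<chi> \<one> = of_nat n" using \<chi>[of \<one>] irreducible_repD(1)[OF \<rho>] by (simp add: matrix_rep_def)
  then show "char_degree G \<chi> > 0" using e irreducible_repD(2)[OF \<rho>] by simp
qed

text \<open>Averaging \<open>\<rho> b\<close> over conjugation gives the scalar matrix with entry \<open>\<chi> b / \<chi> 1\<close>.\<close>

lemma Irr_conj_sum:
  assumes "\<chi> \<in> Irr G" and a: "a \<in> carrier G" and b: "b \<in> carrier G"
  shows "(\<Sum>x\<in>carrier G. \<chi> (a \<otimes> (x \<otimes> b \<otimes> inv x))) = N\<^sub>G * \<chi> a * \<chi> b / \<chi> \<one>"
proof -
  obtain n \<rho> where \<rho>: "irreducible_rep G n \<rho>"
    and \<chi>: "\<And>g. g \<in> carrier G \<Longrightarrow> \<chi> g = (\<Sum>i<n. \<rho> g $$ (i,i))" using IrrE[OF assms(1)] by metis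
  note r = irreducible_repD(1)[OF \<rho>]
  have "\<chi> (a \<otimes> (x \<otimes> b \<otimes> inv x)) = (\<Sum>i<n. \<Sum>p<n. \<Sum>j<n. \<Sum>k<n.
      \<rho> a $$ (i,p) * \<rho> b $$ (j,k) * (\<rho> x $$ (p,j) * \<rho> (inv x) $$ (k,i)))" if x: "x \<in> carrier G" for x
  proof -
    have 1: "\<rho> (x \<otimes> b \<otimes> inv x) $$ (p,i) = (\<Sum>j<n. \<Sum>k<n. \<rho> b $$ (j,k) * (\<rho> x $$ (p,j) * \<rho> (inv x) $$ (k,i)))"
      if "p < n" "i < n" for p i
    proof -
      have "\<rho> (x \<otimes> b \<otimes> inv x) $$ (p,i) = (\<Sum>k<n. (\<Sum>j<n. \<rho> x $$ (p,j) * \<rho> b $$ (j,k)) * \<rho> (inv x) $$ (k,i))"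
        using x b that by (simp add: rep_entry[OF r])
      also have "\<dots> = (\<Sum>k<n. \<Sum>j<n. \<rho> b $$ (j,k) * (\<rho> x $$ (p,j) * \<rho> (inv x) $$ (k,i)))"
        by (simp add: sum_distrib_right sum_distrib_left mult_ac)
      also have "\<dots> = (\<Sum>j<n. \<Sum>k<n. \<rho> b $$ (j,k) * (\<rho> x $$ (p,j) * \<rho> (inv x) $$ (k,i)))" by (rule sum.swap)
      finally show ?thesis .
    qed
    have "\<chi> (a \<otimes> (x \<otimes> b \<otimes> inv x)) = (\<Sum>i<n. \<Sum>p<n. \<rho> a $$ (i,p) * \<rho> (x \<otimes> b \<otimes> inv x) $$ (p,i))"
      using x a b by (simp add: \<chi> rep_entry[OF r a, of "x \<otimes> b \<otimes> inv x"])
    also have "\<dots> = (\<Sum>i<n. \<Sum>p<n. \<Sum>j<n. \<Sum>k<n. \<rho> a $$ (i,p) * \<rho> b $$ (j,k) * (\<rho> x $$ (p,j) * \<rho> (inv x) $$ (k,i)))"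
      by (intro sum.cong refl) (simp add: 1 sum_distrib_left mult.assoc)
    finally show ?thesis .
  qed
  then have "(\<Sum>x\<in>carrier G. \<chi> (a \<otimes> (x \<otimes> b \<otimes> inv x))) =
     (\<Sum>x\<in>carrier G. \<Sum>i<n. \<Sum>p<n. \<Sum>j<n. \<Sum>k<n.
      \<rho> a $$ (i,p) * \<rho> b $$ (j,k) * (\<rho> x $$ (p,j) * \<rho> (inv x) $$ (k,i)))" by simp
  also have "\<dots> = (\<Sum>i<n. \<Sum>p<n. \<Sum>j<n. \<Sum>k<n. \<Sum>x\<in>carrier G.
      \<rho> a $$ (i,p) * \<rho> b $$ (j,k) * (\<rho> x $$ (p,j) * \<rho> (inv x) $$ (k,i)))"
    by (simp only: sum.swap[of _ _ "carrier G"])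
  also have "\<dots> = (\<Sum>i<n. \<Sum>p<n. \<Sum>j<n. \<Sum>k<n.
      \<rho> a $$ (i,p) * \<rho> b $$ (j,k) * (if p = i \<and> j = k then N\<^sub>G / of_nat n else 0))"
    by (intro sum.cong refl) (simp add: sum_distrib_left[symmetric] schur_orthogonality_same[OF \<rho>])
  also have "\<dots> = (\<Sum>i<n. \<Sum>p<n. if p = i then \<rho> a $$ (i,p) * (\<Sum>j<n. \<rho> b $$ (j,j)) * (N\<^sub>G / of_nat n) else 0)"
  proof (intro sum.cong refl)
    fix i p assume "i \<in> {..<n}" "p \<in> {..<n}"
    have "(\<Sum>j<n. \<Sum>k<n. \<rho> a $$ (i,p) * \<rho> b $$ (j,k) * (if p = i \<and> j = k then N\<^sub>G / of_nat n else 0))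
      = (\<Sum>j<n. \<Sum>k<n. if j = k then (if p = i then \<rho> a $$ (i,p) * \<rho> b $$ (j,k) * (N\<^sub>G / of_nat n) else 0) else 0)"
      by (intro sum.cong refl) auto
    also have "\<dots> = (\<Sum>j<n. (if p = i then \<rho> a $$ (i,p) * \<rho> b $$ (j,j) * (N\<^sub>G / of_nat n) else 0))"
      by simp
    also have "\<dots> = (if p = i then \<rho> a $$ (i,p) * (\<Sum>j<n. \<rho> b $$ (j,j)) * (N\<^sub>G / of_nat n) else 0)"
      by (simp add: sum_distrib_left sum_distrib_right sum_divide_distrib)
    finally show "(\<Sum>j<n. \<Sum>k<n. \<rho> a $$ (i,p) * \<rho> b $$ (j,k) * (if p = i \<and> j = k then N\<^sub>G / of_nat n else 0)) = \<dots>" .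
  qed
  also have "\<dots> = (\<Sum>i<n. \<rho> a $$ (i,i)) * (\<Sum>j<n. \<rho> b $$ (j,j)) * (N\<^sub>G / of_nat n)"
    by (simp add: sum_distrib_right sum_divide_distrib)
  also have "\<dots> = N\<^sub>G * \<chi> a * \<chi> b / \<chi> \<one>"
    using \<chi>[OF a] \<chi>[OF b] \<chi>[of \<one>] r by (simp add: matrix_rep_def)
  finally show ?thesis .
qed

text \<open>Up to a scalar, \<open>\<chi>\<close> is idempotent under convolution.\<close>

lemma Irr_convolution:
  assumes "\<chi> \<in> Irr G" and a: "a \<in> carrier G"
  shows "(\<Sum>y\<in>carrier G. \<chi> (a \<otimes> y) * \<chi> (inv y)) = N\<^sub>G * \<chi> a / \<chi> \<one>"
proof -
  obtain n \<rho> where \<rho>: "irreducible_rep G n \<rho>"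
    and \<chi>: "\<And>g. g \<in> carrier G \<Longrightarrow> \<chi> g = (\<Sum>i<n. \<rho> g $$ (i,i))" using IrrE[OF assms(1)] by metis
  note r = irreducible_repD(1)[OF \<rho>]
  have "\<chi> (a \<otimes> y) * \<chi> (inv y) = (\<Sum>i<n. \<Sum>j<n. \<Sum>k<n. \<rho> a $$ (i,j) * (\<rho> y $$ (j,i) * \<rho> (inv y) $$ (k,k)))"
    if y: "y \<in> carrier G" for y
  proof -
    have "\<chi> (a \<otimes> y) * \<chi> (inv y) = (\<Sum>i<n. \<Sum>j<n. \<rho> a $$ (i,j) * \<rho> y $$ (j,i)) * (\<Sum>k<n. \<rho> (inv y) $$ (k,k))"
      using y a by (simp add: \<chi> rep_entry[OF r])
    also have "\<dots> = (\<Sum>i<n. \<Sum>j<n. \<rho> a $$ (i,j) * \<rho> y $$ (j,i) * (\<Sum>k<n. \<rho> (inv y) $$ (k,k)))"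
      by (simp only: sum_distrib_right)
    finally show ?thesis by (simp only: sum_distrib_left mult.assoc)
  qed
  then have "(\<Sum>y\<in>carrier G. \<chi> (a \<otimes> y) * \<chi> (inv y)) =
     (\<Sum>y\<in>carrier G. \<Sum>i<n. \<Sum>j<n. \<Sum>k<n. \<rho> a $$ (i,j) * (\<rho> y $$ (j,i) * \<rho> (inv y) $$ (k,k)))" by simp
  also have "\<dots> = (\<Sum>i<n. \<Sum>j<n. \<Sum>k<n. \<Sum>y\<in>carrier G. \<rho> a $$ (i,j) * (\<rho> y $$ (j,i) * \<rho> (inv y) $$ (k,k)))"
    by (simp only: sum.swap[of _ _ "carrier G"])
  also have "\<dots> = (\<Sum>i<n. \<Sum>j<n. \<Sum>k<n. \<rho> a $$ (i,j) * (if j = k \<and> i = k then N\<^sub>G / of_nat n else 0))"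
    by (intro sum.cong refl) (simp add: sum_distrib_left[symmetric] schur_orthogonality_same[OF \<rho>])
  also have "\<dots> = (\<Sum>i<n. \<Sum>j<n. \<Sum>k<n. if k = i then (if j = i then \<rho> a $$ (i,i) * (N\<^sub>G / of_nat n) else 0) else 0)"
    by (intro sum.cong refl) auto
  also have "\<dots> = (\<Sum>i<n. \<rho> a $$ (i,i)) * (N\<^sub>G / of_nat n)"
    by (simp add: sum_distrib_right sum_divide_distrib)
  also have "\<dots> = N\<^sub>G * \<chi> a / \<chi> \<one>"
    using \<chi>[OF a] \<chi>[of \<one>] r by (simp add: matrix_rep_def)
  finally show ?thesis .
qed

end

section \<open>The regular character\<close>

lemma sum_list_eq_sum_count_list:
  fixes f :: "'a \<Rightarrow> complex"
  assumes "finite A" "set xs \<subseteq> A"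
  shows "(\<Sum>x\<leftarrow>xs. f x) = (\<Sum>x\<in>A. of_nat (count_list xs x) * f x)"
  using assms(2)
proof (induction xs)
  case (Cons y xs)
  have "(\<Sum>x\<in>A. of_nat (count_list (y # xs) x) * f x)
    = (\<Sum>x\<in>A. (if x = y then f x else 0) + of_nat (count_list xs x) * f x)"
    by (intro sum.cong) (auto simp: algebra_simps)
  also have "\<dots> = f y + (\<Sum>x\<in>A. of_nat (count_list xs x) * f x)"
    using Cons.prems assms(1) by (simp add: sum.distrib)
  finally show ?case using Cons by simp
qed simp

text \<open>Bilinear, with \<open>h (inv g)\<close> in place of the complex conjugate of \<open>h g\<close>; the two agree for characters.\<close>

definition char_inner :: "('a, 'b) monoid_scheme \<Rightarrow> ('a \<Rightarrow> complex) \<Rightarrow> ('a \<Rightarrow> complex) \<Rightarrow> complex" where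
  "char_inner G f h = (\<Sum>g\<in>carrier G. f g * h (inv\<^bsub>G\<^esub> g)) / of_nat (card (carrier G))"

context finite_group
begin

lemma regular_representation:
  obtains \<rho> where "matrix_rep G (card (carrier G)) \<rho>"
    "\<And>g. g \<in> carrier G \<Longrightarrow> mat_trace (\<rho> g) = (if g = \<one> then N\<^sub>G else 0)"
proof -
  define n where "n = card (carrier G)"
  obtain e where e: "bij_betw e {..<n} (carrier G)"
    using ex_bij_betw_nat_finite[OF fin] by (auto simp: n_def atLeast0LessThan)
  have eG: "e i \<in> carrier G" if "i < n" for i using e that by (auto simp: bij_betw_def)
  have einj: "e i = e j \<longleftrightarrow> i = j" if "i < n" "j < n" for i j
    using e that by (auto simp: bij_betw_def inj_on_def)
  have esurj: "\<exists>i<n. e i = g" if "g \<in> carrier G" for g using e that by (force simp: bij_betw_def)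
  define \<rho> :: "'a \<Rightarrow> complex mat" where
    "\<rho> g = mat n n (\<lambda>(i,j). if e i = g \<otimes> e j then 1 else 0)" for g
  have "matrix_rep G n \<rho>" unfolding matrix_rep_def
  proof (intro conjI ballI)
    fix g h assume g: "g \<in> carrier G" and h: "h \<in> carrier G"
    show "\<rho> (g \<otimes> h) = \<rho> g * \<rho> h"
    proof (rule eq_matI)
      fix i j assume "i < dim_row (\<rho> g * \<rho> h)" "j < dim_col (\<rho> g * \<rho> h)"
      then have ij: "i < n" "j < n" by (auto simp: \<rho>_def)
      obtain q where q: "q < n" "e q = h \<otimes> e j" using esurj h eG[OF ij(2)] by blast
      have "(\<rho> g * \<rho> h) $$ (i,j) =
          (\<Sum>l<n. (if e i = g \<otimes> e l then 1 else 0) * (if e l = h \<otimes> e j then 1 else 0))"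
        using ij by (simp add: \<rho>_def scalar_prod_def atLeast0LessThan)
      also have "\<dots> = (\<Sum>l<n. if l = q then (if e i = g \<otimes> e q then 1 else 0) else 0)"
        using q einj by (intro sum.cong) (auto simp flip: q(2))
      also have "\<dots> = \<rho> (g \<otimes> h) $$ (i,j)"
        using q ij g h eG by (simp add: \<rho>_def m_assoc)
      finally show "\<rho> (g \<otimes> h) $$ (i,j) = (\<rho> g * \<rho> h) $$ (i,j)" by simp
    qed (auto simp: \<rho>_def)
  next
    show "\<rho> \<one> = 1\<^sub>m n" by (rule eq_matI) (auto simp: \<rho>_def eG einj)
  qed (auto simp: \<rho>_def)
  moreover have "mat_trace (\<rho> g) = (if g = \<one> then N\<^sub>G else 0)" if g: "g \<in> carrier G" for g
  proof -
    have "e i = g \<otimes> e i \<longleftrightarrow> g = \<one>" if "i < n" for i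
      using g eG[OF that] by (metis r_cancel_one)
    then have "mat_trace (\<rho> g) = (\<Sum>i<n. if g = \<one> then 1 else 0)"
      by (auto simp: mat_trace_def \<rho>_def intro!: sum.cong)
    then show ?thesis by (simp add: n_def)
  qed
  ultimately show thesis using that unfolding n_def by blast
qed

lemma sum_list_orthogonality:
  assumes "set xs \<subseteq> Irr G" "\<chi> \<in> Irr G"
  shows "(\<Sum>g\<in>carrier G. (\<Sum>\<psi>\<leftarrow>xs. \<psi> g) * \<chi> (inv g)) = N\<^sub>G * of_nat (count_list xs \<chi>)"
  using assms(1)
proof (induction xs)
  case (Cons \<psi> xs)
  then have "\<psi> \<in> Irr G" by simp
  then show ?case using Cons Irr_orthogonal[OF \<open>\<psi> \<in> Irr G\<close> assms(2)]
    by (auto simp: distrib_right distrib_left sum.distrib)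
qed simp

text \<open>The multiplicity of \<open>\<chi>\<close> in the regular character is \<open>\<chi> 1\<close>, since the regular character vanishes off
  the identity.  This is positive, so every irreducible character occurs among the finitely many
  composition factors; in particular there are only finitely many.\<close>

lemma regular_character_list:
  obtains xs where "set xs = Irr G"
    "\<And>\<chi>. \<chi> \<in> Irr G \<Longrightarrow> of_nat (count_list xs \<chi>) = \<chi> \<one>"
    "\<And>g. g \<in> carrier G \<Longrightarrow> (\<Sum>\<chi>\<leftarrow>xs. \<chi> g) = (if g = \<one> then N\<^sub>G else 0)"
proof -
  obtain \<rho> where \<rho>: "matrix_rep G (card (carrier G)) \<rho>"
    and tr: "\<And>g. g \<in> carrier G \<Longrightarrow> mat_trace (\<rho> g) = (if g = \<one> then N\<^sub>G else 0)"
    by (rule regular_representation) metis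
  obtain xs where xs: "set xs \<subseteq> Irr G" "\<And>g. g \<in> carrier G \<Longrightarrow> mat_trace (\<rho> g) = (\<Sum>\<chi>\<leftarrow>xs. \<chi> g)"
    using rep_trace_decomposition[OF is_group \<rho>] by blast
  have s: "(\<Sum>\<chi>\<leftarrow>xs. \<chi> g) = (if g = \<one> then N\<^sub>G else 0)" if "g \<in> carrier G" for g
    using xs(2) tr that by simp
  have c: "of_nat (count_list xs \<chi>) = \<chi> \<one>" if \<chi>: "\<chi> \<in> Irr G" for \<chi>
  proof -
    have "N\<^sub>G * of_nat (count_list xs \<chi>) = (\<Sum>g\<in>carrier G. (if g = \<one> then N\<^sub>G else 0) * \<chi> (inv g))"
      using sum_list_orthogonality[OF xs(1) \<chi>] s by simp
    also have "\<dots> = (\<Sum>g\<in>carrier G. if g = \<one> then N\<^sub>G * \<chi> \<one> else 0)"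
      by (intro sum.cong) auto
    also have "\<dots> = N\<^sub>G * \<chi> \<one>" by simp
    finally show ?thesis using card_pos by simp
  qed
  have "\<chi> \<in> set xs" if "\<chi> \<in> Irr G" for \<chi>
  proof (rule ccontr)
    assume "\<chi> \<notin> set xs"
    then have "count_list xs \<chi> = 0" by simp
    then show False using c[OF that] Irr_one[OF that] by simp
  qed
  then show thesis using that[of xs] xs(1) c s by blast
qed

lemma finite_Irr [simp]: "finite (Irr G)"
  using regular_character_list by (metis List.finite_set)

lemma sum_degree_Irr:
  assumes "g \<in> carrier G"
  shows "(\<Sum>\<chi>\<in>Irr G. \<chi> \<one> * \<chi> g) = (if g = \<one> then N\<^sub>G else 0)"
proof -
  obtain xs where xs: "set xs = Irr G"
    "\<And>\<chi>. \<chi> \<in> Irr G \<Longrightarrow> of_nat (count_list xs \<chi>) = \<chi> \<one>"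
    "\<And>g. g \<in> carrier G \<Longrightarrow> (\<Sum>\<chi>\<leftarrow>xs. \<chi> g) = (if g = \<one> then N\<^sub>G else 0)"
    by (rule regular_character_list) metis
  have "(\<Sum>\<chi>\<leftarrow>xs. \<chi> g) = (\<Sum>\<chi>\<in>Irr G. of_nat (count_list xs \<chi>) * \<chi> g)"
    using xs(1) by (intro sum_list_eq_sum_count_list) auto
  also have "\<dots> = (\<Sum>\<chi>\<in>Irr G. \<chi> \<one> * \<chi> g)" using xs(2) by (intro sum.cong) auto
  finally show ?thesis using xs(3)[OF assms] by simp
qed

lemma sum_degree_squares: "(\<Sum>\<chi>\<in>Irr G. (char_degree G \<chi>)\<^sup>2) = card (carrier G)"
proof -
  have "of_nat (\<Sum>\<chi>\<in>Irr G. (char_degree G \<chi>)\<^sup>2) = (\<Sum>\<chi>\<in>Irr G. \<chi> \<one> * \<chi> \<one>)"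
    by (simp add: Irr_one power2_eq_square)
  also have "\<dots> = of_nat (card (carrier G))" using sum_degree_Irr[of \<one>] by simp
  finally show ?thesis using of_nat_eq_iff by blast
qed

lemma char_inner_Irr:
  "\<chi> \<in> Irr G \<Longrightarrow> \<psi> \<in> Irr G \<Longrightarrow> char_inner G \<chi> \<psi> = (if \<chi> = \<psi> then 1 else 0)"
  using Irr_orthogonal card_pos by (simp add: char_inner_def)

text \<open>Multiplicities are natural numbers, and orthogonality recovers them from the character alone.\<close>

lemma rep_character_expansion:
  assumes "matrix_rep G n \<rho>"
  obtains m :: "('a \<Rightarrow> complex) \<Rightarrow> nat" where
    "\<And>g. g \<in> carrier G \<Longrightarrow> mat_trace (\<rho> g) = (\<Sum>\<chi>\<in>Irr G. of_nat (m \<chi>) * \<chi> g)"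
    "\<And>\<chi>. \<chi> \<in> Irr G \<Longrightarrow> char_inner G (\<lambda>g. mat_trace (\<rho> g)) \<chi> = of_nat (m \<chi>)"
proof -
  obtain xs where xs: "set xs \<subseteq> Irr G" "\<And>g. g \<in> carrier G \<Longrightarrow> mat_trace (\<rho> g) = (\<Sum>\<chi>\<leftarrow>xs. \<chi> g)"
    using rep_trace_decomposition[OF is_group assms] by blast
  show thesis
  proof (rule that[of "count_list xs"])
    fix g assume "g \<in> carrier G"
    then show "mat_trace (\<rho> g) = (\<Sum>\<chi>\<in>Irr G. of_nat (count_list xs \<chi>) * \<chi> g)"
      using xs sum_list_eq_sum_count_list[OF finite_Irr xs(1), of "\<lambda>\<chi>. \<chi> g"] by simp
  next
    fix \<chi> assume "\<chi> \<in> Irr G"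
    then show "char_inner G (\<lambda>g. mat_trace (\<rho> g)) \<chi> = of_nat (count_list xs \<chi>)"
      using sum_list_orthogonality[OF xs(1)] xs(2) card_pos by (simp add: char_inner_def)
  qed
qed

lemma Irr_class_function:
  assumes "\<chi> \<in> Irr G" "g \<in> carrier G" "h \<in> carrier G"
  shows "\<chi> (g \<otimes> h) = \<chi> (h \<otimes> g)"
proof -
  obtain n \<rho> where \<rho>: "irreducible_rep G n \<rho>" "\<chi> = character_of G \<rho>" using IrrE[OF assms(1)] by metis
  have "\<rho> g \<in> carrier_mat n n" "\<rho> h \<in> carrier_mat n n" "\<rho> (g \<otimes> h) = \<rho> g * \<rho> h" "\<rho> (h \<otimes> g) = \<rho> h * \<rho> g"
    using irreducible_repD(1)[OF \<rho>(1)] assms by (auto simp: matrix_rep_def)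
  then show ?thesis using \<rho>(2) assms trace_mult_comm[of "\<rho> g" n n "\<rho> h"] by (simp add: character_of_def)
qed

text \<open>Evaluate the regular character at \<open>a \<otimes> (x \<otimes> b \<otimes> inv x)\<close> and average over \<open>x\<close>; by \<open>Irr_conj_sum\<close> the
  degrees cancel.\<close>

lemma column_orthogonality:
  assumes a: "a \<in> carrier G" and b: "b \<in> carrier G"
  shows "(\<Sum>\<chi>\<in>Irr G. \<chi> a * \<chi> b) = (\<Sum>x\<in>carrier G. if a \<otimes> (x \<otimes> b \<otimes> inv x) = \<one> then 1 else 0)"
proof -
  have "N\<^sub>G * (\<Sum>\<chi>\<in>Irr G. \<chi> a * \<chi> b) = (\<Sum>\<chi>\<in>Irr G. \<chi> \<one> * (\<Sum>x\<in>carrier G. \<chi> (a \<otimes> (x \<otimes> b \<otimes> inv x))))"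
    unfolding sum_distrib_left
  proof (intro sum.cong refl)
    fix \<chi> assume \<chi>: "\<chi> \<in> Irr G"
    have "\<chi> \<one> \<noteq> 0" using Irr_one[OF \<chi>] by simp
    then show "N\<^sub>G * (\<chi> a * \<chi> b) = (\<Sum>x\<in>carrier G. \<chi> \<one> * \<chi> (a \<otimes> (x \<otimes> b \<otimes> inv x)))"
      unfolding sum_distrib_left[symmetric] Irr_conj_sum[OF \<chi> a b] by simp
  qed
  also have "\<dots> = (\<Sum>x\<in>carrier G. \<Sum>\<chi>\<in>Irr G. \<chi> \<one> * \<chi> (a \<otimes> (x \<otimes> b \<otimes> inv x)))"
    unfolding sum_distrib_left by (rule sum.swap)
  also have "\<dots> = (\<Sum>x\<in>carrier G. N\<^sub>G * (if a \<otimes> (x \<otimes> b \<otimes> inv x) = \<one> then 1 else 0))"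
    using a b by (intro sum.cong refl) (simp add: sum_degree_Irr)
  finally show ?thesis using card_pos by (simp add: sum_distrib_left[symmetric])
qed

end

section \<open>Degrees divide the group order\<close>

text \<open>The characteristic polynomial is monic with integer coefficients.\<close>

lemma algebraic_int_eigenvalue_int_mat:
  fixes A :: "int mat" and c :: complex
  assumes A: "A \<in> carrier_mat n n" and v: "v \<in> carrier_vec n" "v \<noteq> 0\<^sub>v n"
    and e: "map_mat of_int A *\<^sub>v v = c \<cdot>\<^sub>v v"
  shows "algebraic_int c"
proof -
  let ?A = "map_mat of_int A :: complex mat"
  have A': "?A \<in> carrier_mat n n" using A by simp
  have "eigenvalue ?A c" unfolding eigenvalue_def eigenvector_def using A v e by auto
  then have "poly (char_poly ?A) c = 0" using eigenvalue_root_char_poly[OF A'] by simp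
  then have "poly (of_int_poly (char_poly A)) c = 0"
    using of_int_hom.char_poly_hom[OF A, where 'a = complex] by simp
  moreover have "monic (char_poly A)" using degree_monic_char_poly[OF A] by simp
  ultimately show ?thesis unfolding algebraic_int_altdef_ipoly by blast
qed

context finite_group
begin

text \<open>Frobenius' commutator count: the sum of all commutators acts on an irreducible representation as the
  scalar \<open>(|G| / \<chi> 1)\<^sup>2\<close>.  The coefficients of this sum are integers, whereas the element
  \<open>\<Sum>y. \<chi> (inv y) * y\<close>, which acts as \<open>|G| / \<chi> 1\<close>, has character values as coefficients.\<close>

lemma commutator_character_sum:
  assumes \<chi>: "\<chi> \<in> Irr G" and g: "g \<in> carrier G"
  shows "(\<Sum>y\<in>carrier G. \<Sum>x\<in>carrier G. \<chi> (g \<otimes> (x \<otimes> y \<otimes> inv x \<otimes> inv y))) = (N\<^sub>G / \<chi> \<one>)\<^sup>2 * \<chi> g"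
proof -
  have "(\<Sum>x\<in>carrier G. \<chi> (g \<otimes> (x \<otimes> y \<otimes> inv x \<otimes> inv y))) = N\<^sub>G / \<chi> \<one> * (\<chi> (g \<otimes> inv y) * \<chi> (inv (inv y)))"
    if y: "y \<in> carrier G" for y
  proof -
    have "\<chi> (g \<otimes> (x \<otimes> y \<otimes> inv x \<otimes> inv y)) = \<chi> ((inv y \<otimes> g) \<otimes> (x \<otimes> y \<otimes> inv x))" if x: "x \<in> carrier G" for x
      using Irr_class_function[OF \<chi>, of "g \<otimes> (x \<otimes> y \<otimes> inv x)" "inv y"] g x y by (simp add: m_assoc)
    then have "(\<Sum>x\<in>carrier G. \<chi> (g \<otimes> (x \<otimes> y \<otimes> inv x \<otimes> inv y))) =
        (\<Sum>x\<in>carrier G. \<chi> ((inv y \<otimes> g) \<otimes> (x \<otimes> y \<otimes> inv x)))" by simp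
    also have "\<dots> = N\<^sub>G * \<chi> (inv y \<otimes> g) * \<chi> y / \<chi> \<one>"
      using Irr_conj_sum[OF \<chi>, of "inv y \<otimes> g" y] g y by simp
    finally show ?thesis using Irr_class_function[OF \<chi>, of "inv y" g] g y by simp
  qed
  then have "(\<Sum>y\<in>carrier G. \<Sum>x\<in>carrier G. \<chi> (g \<otimes> (x \<otimes> y \<otimes> inv x \<otimes> inv y))) =
     N\<^sub>G / \<chi> \<one> * (\<Sum>y\<in>carrier G. \<chi> (g \<otimes> inv y) * \<chi> (inv (inv y)))"
    by (simp add: sum_distrib_left)
  also have "(\<Sum>y\<in>carrier G. \<chi> (g \<otimes> inv y) * \<chi> (inv (inv y))) = (\<Sum>y\<in>carrier G. \<chi> (g \<otimes> y) * \<chi> (inv y))"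
    by (rule sum_reindex_inv)
  also have "\<dots> = N\<^sub>G * \<chi> g / \<chi> \<one>" by (rule Irr_convolution[OF \<chi> g])
  finally show ?thesis by (simp add: power2_eq_square)
qed

text \<open>By \<open>commutator_character_sum\<close>, \<open>(|G| / \<chi> 1)\<^sup>2\<close> is an eigenvalue of an integer matrix, with the
  values of \<open>\<chi>\<close> as eigenvector.  It is rational, hence an integer.\<close>

theorem char_degree_dvd_order:
  assumes \<chi>: "\<chi> \<in> Irr G"
  shows "char_degree G \<chi> dvd card (carrier G)"
proof -
  define n where "n = card (carrier G)"
  define d where "d = char_degree G \<chi>"
  have d: "\<chi> \<one> = of_nat d" "d > 0" using Irr_one[OF \<chi>] by (auto simp: d_def)
  obtain e where e: "bij_betw e {..<n} (carrier G)"
    using ex_bij_betw_nat_finite[OF fin] by (auto simp: n_def atLeast0LessThan)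
  have eG: "e i \<in> carrier G" if "i < n" for i using e that by (auto simp: bij_betw_def)
  \<comment> \<open>The matrix counts the commutators that carry one group element to another.\<close>
  define A where "A = mat n n (\<lambda>(i,j). \<Sum>y\<in>carrier G. \<Sum>x\<in>carrier G.
     if e i \<otimes> (x \<otimes> y \<otimes> inv x \<otimes> inv y) = e j then 1 else (0::int))"
  define v where "v = vec n (\<lambda>i. \<chi> (e i))"
  define c where "c = (of_nat n / of_nat d :: complex)\<^sup>2"
  have A: "A \<in> carrier_mat n n" and v: "v \<in> carrier_vec n" by (auto simp: A_def v_def)
  have v0: "v \<noteq> 0\<^sub>v n"
  proof
    assume 0: "v = 0\<^sub>v n"
    obtain i where "i < n" "e i = \<one>" using e by (metis bij_betw_imp_surj_on imageE lessThan_iff one_closed)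
    then have "\<chi> \<one> = 0" using arg_cong[OF 0, of "\<lambda>w. w $ i"] by (simp add: v_def)
    then show False using d by simp
  qed
  have "map_mat of_int A *\<^sub>v v = c \<cdot>\<^sub>v v"
  proof (rule eq_vecI)
    fix i assume "i < dim_vec (c \<cdot>\<^sub>v v)"
    then have i: "i < n" by (simp add: v_def)
    have "(map_mat of_int A *\<^sub>v v) $ i = (\<Sum>j<n. of_int (A $$ (i,j)) * \<chi> (e j))"
      using i by (simp add: A_def v_def scalar_prod_def atLeast0LessThan)
    also have "\<dots> = (\<Sum>j<n. (\<lambda>h. (\<Sum>y\<in>carrier G. \<Sum>x\<in>carrier G.
        if e i \<otimes> (x \<otimes> y \<otimes> inv x \<otimes> inv y) = h then 1 else 0) * \<chi> h) (e j))"
      using i by (intro sum.cong refl) (auto simp: A_def of_int_sum intro!: sum.cong)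
    also have "\<dots> = (\<Sum>h\<in>carrier G. (\<Sum>y\<in>carrier G. \<Sum>x\<in>carrier G.
        if e i \<otimes> (x \<otimes> y \<otimes> inv x \<otimes> inv y) = h then 1 else 0) * \<chi> h)"
      by (rule sum.reindex_bij_betw[OF e])
    also have "\<dots> = (\<Sum>h\<in>carrier G. \<Sum>y\<in>carrier G. \<Sum>x\<in>carrier G.
        if e i \<otimes> (x \<otimes> y \<otimes> inv x \<otimes> inv y) = h then \<chi> h else 0)"
      by (simp add: sum_distrib_right if_distrib[of "\<lambda>t. t * _"] cong: if_cong)
    also have "\<dots> = (\<Sum>y\<in>carrier G. \<Sum>h\<in>carrier G. \<Sum>x\<in>carrier G.
        if e i \<otimes> (x \<otimes> y \<otimes> inv x \<otimes> inv y) = h then \<chi> h else 0)"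
      by (rule sum.swap)
    also have "\<dots> = (\<Sum>y\<in>carrier G. \<Sum>x\<in>carrier G. \<Sum>h\<in>carrier G.
        if e i \<otimes> (x \<otimes> y \<otimes> inv x \<otimes> inv y) = h then \<chi> h else 0)"
      by (rule sum.cong[OF refl]) (rule sum.swap)
    also have "\<dots> = (\<Sum>y\<in>carrier G. \<Sum>x\<in>carrier G. \<chi> (e i \<otimes> (x \<otimes> y \<otimes> inv x \<otimes> inv y)))"
      using eG[OF i] by (intro sum.cong refl) simp
    also have "\<dots> = c * \<chi> (e i)"
      using commutator_character_sum[OF \<chi> eG[OF i]] d by (simp add: c_def n_def)
    finally show "(map_mat of_int A *\<^sub>v v) $ i = (c \<cdot>\<^sub>v v) $ i" using i by (simp add: v_def)
  qed (auto simp: A_def v_def)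
  then have "algebraic_int c" by (rule algebraic_int_eigenvalue_int_mat[OF A v v0])
  moreover have "c \<in> \<rat>" by (simp add: c_def)
  ultimately have "c \<in> \<int>" by (rule rational_algebraic_int_is_int)
  then obtain k where k: "c = of_int k" by (auto elim: Ints_cases)
  have "of_int (int n ^ 2) = (of_int (k * int d ^ 2) :: complex)"
    using k d(2) by (simp add: c_def field_simps power_divide)
  then have "int n ^ 2 = k * int d ^ 2" by (simp only: of_int_eq_iff)
  then have "int d ^ 2 dvd int n ^ 2" by simp
  then have "int d dvd int n" by (simp add: pow_divides_pow_iff)
  then show ?thesis by (simp add: n_def d_def)
qed

end

section \<open>Linear characters\<close>

definition linear_chars :: "('a, 'b) monoid_scheme \<Rightarrow> ('a \<Rightarrow> complex) set" where
  "linear_chars G = {\<chi> \<in> Irr G. char_degree G \<chi> = 1}"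

context finite_group
begin

lemma linear_chars_iff:
  "\<theta> \<in> linear_chars G \<longleftrightarrow> \<theta> \<in> extensional (carrier G) \<and> \<theta> \<one> = 1 \<and>
     (\<forall>g\<in>carrier G. \<forall>h\<in>carrier G. \<theta> (g \<otimes> h) = \<theta> g * \<theta> h)"
proof
  assume l: "\<theta> \<in> linear_chars G"
  then have \<chi>: "\<theta> \<in> Irr G" and d: "\<theta> \<one> = 1" using Irr_one(1)[of \<theta>] by (auto simp: linear_chars_def)
  obtain n \<rho> where \<rho>: "irreducible_rep G n \<rho>" and c: "\<theta> = character_of G \<rho>"
    and e: "\<And>g. g \<in> carrier G \<Longrightarrow> \<theta> g = (\<Sum>i<n. \<rho> g $$ (i,i))" using IrrE[OF \<chi>] by metis
  note r = irreducible_repD(1)[OF \<rho>]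
  have "of_nat n = (1::complex)" using e[of \<one>] r d by (simp add: matrix_rep_def)
  then have n: "n = 1" by simp
  have "\<theta> (g \<otimes> h) = \<theta> g * \<theta> h" if "g \<in> carrier G" "h \<in> carrier G" for g h
    using that e n rep_entry[OF r that, of 0 0] by simp
  then show "\<theta> \<in> extensional (carrier G) \<and> \<theta> \<one> = 1 \<and>
     (\<forall>g\<in>carrier G. \<forall>h\<in>carrier G. \<theta> (g \<otimes> h) = \<theta> g * \<theta> h)"
    using d c by (simp add: character_of_def)
next
  assume l: "\<theta> \<in> extensional (carrier G) \<and> \<theta> \<one> = 1 \<and>
     (\<forall>g\<in>carrier G. \<forall>h\<in>carrier G. \<theta> (g \<otimes> h) = \<theta> g * \<theta> h)"
  define \<rho> :: "'a \<Rightarrow> complex mat" where "\<rho> g = mat 1 1 (\<lambda>_. \<theta> g)" for g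
  have r: "matrix_rep G 1 \<rho>" unfolding matrix_rep_def
    using l by (auto simp: \<rho>_def scalar_prod_def intro!: eq_matI)
  have "W = {0\<^sub>v 1} \<or> W = carrier_vec 1" if W: "invariant_subspace G 1 \<rho> W" for W
  proof (cases "W \<subseteq> {0\<^sub>v 1}")
    case True
    then show ?thesis using W by (auto simp: invariant_subspace_iff)
  next
    case False
    then obtain w where w: "w \<in> W" "w \<noteq> 0\<^sub>v 1" by blast
    then have wc: "w \<in> carrier_vec 1" using W by (auto simp: invariant_subspace_iff)
    have w0: "w $ 0 \<noteq> 0"
    proof
      assume "w $ 0 = 0"
      then have "w = 0\<^sub>v 1" using wc by (intro eq_vecI) auto
      then show False using w by simp
    qed
    have "v \<in> W" if v: "v \<in> carrier_vec 1" for v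
    proof -
      have "v = (v $ 0 / w $ 0) \<cdot>\<^sub>v w" using v wc w0 by (intro eq_vecI) auto
      then show ?thesis using W w(1) by (metis invariant_subspace_iff)
    qed
    then show ?thesis using W by (auto simp: invariant_subspace_iff)
  qed
  then have "irreducible_rep G 1 \<rho>" using r by (simp add: irreducible_rep_iff[OF is_group])
  moreover have "\<theta> = character_of G \<rho>"
    using l by (intro extensionalityI[of _ "carrier G"]) (auto simp: character_of_def mat_trace_def \<rho>_def)
  ultimately have i: "\<theta> \<in> Irr G" by (auto simp: Irr_def)
  moreover have "of_nat (char_degree G \<theta>) = (1::complex)" using Irr_one(1)[OF i] l by simp
  ultimately show "\<theta> \<in> linear_chars G" unfolding linear_chars_def by simp
qed

lemma linear_charD:
  assumes "\<theta> \<in> linear_chars G"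
  shows "\<theta> \<in> Irr G" "\<theta> \<one> = 1" "\<And>g h. g \<in> carrier G \<Longrightarrow> h \<in> carrier G \<Longrightarrow> \<theta> (g \<otimes> h) = \<theta> g * \<theta> h"
    "\<And>g. g \<in> carrier G \<Longrightarrow> \<theta> g \<noteq> 0" "\<And>g. g \<in> carrier G \<Longrightarrow> \<theta> (inv g) = inverse (\<theta> g)"
    "\<theta> \<in> extensional (carrier G)"
proof -
  show 1: "\<theta> \<in> Irr G" using assms by (auto simp: linear_chars_def)
  show 2: "\<theta> \<one> = 1" "\<theta> \<in> extensional (carrier G)" using assms linear_chars_iff by auto
  show 3: "\<theta> (g \<otimes> h) = \<theta> g * \<theta> h" if "g \<in> carrier G" "h \<in> carrier G" for g h
    using assms linear_chars_iff that by auto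
  have 4: "\<theta> g * \<theta> (inv g) = 1" if "g \<in> carrier G" for g
    using 3[of g "inv g"] 2 that by simp
  show "\<theta> g \<noteq> 0" if "g \<in> carrier G" for g using 4[OF that] by auto
  show "\<theta> (inv g) = inverse (\<theta> g)" if "g \<in> carrier G" for g using 4[OF that] by (metis inverse_unique)
qed

lemma linear_char_pow:
  assumes "\<theta> \<in> linear_chars G" "g \<in> carrier G"
  shows "\<theta> (g [^] (k::nat)) = \<theta> g ^ k"
  using linear_charD[OF assms(1)] assms(2) by (induction k) auto

text \<open>In a commutative group the conjugation average is trivial, so \<open>\<chi> a * \<chi> (inv a) = (\<chi> 1)\<^sup>2\<close> for all
  \<open>a\<close>; summing over \<open>a\<close> and using orthogonality gives \<open>(\<chi> 1)\<^sup>2 = 1\<close>.\<close>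

lemma Irr_linear_of_commutative:
  assumes comm: "\<And>g h. g \<in> carrier G \<Longrightarrow> h \<in> carrier G \<Longrightarrow> g \<otimes> h = h \<otimes> g"
  shows "linear_chars G = Irr G"
proof -
  have "char_degree G \<chi> = 1" if \<chi>: "\<chi> \<in> Irr G" for \<chi>
  proof -
    have nz: "\<chi> \<one> \<noteq> 0" using Irr_one[OF \<chi>] by simp
    have sq: "\<chi> a * \<chi> (inv a) = \<chi> \<one> * \<chi> \<one>" if a: "a \<in> carrier G" for a
    proof -
      have "a \<otimes> (x \<otimes> inv a \<otimes> inv x) = \<one>" if "x \<in> carrier G" for x
        using a that comm[of x "inv a"] by (simp add: m_assoc)
      then have "(\<Sum>x\<in>carrier G. \<chi> (a \<otimes> (x \<otimes> inv a \<otimes> inv x))) = N\<^sub>G * \<chi> \<one>" by simp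
      then have "N\<^sub>G * \<chi> \<one> = N\<^sub>G * \<chi> a * \<chi> (inv a) / \<chi> \<one>"
        using Irr_conj_sum[OF \<chi> a, of "inv a"] a by simp
      then show ?thesis using nz by (simp add: field_simps)
    qed
    have "N\<^sub>G = (\<Sum>a\<in>carrier G. \<chi> a * \<chi> (inv a))" using Irr_orthogonal[OF \<chi> \<chi>] by simp
    also have "\<dots> = N\<^sub>G * (\<chi> \<one> * \<chi> \<one>)" using sq by simp
    finally have "\<chi> \<one> * \<chi> \<one> = 1" by simp
    then have "of_nat (char_degree G \<chi> * char_degree G \<chi>) = (1::complex)" using Irr_one(1)[OF \<chi>] by simp
    then show ?thesis by (metis of_nat_1 of_nat_eq_iff nat_mult_eq_1_iff)
  qed
  then show ?thesis by (auto simp: linear_chars_def)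
qed

lemma linear_char_trivial_on_derived:
  assumes l: "\<theta> \<in> linear_chars G" and d: "d \<in> derived G (carrier G)"
  shows "\<theta> d = 1"
proof -
  note L = linear_charD[OF l]
  have "subgroup {g \<in> carrier G. \<theta> g = 1} G"
    by (rule subgroupI) (use L in \<open>auto intro!: exI[of _ \<one>]\<close>)
  moreover have "derived_set G (carrier G) \<subseteq> {g \<in> carrier G. \<theta> g = 1}"
  proof
    fix x assume "x \<in> derived_set G (carrier G)"
    then obtain a b where ab: "a \<in> carrier G" "b \<in> carrier G" "x = a \<otimes> b \<otimes> inv a \<otimes> inv b" by auto
    then have "\<theta> x = \<theta> a * \<theta> b * inverse (\<theta> a) * inverse (\<theta> b)" using L(3,5) by simp
    also have "\<dots> = 1" using L(4)[OF ab(1)] L(4)[OF ab(2)] by (simp add: field_simps)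
    finally show "x \<in> {g \<in> carrier G. \<theta> g = 1}" using ab by simp
  qed
  ultimately have "derived G (carrier G) \<subseteq> {g \<in> carrier G. \<theta> g = 1}"
    unfolding derived_def by (rule generate_subgroup_incl[rotated])
  then show ?thesis using d by blast
qed

lemma inflate_linear_char:
  assumes N: "N \<lhd> G" and l: "\<psi> \<in> linear_chars (G Mod N)"
  shows "restrict (\<lambda>g. \<psi> (N #> g)) (carrier G) \<in> linear_chars G"
proof -
  interpret N: normal N G by fact
  interpret Q: group "G Mod N" by (rule N.factorgroup_is_group)
  have c: "carrier (G Mod N) = (\<lambda>x. N #> x) ` carrier G" by (rule carrier_FactGroup)
  interpret Q: finite_group "G Mod N" by unfold_locales (simp add: c)
  have L: "\<psi> N = 1" "\<And>C D. C \<in> carrier (G Mod N) \<Longrightarrow> D \<in> carrier (G Mod N) \<Longrightarrow> \<psi> (C <#> D) = \<psi> C * \<psi> D"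
    using Q.linear_charD[OF l] by auto
  have "\<psi> (N #> (g \<otimes> h)) = \<psi> (N #> g) * \<psi> (N #> h)" if "g \<in> carrier G" "h \<in> carrier G" for g h
    using L(2)[of "N #> g" "N #> h"] that N.rcos_sum[of g h] c by simp
  moreover have "N #> \<one> = N" using N.subset by simp
  ultimately show ?thesis unfolding linear_chars_iff using L(1) by simp
qed

lemma finite_group_FactGroup: assumes "N \<lhd> G" shows "finite_group (G Mod N)"
proof -
  interpret N: normal N G by fact
  interpret Q: group "G Mod N" by (rule N.factorgroup_is_group)
  show ?thesis by unfold_locales (simp add: carrier_FactGroup)
qed

text \<open>Linear characters are trivial on the derived subgroup \<open>D\<close>, so they are those of the abelianization.
  There all irreducible characters are linear, and the sum of the squares of the degrees
  counts them.\<close>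

lemma card_linear_chars: "card (linear_chars G) = group_index G (derived G (carrier G))"
proof -
  let ?D = "derived G (carrier G)"
  have D: "?D \<lhd> G" using derived_is_normal[OF normal_self] by simp
  interpret D: normal ?D G by fact
  interpret Q: finite_group "G Mod ?D" by (rule finite_group_FactGroup[OF D])
  interpret Qc: comm_group "G Mod ?D" by (rule derived_quot_is_comm_group)
  have c: "carrier (G Mod ?D) = (\<lambda>x. ?D #> x) ` carrier G" by (rule carrier_FactGroup)
  have all: "linear_chars (G Mod ?D) = Irr (G Mod ?D)"
    by (rule Q.Irr_linear_of_commutative) (use Qc.m_comm in blast)
  have "(\<Sum>\<chi>\<in>Irr (G Mod ?D). (char_degree (G Mod ?D) \<chi>)\<^sup>2) = (\<Sum>\<chi>\<in>Irr (G Mod ?D). 1)"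
    using all by (intro sum.cong) (auto simp: linear_chars_def)
  then have 1: "card (linear_chars (G Mod ?D)) = card (carrier (G Mod ?D))"
    using Q.sum_degree_squares all by simp
  define \<Phi> where "\<Phi> \<psi> = restrict (\<lambda>g. \<psi> (?D #> g)) (carrier G)" for \<psi> :: "'a set \<Rightarrow> complex"
  have "bij_betw \<Phi> (linear_chars (G Mod ?D)) (linear_chars G)"
  proof (rule bij_betw_imageI)
    show "inj_on \<Phi> (linear_chars (G Mod ?D))"
    proof (rule inj_onI)
      fix \<psi> \<psi>' assume p: "\<psi> \<in> linear_chars (G Mod ?D)" "\<psi>' \<in> linear_chars (G Mod ?D)" and eq: "\<Phi> \<psi> = \<Phi> \<psi>'"
      have "\<psi> C = \<psi>' C" if C: "C \<in> carrier (G Mod ?D)" for C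
      proof -
        obtain g where g: "g \<in> carrier G" "C = ?D #> g" using C unfolding c by blast
        then show ?thesis using fun_cong[OF eq, of g] by (simp add: \<Phi>_def)
      qed
      then show "\<psi> = \<psi>'"
        using Q.linear_charD(6)[OF p(1)] Q.linear_charD(6)[OF p(2)] by (rule extensionalityI[rotated 2]) auto
    qed
    show "\<Phi> ` linear_chars (G Mod ?D) = linear_chars G"
    proof (intro equalityI subsetI)
      fix \<theta> assume "\<theta> \<in> \<Phi> ` linear_chars (G Mod ?D)"
      then show "\<theta> \<in> linear_chars G" unfolding \<Phi>_def using inflate_linear_char[OF D] by blast
    next
      fix \<theta> assume l: "\<theta> \<in> linear_chars G"
      note L = linear_charD[OF l]
      \<comment> \<open>\<open>\<theta>\<close> is constant on cosets, so the representative does not matter.\<close>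
      define \<psi> where "\<psi> = restrict (\<lambda>C. \<theta> (SOME g. g \<in> C)) (carrier (G Mod ?D))"
      have \<psi>: "\<psi> (?D #> g) = \<theta> g" if g: "g \<in> carrier G" for g
      proof -
        have "g \<in> ?D #> g" using rcos_self[OF g D.is_subgroup] .
        then have "(SOME x. x \<in> ?D #> g) \<in> ?D #> g" by (rule someI)
        then obtain d where "d \<in> ?D" "(SOME x. x \<in> ?D #> g) = d \<otimes> g" by (auto simp: r_coset_def)
        then have "\<theta> (SOME x. x \<in> ?D #> g) = \<theta> g"
          using L(3)[of d g] g linear_char_trivial_on_derived[OF l] D.subset by auto
        then show ?thesis using g c by (simp add: \<psi>_def)
      qed
      have "\<psi> \<in> linear_chars (G Mod ?D)" unfolding Q.linear_chars_iff
      proof (intro conjI ballI)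
        show "\<psi> \<in> extensional (carrier (G Mod ?D))" by (simp add: \<psi>_def)
        have "?D #> \<one> = ?D" using D.subset by simp
        then show "\<psi> \<one>\<^bsub>G Mod ?D\<^esub> = 1" using \<psi>[of \<one>] L(2) by simp
        fix A B assume "A \<in> carrier (G Mod ?D)" "B \<in> carrier (G Mod ?D)"
        then obtain a b where "a \<in> carrier G" "b \<in> carrier G" "A = ?D #> a" "B = ?D #> b"
          unfolding c by (elim imageE)
        then show "\<psi> (A \<otimes>\<^bsub>G Mod ?D\<^esub> B) = \<psi> A * \<psi> B"
          using D.rcos_sum[of a b] \<psi> L(3) by simp
      qed
      moreover have "\<Phi> \<psi> = \<theta>"
        unfolding \<Phi>_def using \<psi> L(6) by (intro extensionalityI[of _ "carrier G"]) auto
      ultimately show "\<theta> \<in> \<Phi> ` linear_chars (G Mod ?D)" by blast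
    qed
  qed
  then have "card (linear_chars (G Mod ?D)) = card (linear_chars G)" by (rule bij_betw_same_card)
  then show ?thesis using 1 by (simp add: group_index_def FactGroup_def)
qed

text \<open>Cauchy's theorem in the group of linear characters under pointwise multiplication.\<close>

lemma linear_char_of_order_p:
  assumes p: "prime p" and dvd: "p dvd card (linear_chars G)"
  obtains \<omega> where "\<omega> \<in> linear_chars G" "\<And>g. g \<in> carrier G \<Longrightarrow> \<omega> g ^ p = 1"
    "\<exists>g\<in>carrier G. \<omega> g \<noteq> 1"
proof -
  define L where "L = \<lparr>carrier = linear_chars G, monoid.mult = \<lambda>f (g :: _ \<Rightarrow> complex). restrict (\<lambda>x. f x * g x) (carrier G),
    one = restrict (\<lambda>x. 1 :: complex) (carrier G)\<rparr>"
  have fL: "finite (carrier L)" unfolding L_def linear_chars_def by simp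
  have "group L"
  proof (rule groupI)
    fix f assume f: "f \<in> carrier L"
    then have F: "f \<in> linear_chars G" by (simp add: L_def)
    have "restrict (\<lambda>x. inverse (f x)) (carrier G) \<in> linear_chars G"
      using linear_charD[OF F] unfolding linear_chars_iff by simp
    then have "restrict (\<lambda>x. inverse (f x)) (carrier G) \<in> carrier L" by (simp add: L_def)
    moreover have "restrict (\<lambda>x. inverse (f x)) (carrier G) \<otimes>\<^bsub>L\<^esub> f = \<one>\<^bsub>L\<^esub>"
      using linear_charD(4)[OF F] by (auto simp: L_def restrict_def)
    ultimately show "\<exists>y\<in>carrier L. y \<otimes>\<^bsub>L\<^esub> f = \<one>\<^bsub>L\<^esub>" by blast
    show "\<one>\<^bsub>L\<^esub> \<otimes>\<^bsub>L\<^esub> f = f"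
      using linear_charD(6)[OF F] by (auto simp: L_def intro!: extensionalityI[of _ "carrier G"])
  next
    fix f g assume "f \<in> carrier L" "g \<in> carrier L"
    then have F: "f \<in> linear_chars G" "g \<in> linear_chars G" by (auto simp: L_def)
    have "restrict (\<lambda>x. f x * g x) (carrier G) \<in> linear_chars G"
      using linear_charD(2,3)[OF F(1)] linear_charD(2,3)[OF F(2)] unfolding linear_chars_iff by simp
    then show "f \<otimes>\<^bsub>L\<^esub> g \<in> carrier L" by (simp add: L_def)
  next
    fix f g h assume "f \<in> carrier L" "g \<in> carrier L" "h \<in> carrier L"
    then show "f \<otimes>\<^bsub>L\<^esub> g \<otimes>\<^bsub>L\<^esub> h = f \<otimes>\<^bsub>L\<^esub> (g \<otimes>\<^bsub>L\<^esub> h)"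
      by (auto simp: L_def restrict_def mult.assoc)
  next
    show "\<one>\<^bsub>L\<^esub> \<in> carrier L" by (auto simp: L_def linear_chars_iff)
  qed
  then interpret L: group L .
  obtain m where m: "card (linear_chars G) = p * m" using dvd by blast
  have "Coset.order L = p ^ 1 * m" using m by (simp add: Coset.order_def L_def)
  then obtain S where S: "subgroup S L" "card S = p ^ 1" using sylow_thm[OF p L.is_group _ fL] by blast
  interpret S: group "L\<lparr>carrier := S\<rparr>" using S(1) L.subgroup_imp_group by blast
  have "card S > 1" using S(2) prime_gt_1_nat[OF p] by simp
  then have "\<not> S \<subseteq> {\<one>\<^bsub>L\<^esub>}" by (metis card.empty card_insert_disjoint card_mono finite.emptyI finite.insertI
     empty_iff One_nat_def linorder_not_less)
  then obtain \<omega> where \<omega>: "\<omega> \<in> S" "\<omega> \<noteq> \<one>\<^bsub>L\<^esub>" by blast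
  have \<omega>L: "\<omega> \<in> linear_chars G" using \<omega>(1) subgroup.subset[OF S(1)] by (auto simp: L_def)
  have "\<omega> [^]\<^bsub>L\<lparr>carrier := S\<rparr>\<^esub> Coset.order (L\<lparr>carrier := S\<rparr>) = \<one>\<^bsub>L\<lparr>carrier := S\<rparr>\<^esub>"
    by (rule S.pow_order_eq_1) (use \<omega> in simp)
  then have pw: "\<omega> [^]\<^bsub>L\<^esub> p = \<one>\<^bsub>L\<^esub>" using S(2) by (simp add: Coset.order_def nat_pow_def)
  have pk: "(\<omega> [^]\<^bsub>L\<^esub> k) g = \<omega> g ^ k" if "g \<in> carrier G" for g and k :: nat
    using that by (induction k) (auto simp: L_def)
  have "\<omega> g ^ p = 1" if "g \<in> carrier G" for g
  proof -
    have "\<omega> g ^ p = (\<omega> [^]\<^bsub>L\<^esub> p) g" using pk[OF that] by simp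
    also have "\<dots> = 1" unfolding pw using that by (simp add: L_def)
    finally show ?thesis .
  qed
  moreover have "\<exists>g\<in>carrier G. \<omega> g \<noteq> 1"
  proof (rule ccontr)
    assume "\<not> ?thesis"
    then have "\<omega> = \<one>\<^bsub>L\<^esub>" using linear_charD(6)[OF \<omega>L]
      by (auto simp: L_def intro!: extensionalityI[of _ "carrier G"])
    then show False using \<omega> by simp
  qed
  ultimately show thesis using that \<omega>L by blast
qed

end

section \<open>Restriction to the kernel of a linear character of prime order\<close>

text \<open>Multiplying a representation by nonzero scalars does not change its invariant subspaces.\<close>

lemma (in finite_group) twist_Irr:
  assumes l: "\<theta> \<in> linear_chars G" and \<chi>: "\<chi> \<in> Irr G"
  shows "restrict (\<lambda>g. \<theta> g * \<chi> g) (carrier G) \<in> Irr G"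
proof -
  note L = linear_charD[OF l]
  obtain n \<rho> where \<rho>: "irreducible_rep G n \<rho>" and c: "\<chi> = character_of G \<rho>" using IrrE[OF \<chi>] by metis
  note r = irreducible_repD(1)[OF \<rho>]
  have rc: "\<rho> g \<in> carrier_mat n n" if "g \<in> carrier G" for g using r that by (simp add: matrix_rep_def)
  define \<sigma> where "\<sigma> g = \<theta> g \<cdot>\<^sub>m \<rho> g" for g
  have "matrix_rep G n \<sigma>" unfolding matrix_rep_def
  proof (intro conjI ballI)
    fix g h assume g: "g \<in> carrier G" and h: "h \<in> carrier G"
    have "\<sigma> g * \<sigma> h = \<theta> g \<cdot>\<^sub>m (\<rho> g * (\<theta> h \<cdot>\<^sub>m \<rho> h))"
      unfolding \<sigma>_def using rc[OF g] rc[OF h] by (intro mult_smult_assoc_mat) auto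
    also have "\<rho> g * (\<theta> h \<cdot>\<^sub>m \<rho> h) = \<theta> h \<cdot>\<^sub>m (\<rho> g * \<rho> h)"
      using rc[OF g] rc[OF h] by (intro mult_smult_distrib) auto
    also have "\<theta> g \<cdot>\<^sub>m (\<theta> h \<cdot>\<^sub>m (\<rho> g * \<rho> h)) = \<sigma> (g \<otimes> h)"
      using r g h L(3)[OF g h] by (auto simp: \<sigma>_def matrix_rep_def intro!: eq_matI)
    finally show "\<sigma> (g \<otimes> h) = \<sigma> g * \<sigma> h" by simp
  qed (use r L(2) rc in \<open>auto simp: \<sigma>_def matrix_rep_def intro!: eq_matI\<close>)
  moreover have "W = {0\<^sub>v n} \<or> W = carrier_vec n" if W: "invariant_subspace G n \<sigma> W" for W
  proof -
    note W' = W[unfolded invariant_subspace_iff]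
    have "\<rho> g *\<^sub>v w \<in> W" if g: "g \<in> carrier G" and w: "w \<in> W" for g w
    proof -
      have wc: "w \<in> carrier_vec n" using W' w by blast
      have "\<sigma> g *\<^sub>v w = \<theta> g \<cdot>\<^sub>v (\<rho> g *\<^sub>v w)"
        unfolding \<sigma>_def using rc[OF g] wc by (intro eq_vecI) (auto simp: scalar_prod_def sum_distrib_left mult.assoc)
      then have "inverse (\<theta> g) \<cdot>\<^sub>v (\<sigma> g *\<^sub>v w) = \<rho> g *\<^sub>v w"
        using L(4)[OF g] by (simp add: smult_smult_assoc)
      then show ?thesis using W' g w by metis
    qed
    then have "invariant_subspace G n \<rho> W" using W' by (auto simp: invariant_subspace_iff)
    then show ?thesis using \<rho> by (auto simp: irreducible_rep_iff[OF is_group])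
  qed
  ultimately have "irreducible_rep G n \<sigma>" using irreducible_repD(2)[OF \<rho>] by (simp add: irreducible_rep_iff[OF is_group])
  moreover have "restrict (\<lambda>g. \<theta> g * \<chi> g) (carrier G) = character_of G \<sigma>"
  proof (rule extensionalityI[of _ "carrier G"])
    fix g assume g: "g \<in> carrier G"
    then show "restrict (\<lambda>g. \<theta> g * \<chi> g) (carrier G) g = character_of G \<sigma> g"
      using rc[OF g] by (simp add: c character_of_def mat_trace_def \<sigma>_def sum_distrib_left)
  qed (auto simp: character_of_def)
  ultimately show ?thesis by (auto simp: Irr_def)
qed

lemma (in finite_group) char_inner_commute: "char_inner G f h = char_inner G h f"
  using sum_reindex_inv[of "\<lambda>g. f g * h (inv g)"] by (simp add: char_inner_def mult.commute cong: sum.cong)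

lemma root_of_unity_coprime_exponents:
  fixes w :: complex
  assumes "coprime i p" "i > 0" "w ^ i = 1" "w ^ p = 1"
  shows "w = 1"
proof -
  obtain x y where "i * x = p * y + 1" using bezout_nat[of i p] assms(1,2) by auto
  then have "w ^ (i * x) = w ^ (p * y + 1)" by simp
  then show ?thesis using assms(3,4) by (simp add: power_mult power_add)
qed

locale prime_order_linear_char = finite_group +
  fixes p :: nat and \<omega> :: "'a \<Rightarrow> complex"
  assumes p: "prime p" and \<omega>: "\<omega> \<in> linear_chars G"
    and \<omega>p: "\<And>g. g \<in> carrier G \<Longrightarrow> \<omega> g ^ p = 1"
    and nontrivial: "\<exists>g\<in>carrier G. \<omega> g \<noteq> 1"
begin

definition "K = {g \<in> carrier G. \<omega> g = 1}"

abbreviation "GK \<equiv> G\<lparr>carrier := K\<rparr>"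

lemmas \<omega>D = linear_charD[OF \<omega>]

lemma K_subgroup: "subgroup K G"
  unfolding K_def by (rule subgroupI) (use \<omega>D(2,3,5) in \<open>auto intro!: exI[of _ \<one>]\<close>)

lemma K_sub: "h \<in> K \<Longrightarrow> h \<in> carrier G" by (simp add: K_def)

lemma K_conj: "g \<in> carrier G \<Longrightarrow> h \<in> K \<Longrightarrow> g \<otimes> h \<otimes> inv g \<in> K"
  using \<omega>D by (auto simp: K_def)

lemma finite_group_GK: "finite_group GK"
proof -
  interpret H: group GK by (rule subgroup_imp_group[OF K_subgroup])
  show ?thesis by unfold_locales (auto simp: K_def)
qed

sublocale H: finite_group GK by (rule finite_group_GK)

lemma inv_GK [simp]: "h \<in> K \<Longrightarrow> inv\<^bsub>GK\<^esub> h = inv h"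
  by (rule m_inv_consistent[OF K_subgroup])

lemma inv_K: "h \<in> K \<Longrightarrow> inv h \<in> K" by (rule subgroup.m_inv_closed[OF K_subgroup])

lemma one_K: "\<one> \<in> K" by (rule subgroup.one_closed[OF K_subgroup])

lemma sum_omega_powers: "g \<in> carrier G \<Longrightarrow> (\<Sum>i<p. \<omega> g ^ i) = (if g \<in> K then of_nat p else 0)"
  using \<omega>p[of g] by (auto simp: K_def geometric_sum)

text \<open>The powers of \<open>\<omega>\<close> average to the indicator function of \<open>K\<close>.\<close>

lemma sum_over_K:
  "of_nat p * (\<Sum>h\<in>K. f h) = (\<Sum>i<p. \<Sum>g\<in>carrier G. \<omega> g ^ i * f g)"
proof -
  have "(\<Sum>i<p. \<Sum>g\<in>carrier G. \<omega> g ^ i * f g) = (\<Sum>g\<in>carrier G. (\<Sum>i<p. \<omega> g ^ i) * f g)"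
    by (subst sum.swap) (simp add: sum_distrib_right)
  also have "\<dots> = (\<Sum>g\<in>carrier G. if g \<in> K then of_nat p * f g else 0)"
    by (intro sum.cong refl) (simp add: sum_omega_powers)
  also have "\<dots> = (\<Sum>g\<in>carrier G \<inter> K. of_nat p * f g)"
    by (rule sum.inter_restrict[symmetric]) simp
  also have "carrier G \<inter> K = K" by (auto simp: K_def)
  finally show ?thesis by (simp add: sum_distrib_left)
qed

lemma coprime_less_p: "0 < i \<Longrightarrow> i < p \<Longrightarrow> coprime i p"
  using p by (metis coprime_commute nat_dvd_not_less prime_imp_coprime)

text \<open>Only the trivial power of \<open>\<omega>\<close> has a nonzero sum over \<open>G\<close>.\<close>

lemma card_K: "card (carrier G) = p * card K"
proof -
  have "(\<Sum>g\<in>carrier G. \<omega> g ^ i) = (if i = 0 then N\<^sub>G else 0)" if i: "i < p" for i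
  proof (cases "i = 0")
    case False
    obtain g0 where g0: "g0 \<in> carrier G" "\<omega> g0 \<noteq> 1" using nontrivial by blast
    have "\<omega> g0 ^ i \<noteq> 1"
      using root_of_unity_coprime_exponents[OF coprime_less_p[OF _ i] _ _ \<omega>p[OF g0(1)]] False g0 by auto
    moreover have "(\<Sum>g\<in>carrier G. \<omega> g ^ i) = (\<Sum>g\<in>carrier G. \<omega> (g0 \<otimes> g) ^ i)"
      by (rule sum_reindex_mult[OF g0(1), symmetric])
    then have "(\<Sum>g\<in>carrier G. \<omega> g ^ i) = \<omega> g0 ^ i * (\<Sum>g\<in>carrier G. \<omega> g ^ i)"
      using \<omega>D(3)[OF g0(1)] by (simp add: power_mult_distrib flip: sum_distrib_left)
    ultimately show ?thesis using False by simp
  qed simp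
  then have "of_nat p * (\<Sum>h\<in>K. 1) = (\<Sum>i<p. if i = 0 then N\<^sub>G else 0)"
    using sum_over_K[of "\<lambda>_. 1"] by simp
  also have "\<dots> = N\<^sub>G" using prime_gt_0_nat[OF p] by simp
  finally have "of_nat (p * card K) = (N\<^sub>G :: complex)" by simp
  then show ?thesis using of_nat_eq_iff by metis
qed

lemma card_K_pos: "card K > 0" using H.card_pos by simp

lemma omega_power_twist:
  assumes \<chi>: "\<chi> \<in> Irr G"
  shows "restrict (\<lambda>g. \<omega> g ^ i * \<chi> g) (carrier G) \<in> Irr G"
proof -
  have "restrict (\<lambda>g. \<omega> g ^ i) (carrier G) \<in> linear_chars G"
    using \<omega>D(2,3) unfolding linear_chars_iff by (simp add: power_mult_distrib)
  from twist_Irr[OF this \<chi>] show ?thesis by (simp add: restrict_def cong: if_cong)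
qed

text \<open>By \<open>sum_over_K\<close> the inner product counts the \<open>i < p\<close> with \<open>\<omega>\<^sup>i * \<chi> = \<chi>\<close>.  If \<open>\<chi>\<close> vanishes off \<open>K\<close>, these
  are all \<open>i\<close>.  Otherwise a point off \<open>K\<close> with \<open>\<chi> g \<noteq> 0\<close> leaves only \<open>i = 0\<close>, because \<open>\<omega> g\<close> is a
  primitive \<open>p\<close>-th root of unity.\<close>

lemma inner_restrict_self:
  assumes \<chi>: "\<chi> \<in> Irr G"
  shows "char_inner GK \<chi> \<chi> \<in> {1, of_nat p}"
proof -
  have t: "(\<Sum>g\<in>carrier G. \<omega> g ^ i * (\<chi> g * \<chi> (inv g)))
      = (if \<forall>g\<in>carrier G. \<omega> g ^ i * \<chi> g = \<chi> g then N\<^sub>G else 0)" for i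
  proof -
    have "(\<Sum>g\<in>carrier G. \<omega> g ^ i * (\<chi> g * \<chi> (inv g))) =
      (\<Sum>g\<in>carrier G. restrict (\<lambda>g. \<omega> g ^ i * \<chi> g) (carrier G) g * \<chi> (inv g))"
      by (intro sum.cong) auto
    also have "\<dots> = (if restrict (\<lambda>g. \<omega> g ^ i * \<chi> g) (carrier G) = \<chi> then N\<^sub>G else 0)"
      by (rule Irr_orthogonal[OF omega_power_twist[OF \<chi>] \<chi>])
    also have "restrict (\<lambda>g. \<omega> g ^ i * \<chi> g) (carrier G) = \<chi> \<longleftrightarrow> (\<forall>g\<in>carrier G. \<omega> g ^ i * \<chi> g = \<chi> g)"
    proof -
      have ext: "\<chi> \<in> extensional (carrier G)" using \<chi> by (auto simp: Irr_def character_of_def)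
      show ?thesis
      proof
        assume eq: "restrict (\<lambda>g. \<omega> g ^ i * \<chi> g) (carrier G) = \<chi>"
        show "\<forall>g\<in>carrier G. \<omega> g ^ i * \<chi> g = \<chi> g"
        proof
          fix g assume "g \<in> carrier G"
          then show "\<omega> g ^ i * \<chi> g = \<chi> g" using fun_cong[OF eq, of g] by simp
        qed
      next
        assume "\<forall>g\<in>carrier G. \<omega> g ^ i * \<chi> g = \<chi> g"
        then show "restrict (\<lambda>g. \<omega> g ^ i * \<chi> g) (carrier G) = \<chi>"
          using ext by (intro extensionalityI[of _ "carrier G"]) auto
      qed
    qed
    finally show ?thesis .
  qed
  have K: "char_inner GK \<chi> \<chi> = (\<Sum>h\<in>K. \<chi> h * \<chi> (inv h)) / of_nat (card K)"
    by (simp add: char_inner_def)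
  have N: "N\<^sub>G = of_nat p * of_nat (card K)" by (simp add: card_K)
  have p0: "(of_nat p :: complex) \<noteq> 0" using prime_gt_0_nat[OF p] by simp
  have k0: "(of_nat (card K) :: complex) \<noteq> 0" using card_K_pos by simp
  have S: "of_nat p * (\<Sum>h\<in>K. \<chi> h * \<chi> (inv h)) =
      (\<Sum>i<p. if \<forall>g\<in>carrier G. \<omega> g ^ i * \<chi> g = \<chi> g then N\<^sub>G else 0)"
    unfolding sum_over_K t ..
  show ?thesis
  proof (cases "\<forall>g\<in>carrier G. \<chi> g = 0 \<or> g \<in> K")
    case True
    then have "\<forall>g\<in>carrier G. \<omega> g ^ i * \<chi> g = \<chi> g" for i by (auto simp: K_def)
    then have "of_nat p * (\<Sum>h\<in>K. \<chi> h * \<chi> (inv h)) = of_nat p * N\<^sub>G" using S by simp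
    then have "(\<Sum>h\<in>K. \<chi> h * \<chi> (inv h)) = of_nat p * of_nat (card K)" using p0 N by simp
    then show ?thesis using K k0 by simp
  next
    case False
    then obtain g0 where g0: "g0 \<in> carrier G" "\<chi> g0 \<noteq> 0" "\<omega> g0 \<noteq> 1" by (auto simp: K_def)
    have "(\<forall>g\<in>carrier G. \<omega> g ^ i * \<chi> g = \<chi> g) \<longleftrightarrow> i = 0" if i: "i < p" for i
    proof
      assume "\<forall>g\<in>carrier G. \<omega> g ^ i * \<chi> g = \<chi> g"
      then have "\<omega> g0 ^ i = 1" using g0 by auto
      then show "i = 0" using root_of_unity_coprime_exponents[OF coprime_less_p[OF _ i] _ _ \<omega>p[OF g0(1)]] g0(3) by auto
    qed simp
    then have "(\<Sum>i<p. if \<forall>g\<in>carrier G. \<omega> g ^ i * \<chi> g = \<chi> g then N\<^sub>G else 0) = (\<Sum>i<p. if i = 0 then N\<^sub>G else 0)"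
      by (intro sum.cong) auto
    also have "\<dots> = N\<^sub>G" using prime_gt_0_nat[OF p] by simp
    finally have "(\<Sum>h\<in>K. \<chi> h * \<chi> (inv h)) = of_nat (card K)" using S N p0 by simp
    then show ?thesis using K k0 by simp
  qed
qed

text \<open>The multiplicity of \<open>\<theta>\<close> in the restriction of \<open>\<chi>\<close> to \<open>K\<close>.\<close>

definition res_mult :: "('a \<Rightarrow> complex) \<Rightarrow> ('a \<Rightarrow> complex) \<Rightarrow> nat" where
  "res_mult \<chi> \<theta> = (THE m. char_inner GK \<chi> \<theta> = of_nat m)"

lemma res_mult:
  assumes \<chi>: "\<chi> \<in> Irr G"
  shows "\<theta> \<in> Irr GK \<Longrightarrow> char_inner GK \<chi> \<theta> = of_nat (res_mult \<chi> \<theta>)"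
    and "h \<in> K \<Longrightarrow> \<chi> h = (\<Sum>\<theta>\<in>Irr GK. of_nat (res_mult \<chi> \<theta>) * \<theta> h)"
proof -
  obtain n \<rho> where \<rho>: "irreducible_rep G n \<rho>" and c: "\<chi> = character_of G \<rho>" using IrrE[OF \<chi>] by metis
  have r: "matrix_rep GK n \<rho>" using irreducible_repD(1)[OF \<rho>] by (auto simp: matrix_rep_def K_def)
  obtain m :: "('a \<Rightarrow> complex) \<Rightarrow> nat" where
    m: "\<And>h. h \<in> K \<Longrightarrow> mat_trace (\<rho> h) = (\<Sum>\<theta>\<in>Irr GK. of_nat (m \<theta>) * \<theta> h)"
    "\<And>\<theta>. \<theta> \<in> Irr GK \<Longrightarrow> char_inner GK (\<lambda>g. mat_trace (\<rho> g)) \<theta> = of_nat (m \<theta>)"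
    using H.rep_character_expansion[OF r] by auto
  have tr: "\<chi> h = mat_trace (\<rho> h)" if "h \<in> K" for h using that by (simp add: c character_of_def K_sub)
  have i: "char_inner GK \<chi> \<theta> = of_nat (m \<theta>)" if "\<theta> \<in> Irr GK" for \<theta>
    using m(2)[OF that] tr by (simp add: char_inner_def)
  then have mm: "res_mult \<chi> \<theta> = m \<theta>" if "\<theta> \<in> Irr GK" for \<theta>
    unfolding res_mult_def using that by (intro the_equality) auto
  show "\<theta> \<in> Irr GK \<Longrightarrow> char_inner GK \<chi> \<theta> = of_nat (res_mult \<chi> \<theta>)" using i mm by simp
  show "h \<in> K \<Longrightarrow> \<chi> h = (\<Sum>\<theta>\<in>Irr GK. of_nat (res_mult \<chi> \<theta>) * \<theta> h)"
    using m(1) tr mm by (simp cong: sum.cong)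
qed

lemma sum_res_mult_squares:
  assumes \<chi>: "\<chi> \<in> Irr G"
  shows "(\<Sum>\<theta>\<in>Irr GK. (res_mult \<chi> \<theta>)\<^sup>2) \<in> {1, p}"
proof -
  have "char_inner GK \<chi> \<chi> = (\<Sum>h\<in>K. \<Sum>\<theta>\<in>Irr GK. of_nat (res_mult \<chi> \<theta>) * (\<theta> h * \<chi> (inv h))) / of_nat (card K)"
    using res_mult(2)[OF \<chi>] by (simp add: char_inner_def sum_distrib_right mult.assoc cong: sum.cong)
  also have "\<dots> = (\<Sum>\<theta>\<in>Irr GK. of_nat (res_mult \<chi> \<theta>) * char_inner GK \<theta> \<chi>)"
    by (subst sum.swap) (simp add: char_inner_def sum_distrib_left sum_divide_distrib)
  also have "\<dots> = (\<Sum>\<theta>\<in>Irr GK. of_nat (res_mult \<chi> \<theta>) * of_nat (res_mult \<chi> \<theta>))"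
    using res_mult(1)[OF \<chi>] H.char_inner_commute by (intro sum.cong) auto
  also have "\<dots> = of_nat (\<Sum>\<theta>\<in>Irr GK. (res_mult \<chi> \<theta>)\<^sup>2)" by (simp add: power2_eq_square)
  finally have "of_nat (\<Sum>\<theta>\<in>Irr GK. (res_mult \<chi> \<theta>)\<^sup>2) \<in> {1::complex, of_nat p}"
    using inner_restrict_self[OF \<chi>] by simp
  then show ?thesis by (metis insert_iff of_nat_1 of_nat_eq_iff singletonD)
qed

definition conj_char :: "'a \<Rightarrow> ('a \<Rightarrow> complex) \<Rightarrow> 'a \<Rightarrow> complex" where
  "conj_char g \<theta> = restrict (\<lambda>h. \<theta> (g \<otimes> h \<otimes> inv g)) K"

lemma conj_char_Irr:
  assumes g: "g \<in> carrier G" and \<theta>: "\<theta> \<in> Irr GK"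
  shows "conj_char g \<theta> \<in> Irr GK"
proof -
  obtain n \<rho> where \<rho>: "irreducible_rep GK n \<rho>" and c: "\<theta> = character_of GK \<rho>" using H.IrrE[OF \<theta>] by metis
  note r = H.irreducible_repD(1)[OF \<rho>]
  \<comment> \<open>As conjugation by \<open>g\<close> permutes \<open>K\<close>, \<open>\<sigma>\<close> and \<open>\<rho>\<close> have the same invariant subspaces.\<close>
  define \<sigma> where "\<sigma> h = \<rho> (g \<otimes> h \<otimes> inv g)" for h
  have m: "g \<otimes> (h \<otimes> k) \<otimes> inv g = (g \<otimes> h \<otimes> inv g) \<otimes> (g \<otimes> k \<otimes> inv g)" if "h \<in> K" "k \<in> K" for h k
    using g that by (simp add: K_sub m_assoc inv_solve_left)
  have "matrix_rep GK n \<sigma>" unfolding matrix_rep_def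
  proof (intro conjI ballI)
    fix h k assume "h \<in> carrier GK" "k \<in> carrier GK"
    then show "\<sigma> (h \<otimes>\<^bsub>GK\<^esub> k) = \<sigma> h * \<sigma> k"
      using r m[of h k] K_conj[OF g] by (simp add: \<sigma>_def matrix_rep_def)
  qed (use r K_conj[OF g] g in \<open>auto simp: \<sigma>_def matrix_rep_def\<close>)
  moreover have "W = {0\<^sub>v n} \<or> W = carrier_vec n" if W: "invariant_subspace GK n \<sigma> W" for W
  proof -
    have "\<rho> k *\<^sub>v w \<in> W" if k: "k \<in> K" and w: "w \<in> W" for k w
    proof -
      have "inv g \<otimes> k \<otimes> g \<in> K" using K_conj[of "inv g" k] g k by simp
      moreover have "g \<otimes> (inv g \<otimes> k \<otimes> g) \<otimes> inv g = k"
        using g K_sub[OF k] by (simp add: m_assoc[symmetric]) (simp add: m_assoc)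
      ultimately show ?thesis using W w unfolding invariant_subspace_iff \<sigma>_def by fastforce
    qed
    then have "invariant_subspace GK n \<rho> W" using W by (auto simp: invariant_subspace_iff)
    then show ?thesis using \<rho> by (auto simp: irreducible_rep_iff[OF H.is_group])
  qed
  ultimately have "irreducible_rep GK n \<sigma>" using H.irreducible_repD(2)[OF \<rho>] by (simp add: irreducible_rep_iff[OF H.is_group])
  moreover have "conj_char g \<theta> = character_of GK \<sigma>"
    using K_conj[OF g] by (auto simp: conj_char_def character_of_def c \<sigma>_def restrict_def)
  ultimately show ?thesis by (auto simp: Irr_def)
qed

lemma conj_char_degree:
  assumes g: "g \<in> carrier G" and \<theta>: "\<theta> \<in> Irr GK"
  shows "char_degree GK (conj_char g \<theta>) = char_degree GK \<theta>"
proof -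
  have "conj_char g \<theta> \<one> = \<theta> \<one>" using g one_K by (simp add: conj_char_def)
  then show ?thesis by (simp add: char_degree_def)
qed

lemma res_mult_conj_char:
  assumes g: "g \<in> carrier G" and \<theta>: "\<theta> \<in> Irr GK" and \<chi>: "\<chi> \<in> Irr G"
  shows "res_mult \<chi> (conj_char g \<theta>) = res_mult \<chi> \<theta>"
proof -
  have "(\<Sum>h\<in>K. \<chi> h * conj_char g \<theta> (inv h)) = (\<Sum>h\<in>K. \<chi> h * \<theta> (inv h))"
  proof (rule sum.reindex_bij_witness[of _ "\<lambda>h. inv g \<otimes> h \<otimes> g" "\<lambda>h. g \<otimes> h \<otimes> inv g"])
    fix h assume h: "h \<in> K"
    note hG = K_sub[OF h]
    show "inv g \<otimes> (g \<otimes> h \<otimes> inv g) \<otimes> g = h" using g hG by (simp add: m_assoc[symmetric]) (simp add: m_assoc)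
    show "g \<otimes> h \<otimes> inv g \<in> K" by (rule K_conj[OF g h])
    show "g \<otimes> (inv g \<otimes> h \<otimes> g) \<otimes> inv g = h" using g hG by (simp add: m_assoc[symmetric]) (simp add: m_assoc)
    show "inv g \<otimes> h \<otimes> g \<in> K" using K_conj[of "inv g" h] g h by simp
    have "\<chi> (g \<otimes> h \<otimes> inv g) = \<chi> (inv g \<otimes> (g \<otimes> h))" using Irr_class_function[OF \<chi>, of "g \<otimes> h" "inv g"] g hG by simp
    also have "inv g \<otimes> (g \<otimes> h) = h" using g hG by (simp add: m_assoc[symmetric])
    finally have 1: "\<chi> (g \<otimes> h \<otimes> inv g) = \<chi> h" .
    have 2: "inv (g \<otimes> h \<otimes> inv g) = g \<otimes> inv h \<otimes> inv g" using g hG by (simp add: inv_mult_group m_assoc)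
    show "\<chi> (g \<otimes> h \<otimes> inv g) * \<theta> (inv (g \<otimes> h \<otimes> inv g)) = \<chi> h * conj_char g \<theta> (inv h)"
      unfolding 1 2 using inv_K[OF h] by (simp add: conj_char_def)
  qed
  then have "char_inner GK \<chi> (conj_char g \<theta>) = char_inner GK \<chi> \<theta>" by (simp add: char_inner_def)
  then show ?thesis by (simp add: res_mult_def)
qed

text \<open>Clifford's theorem.  Column orthogonality of \<open>G\<close> turns
  \<open>\<Sum>\<psi>. res_mult \<psi> \<theta>1 * res_mult \<psi> \<theta>2\<close> into \<open>1 / |K|\<close> times the number of \<open>g\<close> that conjugate \<open>\<theta>1\<close> into
  \<open>\<theta>2\<close>.  All terms of the sum are natural numbers, and the one for \<open>\<chi>\<close> is not zero.\<close>

lemma constituents_conjugate: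
  assumes \<theta>1: "\<theta>1 \<in> Irr GK" and \<theta>2: "\<theta>2 \<in> Irr GK" and \<chi>: "\<chi> \<in> Irr G"
    and m1: "res_mult \<chi> \<theta>1 \<noteq> 0" and m2: "res_mult \<chi> \<theta>2 \<noteq> 0"
  shows "\<exists>g\<in>carrier G. \<theta>2 = conj_char g \<theta>1"
proof (rule ccontr)
  assume no: "\<not> ?thesis"
  have k0: "(of_nat (card K) :: complex) \<noteq> 0" using card_K_pos by simp
  define s where "s = (\<Sum>\<psi>\<in>Irr G. of_nat (res_mult \<psi> \<theta>1) * of_nat (res_mult \<psi> \<theta>2) :: complex)"
  let ?c = "of_nat (card K) :: complex"
  have e: "?c * of_nat (res_mult \<psi> \<theta>) = (\<Sum>a\<in>K. \<psi> a * \<theta> (inv a))" if "\<psi> \<in> Irr G" "\<theta> \<in> Irr GK" for \<psi> \<theta>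
    using res_mult(1)[OF that] k0 by (simp add: char_inner_def field_simps)
  have "?c * ?c * s = (\<Sum>\<psi>\<in>Irr G. (?c * of_nat (res_mult \<psi> \<theta>1)) * (?c * of_nat (res_mult \<psi> \<theta>2)))"
    by (simp add: s_def sum_distrib_left mult_ac)
  also have "\<dots> = (\<Sum>\<psi>\<in>Irr G. \<Sum>a\<in>K. \<Sum>b\<in>K. (\<psi> a * \<theta>1 (inv a)) * (\<psi> b * \<theta>2 (inv b)))"
    by (intro sum.cong refl) (simp only: e[OF _ \<theta>1] e[OF _ \<theta>2] sum_product)
  also have "\<dots> = (\<Sum>a\<in>K. \<Sum>\<psi>\<in>Irr G. \<Sum>b\<in>K. (\<psi> a * \<theta>1 (inv a)) * (\<psi> b * \<theta>2 (inv b)))"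
    by (rule sum.swap)
  also have "\<dots> = (\<Sum>a\<in>K. \<Sum>b\<in>K. \<Sum>\<psi>\<in>Irr G. (\<psi> a * \<theta>1 (inv a)) * (\<psi> b * \<theta>2 (inv b)))"
    by (rule sum.cong[OF refl], rule sum.swap)
  also have "\<dots> = (\<Sum>a\<in>K. \<Sum>b\<in>K. \<theta>1 (inv a) * \<theta>2 (inv b) * (\<Sum>\<psi>\<in>Irr G. \<psi> a * \<psi> b))"
    by (simp add: sum_distrib_left mult_ac)
  also have "\<dots> = (\<Sum>a\<in>K. \<Sum>b\<in>K. \<Sum>x\<in>carrier G. \<theta>1 (inv a) * \<theta>2 (inv b) * (if a = inv (x \<otimes> b \<otimes> inv x) then 1 else 0))"
  proof (intro sum.cong refl)
    fix a b assume ab: "a \<in> K" "b \<in> K"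
    have "a \<otimes> (x \<otimes> b \<otimes> inv x) = \<one> \<longleftrightarrow> a = inv (x \<otimes> b \<otimes> inv x)" if "x \<in> carrier G" for x
      using ab that K_sub by (metis inv_closed inv_equality l_inv m_closed)
    then show "\<theta>1 (inv a) * \<theta>2 (inv b) * (\<Sum>\<psi>\<in>Irr G. \<psi> a * \<psi> b) =
       (\<Sum>x\<in>carrier G. \<theta>1 (inv a) * \<theta>2 (inv b) * (if a = inv (x \<otimes> b \<otimes> inv x) then 1 else 0))"
      unfolding sum_distrib_left[symmetric] using column_orthogonality[of a b] ab K_sub
      by (simp cong: if_cong)
  qed
  also have "\<dots> = (\<Sum>x\<in>carrier G. \<Sum>b\<in>K. \<Sum>a\<in>K. \<theta>1 (inv a) * \<theta>2 (inv b) * (if a = inv (x \<otimes> b \<otimes> inv x) then 1 else 0))"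
    by (subst sum.swap, subst (2) sum.swap, subst sum.swap) (rule refl)
  also have "\<dots> = (\<Sum>x\<in>carrier G. \<Sum>b\<in>K. conj_char x \<theta>1 b * \<theta>2 (inv b))"
  proof (intro sum.cong refl)
    fix x b assume x: "x \<in> carrier G" and b: "b \<in> K"
    let ?y = "x \<otimes> b \<otimes> inv x"
    have y: "?y \<in> K" "inv ?y \<in> K" using K_conj[OF x b] inv_K by auto
    have "(\<Sum>a\<in>K. \<theta>1 (inv a) * \<theta>2 (inv b) * (if a = inv ?y then 1 else 0)) =
       (\<Sum>a\<in>K. if a = inv ?y then \<theta>1 (inv (inv ?y)) * \<theta>2 (inv b) else 0)"
      by (intro sum.cong) auto
    also have "\<dots> = \<theta>1 (inv (inv ?y)) * \<theta>2 (inv b)"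
      using y H.fin by simp
    also have "\<dots> = conj_char x \<theta>1 b * \<theta>2 (inv b)" using K_sub[OF y(1)] b by (simp add: conj_char_def)
    finally show "(\<Sum>a\<in>K. \<theta>1 (inv a) * \<theta>2 (inv b) * (if a = inv ?y then 1 else 0)) = conj_char x \<theta>1 b * \<theta>2 (inv b)" .
  qed
  also have "\<dots> = (\<Sum>x\<in>carrier G. ?c * char_inner GK (conj_char x \<theta>1) \<theta>2)"
    using k0 by (intro sum.cong refl) (simp add: char_inner_def)
  also have "\<dots> = 0"
    using no H.char_inner_Irr[OF conj_char_Irr[OF _ \<theta>1] \<theta>2] by (intro sum.neutral) auto
  finally have "s = 0" using k0 by simp
  moreover have "s = of_nat (\<Sum>\<psi>\<in>Irr G. res_mult \<psi> \<theta>1 * res_mult \<psi> \<theta>2)" by (simp add: s_def)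
  ultimately have "(\<Sum>\<psi>\<in>Irr G. res_mult \<psi> \<theta>1 * res_mult \<psi> \<theta>2) = 0" by (metis of_nat_eq_0_iff)
  then have "res_mult \<chi> \<theta>1 * res_mult \<chi> \<theta>2 = 0" using \<chi> by simp
  then show False using m1 m2 by simp
qed

text \<open>The constituents of the restriction are conjugate, so they occur with one common multiplicity \<open>e\<close> and
  have one common degree.  If there are \<open>t\<close> of them, then \<open>t * e\<^sup>2\<close> is \<open>1\<close> or \<open>p\<close>.  As \<open>p\<close> is squarefree,
  \<open>e = 1\<close>, and \<open>\<chi> 1 = t * \<theta> 1\<close> with \<open>t\<close> equal to \<open>1\<close> or \<open>p\<close>.\<close>

lemma degree_ratio:
  assumes \<chi>: "\<chi> \<in> Irr G" and \<theta>: "\<theta> \<in> Irr GK" and m: "res_mult \<chi> \<theta> \<noteq> 0"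
  shows "char_degree G \<chi> \<in> {char_degree GK \<theta>, p * char_degree GK \<theta>}"
proof -
  define T where "T = {\<psi> \<in> Irr GK. res_mult \<chi> \<psi> \<noteq> 0}"
  have fT: "finite T" unfolding T_def using H.finite_Irr by simp
  have same: "res_mult \<chi> \<psi> = res_mult \<chi> \<theta> \<and> char_degree GK \<psi> = char_degree GK \<theta>" if "\<psi> \<in> T" for \<psi>
    using constituents_conjugate[OF \<theta> _ \<chi> m] that res_mult_conj_char[OF _ \<theta> \<chi>] conj_char_degree[OF _ \<theta>]
    unfolding T_def by blast
  have "(\<Sum>\<psi>\<in>Irr GK. (res_mult \<chi> \<psi>)\<^sup>2) = (\<Sum>\<psi>\<in>T. (res_mult \<chi> \<psi>)\<^sup>2)"
    by (rule sum.mono_neutral_right) (auto simp: T_def H.finite_Irr)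
  also have "\<dots> = card T * (res_mult \<chi> \<theta>)\<^sup>2" using same by simp
  finally have sq: "card T * (res_mult \<chi> \<theta>)\<^sup>2 \<in> {1, p}" using sum_res_mult_squares[OF \<chi>] by simp
  have one: "res_mult \<chi> \<theta> = 1"
  proof (cases "card T * (res_mult \<chi> \<theta>)\<^sup>2 = 1")
    case False
    then have "card T * (res_mult \<chi> \<theta>)\<^sup>2 = p" using sq by blast
    then have d: "res_mult \<chi> \<theta> * res_mult \<chi> \<theta> dvd p" by (metis dvd_triv_right power2_eq_square)
    then have "res_mult \<chi> \<theta> dvd p" by (rule dvd_mult_left)
    then have "res_mult \<chi> \<theta> = 1 \<or> res_mult \<chi> \<theta> = p" using p by (auto simp: prime_nat_iff)
    moreover have "\<not> p * p dvd p" using prime_gt_1_nat[OF p] by (auto dest!: dvd_imp_le)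
    ultimately show ?thesis using d by auto
  qed simp
  have "complex_of_nat (char_degree G \<chi>) = (\<Sum>\<psi>\<in>Irr GK. of_nat (res_mult \<chi> \<psi>) * \<psi> \<one>)"
    using res_mult(2)[OF \<chi> one_K] Irr_one(1)[OF \<chi>] by simp
  also have "\<dots> = (\<Sum>\<psi>\<in>Irr GK. of_nat (res_mult \<chi> \<psi> * char_degree GK \<psi>))"
    using H.Irr_one(1) by (intro sum.cong) auto
  also have "\<dots> = of_nat (\<Sum>\<psi>\<in>Irr GK. res_mult \<chi> \<psi> * char_degree GK \<psi>)" by simp
  finally have "char_degree G \<chi> = (\<Sum>\<psi>\<in>Irr GK. res_mult \<chi> \<psi> * char_degree GK \<psi>)" using of_nat_eq_iff by blast
  also have "\<dots> = (\<Sum>\<psi>\<in>T. res_mult \<chi> \<psi> * char_degree GK \<psi>)"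
    by (rule sum.mono_neutral_right) (auto simp: T_def H.finite_Irr)
  also have "\<dots> = card T * char_degree GK \<theta>" using same one by simp
  finally show ?thesis using sq one by auto
qed

text \<open>The sum is the multiplicity of \<open>\<theta>\<close> in the restriction to \<open>K\<close> of the regular character of \<open>G\<close>,
  which vanishes off the identity.\<close>

lemma sum_degree_res_mult:
  assumes \<theta>: "\<theta> \<in> Irr GK"
  shows "(\<Sum>\<chi>\<in>Irr G. \<chi> \<one> * of_nat (res_mult \<chi> \<theta>)) = of_nat p * \<theta> \<one>"
proof -
  have k0: "(of_nat (card K) :: complex) \<noteq> 0" using card_K_pos by simp
  have "of_nat (card K) * (\<Sum>\<chi>\<in>Irr G. \<chi> \<one> * of_nat (res_mult \<chi> \<theta>)) =
     (\<Sum>\<chi>\<in>Irr G. \<chi> \<one> * (of_nat (card K) * char_inner GK \<chi> \<theta>))"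
    using res_mult(1)[OF _ \<theta>] by (simp add: sum_distrib_left mult_ac)
  also have "\<dots> = (\<Sum>\<chi>\<in>Irr G. \<Sum>h\<in>K. \<chi> \<one> * \<chi> h * \<theta> (inv h))"
    using k0 by (intro sum.cong refl) (simp add: char_inner_def mult.assoc flip: sum_distrib_left)
  also have "\<dots> = (\<Sum>h\<in>K. (\<Sum>\<chi>\<in>Irr G. \<chi> \<one> * \<chi> h) * \<theta> (inv h))"
    by (subst sum.swap) (simp add: sum_distrib_right)
  also have "\<dots> = (\<Sum>h\<in>K. if h = \<one> then N\<^sub>G * \<theta> \<one> else 0)"
    by (intro sum.cong refl) (auto simp: sum_degree_Irr K_sub)
  also have "\<dots> = N\<^sub>G * \<theta> \<one>" using one_K H.fin by simp
  finally show ?thesis using k0 by (simp add: card_K)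
qed

end

lemma p'_part_eq_1_iff:
  assumes p: "prime p" and n: "n > 0"
  shows "p'_part p n = 1 \<longleftrightarrow> (\<exists>a. n = p ^ a)"
proof
  assume "p'_part p n = 1"
  moreover have "p_part p n dvd n" by (simp add: p_part_def multiplicity_dvd)
  ultimately have "n = p_part p n" by (metis dvd_mult_div_cancel mult.right_neutral p'_part_def)
  then show "\<exists>a. n = p ^ a" by (auto simp: p_part_def)
next
  assume "\<exists>a. n = p ^ a"
  then obtain a where "n = p ^ a" by blast
  then show "p'_part p n = 1"
    using p prime_gt_0_nat[OF p] by (simp add: p'_part_def p_part_def multiplicity_same_power not_prime_unit)
qed

lemma prime_power_times_prime_iff:
  fixes p d :: nat
  assumes p: "prime p"
  shows "(\<exists>a. p * d = p ^ a) \<longleftrightarrow> (\<exists>a. d = p ^ a)"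
proof
  assume "\<exists>a. p * d = p ^ a"
  then obtain a where a: "p * d = p ^ a" by blast
  then have "a \<noteq> 0" using prime_gt_1_nat[OF p] by (intro notI) auto
  then obtain b where "a = Suc b" by (cases a) auto
  then show "\<exists>a. d = p ^ a" using a prime_gt_0_nat[OF p] by auto
next
  assume "\<exists>a. d = p ^ a"
  then show "\<exists>a. p * d = p ^ a" by (metis power_Suc)
qed

context prime_order_linear_char
begin

text \<open>Expand one factor of each \<open>\<chi> 1 * \<chi> 1\<close> over the constituents of the restriction.  By \<open>degree_ratio\<close>
  only admissible \<open>\<theta>\<close> occur, and for these the sum over admissible \<open>\<chi>\<close> is already the sum over all
  \<open>\<chi>\<close>, which \<open>sum_degree_res_mult\<close> evaluates.\<close>

theorem u_inv_kernel: "u_inv p G = p * u_inv p GK"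
proof -
  define T where "T = {\<chi> \<in> Irr G. p'_part p (char_degree G \<chi>) = 1}"
  define S where "S = {\<theta> \<in> Irr GK. p'_part p (char_degree GK \<theta>) = 1}"
  have TS: "\<chi> \<in> T \<longleftrightarrow> \<theta> \<in> S" if \<chi>: "\<chi> \<in> Irr G" and \<theta>: "\<theta> \<in> Irr GK" and m: "res_mult \<chi> \<theta> \<noteq> 0" for \<chi> \<theta>
  proof -
    have "\<chi> \<in> T \<longleftrightarrow> (\<exists>a. char_degree G \<chi> = p ^ a)"
      using \<chi> p'_part_eq_1_iff[OF p Irr_one(2)[OF \<chi>]] by (simp add: T_def)
    also have "\<dots> \<longleftrightarrow> (\<exists>a. char_degree GK \<theta> = p ^ a)"
      using degree_ratio[OF \<chi> \<theta> m] prime_power_times_prime_iff[OF p] by (metis insertE singletonD)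
    also have "\<dots> \<longleftrightarrow> \<theta> \<in> S"
      using \<theta> p'_part_eq_1_iff[OF p H.Irr_one(2)[OF \<theta>]] by (simp add: S_def)
    finally show ?thesis .
  qed
  have TI: "T \<subseteq> Irr G" and SI: "S \<subseteq> Irr GK" by (auto simp: T_def S_def)
  have fT: "finite T" "finite S" using TI SI finite_Irr H.finite_Irr finite_subset by blast+
  have "of_nat (u_inv p G) = (\<Sum>\<chi>\<in>T. \<chi> \<one> * \<chi> \<one>)"
    unfolding u_inv_def T_def[symmetric] of_nat_sum
    using TI Irr_one(1) by (intro sum.cong) (auto simp: power2_eq_square)
  also have "\<dots> = (\<Sum>\<chi>\<in>T. \<Sum>\<theta>\<in>S. \<chi> \<one> * of_nat (res_mult \<chi> \<theta>) * \<theta> \<one>)"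
  proof (intro sum.cong refl)
    fix \<chi> assume \<chi>: "\<chi> \<in> T"
    then have \<chi>I: "\<chi> \<in> Irr G" using TI by blast
    have "\<chi> \<one> = (\<Sum>\<theta>\<in>Irr GK. of_nat (res_mult \<chi> \<theta>) * \<theta> \<one>)" by (rule res_mult(2)[OF \<chi>I one_K])
    also have "\<dots> = (\<Sum>\<theta>\<in>S. of_nat (res_mult \<chi> \<theta>) * \<theta> \<one>)"
      using TS[OF \<chi>I] \<chi> SI by (intro sum.mono_neutral_right) (auto simp: H.finite_Irr)
    finally have "\<chi> \<one> * \<chi> \<one> = \<chi> \<one> * (\<Sum>\<theta>\<in>S. of_nat (res_mult \<chi> \<theta>) * \<theta> \<one>)" by (rule arg_cong)
    then show "\<chi> \<one> * \<chi> \<one> = (\<Sum>\<theta>\<in>S. \<chi> \<one> * of_nat (res_mult \<chi> \<theta>) * \<theta> \<one>)"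
      by (simp only: sum_distrib_left mult.assoc)
  qed
  also have "\<dots> = (\<Sum>\<theta>\<in>S. (\<Sum>\<chi>\<in>T. \<chi> \<one> * of_nat (res_mult \<chi> \<theta>)) * \<theta> \<one>)"
    by (subst sum.swap) (simp add: sum_distrib_right)
  also have "\<dots> = (\<Sum>\<theta>\<in>S. of_nat p * (\<theta> \<one> * \<theta> \<one>))"
  proof (intro sum.cong refl)
    fix \<theta> assume \<theta>: "\<theta> \<in> S"
    then have \<theta>I: "\<theta> \<in> Irr GK" using SI by blast
    have "(\<Sum>\<chi>\<in>T. \<chi> \<one> * of_nat (res_mult \<chi> \<theta>)) = (\<Sum>\<chi>\<in>Irr G. \<chi> \<one> * of_nat (res_mult \<chi> \<theta>))"
      using TS[OF _ \<theta>I] \<theta> TI by (intro sum.mono_neutral_left) auto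
    also have "\<dots> = of_nat p * \<theta> \<one>" by (rule sum_degree_res_mult[OF \<theta>I])
    finally show "(\<Sum>\<chi>\<in>T. \<chi> \<one> * of_nat (res_mult \<chi> \<theta>)) * \<theta> \<one> = of_nat p * (\<theta> \<one> * \<theta> \<one>)" by simp
  qed
  also have "\<dots> = of_nat (p * u_inv p GK)"
    unfolding u_inv_def S_def[symmetric] of_nat_mult of_nat_sum sum_distrib_left
    using SI H.Irr_one(1) by (intro sum.cong) (auto simp: power2_eq_square)
  finally show ?thesis using of_nat_eq_iff by blast
qed

end

section \<open>Descent through kernels of index p\<close>

context finite_group
begin

lemma degree_prime_power_cases:
  assumes p: "prime p" and \<chi>: "\<chi> \<in> Irr G" "p'_part p (char_degree G \<chi>) = 1"
  shows "char_degree G \<chi> = 1 \<or> p dvd char_degree G \<chi>"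
proof -
  obtain a where "char_degree G \<chi> = p ^ a" using \<chi> p'_part_eq_1_iff[OF p Irr_one(2)[OF \<chi>(1)]] by auto
  then show ?thesis by (cases a) auto
qed

lemma u_inv_cong_linear:
  assumes p: "prime p"
  obtains k where "u_inv p G = card (linear_chars G) + p * k"
proof -
  let ?T = "{\<chi>. \<chi> \<in> Irr G \<and> p'_part p (char_degree G \<chi>) = 1}"
  have fT: "finite ?T" by simp
  have LT: "linear_chars G \<subseteq> ?T" by (auto simp: linear_chars_def p'_part_def p_part_def)
  have "u_inv p G = (\<Sum>\<chi>\<in>?T - linear_chars G. (char_degree G \<chi>)\<^sup>2) + (\<Sum>\<chi>\<in>linear_chars G. (char_degree G \<chi>)\<^sup>2)"
    unfolding u_inv_def by (rule sum.subset_diff[OF LT fT])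
  also have "(\<Sum>\<chi>\<in>linear_chars G. (char_degree G \<chi>)\<^sup>2) = card (linear_chars G)"
    by (simp add: linear_chars_def)
  finally have 1: "u_inv p G = (\<Sum>\<chi>\<in>?T - linear_chars G. (char_degree G \<chi>)\<^sup>2) + card (linear_chars G)" .
  have "p dvd (\<Sum>\<chi>\<in>?T - linear_chars G. (char_degree G \<chi>)\<^sup>2)"
  proof (rule dvd_sum)
    fix \<chi> assume "\<chi> \<in> ?T - linear_chars G"
    then have "p dvd char_degree G \<chi>" using degree_prime_power_cases[OF p, of \<chi>] by (auto simp: linear_chars_def)
    then show "p dvd (char_degree G \<chi>)\<^sup>2" by (simp add: power2_eq_square)
  qed
  then obtain k where "(\<Sum>\<chi>\<in>?T - linear_chars G. (char_degree G \<chi>)\<^sup>2) = p * k" by blast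
  then show thesis using 1 that[of k] by simp
qed

lemma u_inv_coprime_order:
  assumes p: "prime p" and n: "\<not> p dvd card (carrier G)"
  shows "u_inv p G = card (linear_chars G)"
proof -
  have "{\<chi>. \<chi> \<in> Irr G \<and> p'_part p (char_degree G \<chi>) = 1} = linear_chars G"
  proof (intro equalityI subsetI)
    fix \<chi> assume "\<chi> \<in> {\<chi>. \<chi> \<in> Irr G \<and> p'_part p (char_degree G \<chi>) = 1}"
    then have \<chi>: "\<chi> \<in> Irr G" "p'_part p (char_degree G \<chi>) = 1" by auto
    \<comment> \<open>The degree divides a number prime to \<open>p\<close>, so the only power of \<open>p\<close> it can be is 1.\<close>
    have "\<not> p dvd char_degree G \<chi>" using char_degree_dvd_order[OF \<chi>(1)] n dvd_trans by blast
    then show "\<chi> \<in> linear_chars G"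
      using degree_prime_power_cases[OF p \<chi>] \<chi>(1) by (simp add: linear_chars_def)
  qed (auto simp: linear_chars_def p'_part_def p_part_def)
  then show ?thesis unfolding u_inv_def by (simp add: linear_chars_def)
qed

text \<open>All degrees are powers of \<open>p\<close>, so \<open>u_inv p G\<close> is the group order; now reduce modulo \<open>p\<close>.\<close>

lemma p_group_linear_chars:
  assumes p: "prime p" and n: "card (carrier G) = p ^ k" and k: "k > 0"
  shows "p dvd card (linear_chars G)"
proof -
  have "p'_part p (char_degree G \<chi>) = 1" if "\<chi> \<in> Irr G" for \<chi>
  proof -
    have "char_degree G \<chi> dvd p ^ k" using char_degree_dvd_order[OF that] n by simp
    then show ?thesis
      using p'_part_eq_1_iff[OF p Irr_one(2)[OF that]] divides_primepow_nat[OF p] by blast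
  qed
  then have "{\<chi>. \<chi> \<in> Irr G \<and> p'_part p (char_degree G \<chi>) = 1} = Irr G" by auto
  then have "u_inv p G = p ^ k" unfolding u_inv_def using sum_degree_squares n by simp
  then have "p dvd u_inv p G" using k by simp
  moreover obtain j where "u_inv p G = card (linear_chars G) + p * j" by (rule u_inv_cong_linear[OF p])
  ultimately show ?thesis by (simp add: dvd_add_left_iff)
qed

end

lemma prime_order_linear_charI:
  assumes "finite_group G" "prime p" "p dvd card (linear_chars G)"
  obtains \<omega> where "prime_order_linear_char G p \<omega>"
proof -
  interpret finite_group G by fact
  obtain \<omega> where "\<omega> \<in> linear_chars G" "\<And>g. g \<in> carrier G \<Longrightarrow> \<omega> g ^ p = 1" "\<exists>g\<in>carrier G. \<omega> g \<noteq> 1"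
    by (rule linear_char_of_order_p[OF assms(2,3)]) metis
  then have "prime_order_linear_char G p \<omega>"
    by unfold_locales (use assms(2) in auto)
  then show thesis by (rule that)
qed

text \<open>Iterate \<open>u_inv_kernel\<close> until no linear character of order \<open>p\<close> is left.  The last clause records that
  elements of order prime to \<open>p\<close> are never lost; it makes the final subgroup normal once its order is
  known to be prime to \<open>p\<close>.\<close>

lemma descent_to_p_perfect:
  fixes G :: "('a, 'b) monoid_scheme"
  assumes "finite_group G" and p: "prime p"
  shows "\<exists>N k. subgroup N G \<and> card (carrier G) = p ^ k * card N
     \<and> u_inv p G = p ^ k * u_inv p (G\<lparr>carrier := N\<rparr>)
     \<and> \<not> p dvd card (linear_chars (G\<lparr>carrier := N\<rparr>))
     \<and> (\<forall>g\<in>carrier G. \<forall>m. coprime m p \<and> g [^]\<^bsub>G\<^esub> m = \<one>\<^bsub>G\<^esub> \<longrightarrow> g \<in> N)"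
  using assms(1)
proof (induction "card (carrier G)" arbitrary: G rule: less_induct)
  case less
  interpret finite_group G by fact
  show ?case
  proof (cases "p dvd card (linear_chars G)")
    case False
    then show ?thesis by (intro exI[of _ "carrier G"] exI[of _ 0]) (auto simp: subgroup_self)
  next
    case True
    obtain \<omega> where "prime_order_linear_char G p \<omega>"
      by (rule prime_order_linear_charI[OF less.prems p True])
    then interpret W: prime_order_linear_char G p \<omega> .
    have "card W.K < card (carrier G)"
      using W.card_K W.card_K_pos prime_gt_1_nat[OF p] by simp
    then obtain N k where N: "subgroup N W.GK" "card W.K = p ^ k * card N"
      "u_inv p W.GK = p ^ k * u_inv p (G\<lparr>carrier := N\<rparr>)"
      "\<not> p dvd card (linear_chars (G\<lparr>carrier := N\<rparr>))"
      "\<forall>g\<in>W.K. \<forall>m. coprime m p \<and> g [^]\<^bsub>W.GK\<^esub> m = \<one>\<^bsub>G\<^esub> \<longrightarrow> g \<in> N"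
      using less.hyps[of W.GK] W.finite_group_GK by auto
    have "subgroup N G" using incl_subgroup[OF W.K_subgroup N(1)] .
    moreover have "card (carrier G) = p ^ Suc k * card N" using W.card_K N(2) by simp
    moreover have "u_inv p G = p ^ Suc k * u_inv p (G\<lparr>carrier := N\<rparr>)" using W.u_inv_kernel N(3) by simp
    moreover have "g \<in> N" if g: "g \<in> carrier G" and m: "coprime m p" "g [^]\<^bsub>G\<^esub> m = \<one>\<^bsub>G\<^esub>" for g and m :: nat
    proof -
      have "\<omega> g ^ m = 1" using linear_char_pow[OF W.\<omega> g, of m] m(2) W.\<omega>D(2) by simp
      moreover have "m > 0" using m(1) prime_gt_1_nat[OF p] by (intro gr0I) auto
      ultimately have "\<omega> g = 1" using root_of_unity_coprime_exponents[OF m(1) _ _ W.\<omega>p[OF g]] by simp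
      then have "g \<in> W.K" using g by (simp add: W.K_def)
      moreover have "g [^]\<^bsub>W.GK\<^esub> m = \<one>\<^bsub>G\<^esub>" using m(2) by (simp add: nat_pow_def)
      ultimately show ?thesis using N(5) m(1) by blast
    qed
    ultimately show ?thesis using N(4) by blast
  qed
qed

text \<open>Here the descent is steered towards a given \<open>N\<close>: the linear characters used are inflated from the
  \<open>p\<close>-group \<open>G/N\<close>, so their kernels contain \<open>N\<close>.\<close>

lemma u_inv_normal_complement_descent:
  fixes G :: "('a, 'b) monoid_scheme"
  assumes "finite_group G" and p: "prime p" and "N \<lhd> G" "card (carrier G) = p ^ k * card N"
  shows "u_inv p G = p ^ k * u_inv p (G\<lparr>carrier := N\<rparr>)"
  using assms(1,3,4)
proof (induction k arbitrary: G)
  case 0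
  interpret finite_group G by fact
  have "N = carrier G"
    using 0 by (intro card_subset_eq) (auto dest: normal_imp_subgroup subgroup.subset)
  then show ?case by simp
next
  case (Suc k)
  interpret finite_group G by fact
  interpret N: normal N G by fact
  interpret Q: finite_group "G Mod N" by (rule finite_group_FactGroup) fact
  have "card (rcosets\<^bsub>G\<^esub> N) * card N = card (carrier G)"
    using lagrange[OF N.is_subgroup] by (simp add: Coset.order_def)
  moreover have cN: "card N > 0" using N.one_closed finite_subset[OF N.subset fin] card_gt_0_iff by blast
  ultimately have cQ: "card (carrier (G Mod N)) = p ^ Suc k"
    using Suc.prems(3) by (simp add: FactGroup_def)
  obtain \<psi> where "prime_order_linear_char (G Mod N) p \<psi>"
    by (rule prime_order_linear_charI[OF Q.finite_group_axioms p Q.p_group_linear_chars[OF p cQ]]) auto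
  then interpret Q: prime_order_linear_char "G Mod N" p \<psi> .
  have c: "carrier (G Mod N) = (\<lambda>x. N #>\<^bsub>G\<^esub> x) ` carrier G" by (rule carrier_FactGroup)
  define \<omega> where "\<omega> = restrict (\<lambda>g. \<psi> (N #>\<^bsub>G\<^esub> g)) (carrier G)"
  interpret W: prime_order_linear_char G p \<omega>
  proof unfold_locales
    show "prime p" by (rule p)
    show "\<omega> \<in> linear_chars G" unfolding \<omega>_def by (rule inflate_linear_char[OF Suc.prems(2) Q.\<omega>])
    show "\<omega> g ^ p = 1" if "g \<in> carrier G" for g
      using that Q.\<omega>p[of "N #>\<^bsub>G\<^esub> g"] c by (simp add: \<omega>_def)
    obtain g where "g \<in> carrier G" "\<psi> (N #>\<^bsub>G\<^esub> g) \<noteq> 1" using Q.nontrivial c by auto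
    then show "\<exists>g\<in>carrier G. \<omega> g \<noteq> 1" by (auto simp: \<omega>_def)
  qed
  have NK: "N \<subseteq> W.K"
  proof
    fix n assume n: "n \<in> N"
    then have "N #>\<^bsub>G\<^esub> n = N" by (rule N.rcos_const[OF is_group])
    then have "\<omega> n = 1" using n N.subset Q.\<omega>D(2) by (auto simp: \<omega>_def)
    then show "n \<in> W.K" using n N.subset by (auto simp: W.K_def)
  qed
  have "N \<lhd> W.GK" by (rule normal_restrict_supergroup[OF W.K_subgroup Suc.prems(2) NK])
  moreover have "card W.K = p ^ k * card N"
    using W.card_K Suc.prems(3) prime_gt_0_nat[OF p] by simp
  ultimately have "u_inv p W.GK = p ^ k * u_inv p (G\<lparr>carrier := N\<rparr>)"
    using Suc.IH[of W.GK] W.finite_group_GK by simp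
  then show ?case using W.u_inv_kernel by simp
qed

section \<open>The p'-part of the abelianization\<close>

text \<open>A commutator depends only on the classes of its entries modulo the centre.\<close>

lemma (in group) central_commutator:
  assumes "x \<in> carrier G" "y \<in> carrier G" "u \<in> carrier G" "v \<in> carrier G"
    and x: "\<And>g. g \<in> carrier G \<Longrightarrow> x \<otimes> g = g \<otimes> x" and y: "\<And>g. g \<in> carrier G \<Longrightarrow> y \<otimes> g = g \<otimes> y"
  shows "(x \<otimes> u) \<otimes> (y \<otimes> v) \<otimes> inv (x \<otimes> u) \<otimes> inv (y \<otimes> v) = u \<otimes> v \<otimes> inv u \<otimes> inv v"
proof -
  have 1: "(x \<otimes> u) \<otimes> (y \<otimes> v) = (x \<otimes> y) \<otimes> (u \<otimes> v)"
    using assms(1-4) y[of u] by (metis m_assoc m_closed)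
  have 2: "(y \<otimes> v) \<otimes> (x \<otimes> u) = (x \<otimes> y) \<otimes> (v \<otimes> u)"
    using assms(1-4) x[of v] x[of y] by (metis m_assoc m_closed)
  have xy: "(x \<otimes> y) \<otimes> w = w \<otimes> (x \<otimes> y)" if "w \<in> carrier G" for w
    using assms(1-2) x[of w] y[of w] that by (metis m_assoc m_closed)
  have "(x \<otimes> u) \<otimes> (y \<otimes> v) \<otimes> inv (x \<otimes> u) \<otimes> inv (y \<otimes> v) = (x \<otimes> u) \<otimes> (y \<otimes> v) \<otimes> inv ((y \<otimes> v) \<otimes> (x \<otimes> u))"
    using assms(1-4) by (simp add: inv_mult_group m_assoc)
  also have "\<dots> = (x \<otimes> y) \<otimes> ((u \<otimes> v) \<otimes> inv (v \<otimes> u)) \<otimes> inv (x \<otimes> y)"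
    unfolding 1 2 using assms(1-4) by (simp add: inv_mult_group m_assoc)
  also have "\<dots> = (u \<otimes> v) \<otimes> inv (v \<otimes> u)"
    using assms(1-4) xy[of "(u \<otimes> v) \<otimes> inv (v \<otimes> u)"] by (simp add: m_assoc)
  also have "\<dots> = u \<otimes> v \<otimes> inv u \<otimes> inv v" using assms(1-4) by (simp add: inv_mult_group m_assoc)
  finally show ?thesis .
qed

lemma (in group) inv_cancel_assoc:
  assumes "x \<in> carrier G" "y \<in> carrier G"
  shows "inv x \<otimes> (x \<otimes> y) = y" "x \<otimes> (inv x \<otimes> y) = y"
  using assms by (simp_all flip: m_assoc)

lemma (in group) commutator_subgroup_normal:
  assumes N: "N \<lhd> G"
  shows "commutator_subgroup G N (carrier G) \<lhd> G" "commutator_subgroup G N (carrier G) \<subseteq> N"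
proof -
  interpret N: normal N G by fact
  let ?C = "\<Union>h \<in> N. \<Union>k \<in> carrier G. {h \<otimes> k \<otimes> inv h \<otimes> inv k}"
  have sub: "?C \<subseteq> carrier G" using N.subset by auto
  show "commutator_subgroup G N (carrier G) \<lhd> G" unfolding commutator_subgroup_def
  proof (rule normal_generateI[OF sub])
    fix c g assume "c \<in> ?C" and g: "g \<in> carrier G"
    then obtain h k where hk: "h \<in> N" "k \<in> carrier G" "c = h \<otimes> k \<otimes> inv h \<otimes> inv k" by auto
    have h: "h \<in> carrier G" using hk N.subset by auto
    have "g \<otimes> c \<otimes> inv g = (g \<otimes> h \<otimes> inv g) \<otimes> (g \<otimes> k \<otimes> inv g) \<otimes> inv (g \<otimes> h \<otimes> inv g) \<otimes> inv (g \<otimes> k \<otimes> inv g)"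
      using g h hk(2,3) by (simp add: inv_mult_group m_assoc inv_cancel_assoc)
    moreover have "g \<otimes> h \<otimes> inv g \<in> N" using N.inv_op_closed2[OF g hk(1)] .
    moreover have "g \<otimes> k \<otimes> inv g \<in> carrier G" using g hk(2) by simp
    ultimately show "g \<otimes> c \<otimes> inv g \<in> ?C" by blast
  qed
  have "?C \<subseteq> N"
  proof
    fix c assume "c \<in> ?C"
    then obtain h k where hk: "h \<in> N" "k \<in> carrier G" "c = h \<otimes> k \<otimes> inv h \<otimes> inv k" by auto
    have "k \<otimes> inv h \<otimes> inv k \<in> N" using N.inv_op_closed2[OF hk(2)] hk(1) by simp
    then have "h \<otimes> (k \<otimes> inv h \<otimes> inv k) \<in> N" using hk(1) by simp
    then show "c \<in> N" using hk N.subset by (simp add: m_assoc subset_iff)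
  qed
  then show "commutator_subgroup G N (carrier G) \<subseteq> N"
    unfolding commutator_subgroup_def by (rule generate_subgroup_incl[OF _ N.is_subgroup])
qed

lemma (in finite_group) card_set_mult_trivial_inter:
  assumes "subgroup A G" "subgroup B G" "A \<inter> B = {\<one>}"
  shows "card (A <#> B) = card A * card B"
proof -
  have A: "A \<subseteq> carrier G" and B: "B \<subseteq> carrier G" using assms by (auto dest: subgroup.subset)
  have "inj_on (\<lambda>(a,b). a \<otimes> b) (A \<times> B)"
  proof (rule inj_onI, clarify)
    fix a b c d assume h: "a \<in> A" "b \<in> B" "c \<in> A" "d \<in> B" and eq: "a \<otimes> b = c \<otimes> d"
    have G: "a \<in> carrier G" "b \<in> carrier G" "c \<in> carrier G" "d \<in> carrier G" using h A B by auto
    have "inv c \<otimes> a = d \<otimes> inv b"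
      using eq G by (metis inv_closed inv_solve_left inv_solve_right m_assoc m_closed)
    moreover have "inv c \<otimes> a \<in> A" using h assms(1) by (simp add: subgroup.m_closed subgroup.m_inv_closed)
    moreover have "d \<otimes> inv b \<in> B" using h assms(2) by (simp add: subgroup.m_closed subgroup.m_inv_closed)
    ultimately have "inv c \<otimes> a = \<one>" "d \<otimes> inv b = \<one>" using assms(3) by auto
    then show "a = c \<and> b = d" using G by (metis inv_closed inv_equality inv_inv)
  qed
  then have "card ((\<lambda>(a,b). a \<otimes> b) ` (A \<times> B)) = card (A \<times> B)" by (rule card_image)
  moreover have "(\<lambda>(a,b). a \<otimes> b) ` (A \<times> B) = A <#> B" by (auto simp: set_mult_def)
  ultimately show ?thesis by (simp add: card_cartesian_product)
qed

lemma (in finite_group) subgroup_card_dvd: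
  assumes "subgroup A G" shows "card A dvd card (carrier G)"
  using lagrange[OF assms] by (metis Coset.order_def dvd_triv_right)

lemma (in finite_group) trivial_inter_coprime:
  assumes A: "subgroup A G" and B: "subgroup B G" and c: "coprime (card A) (card B)"
  shows "A \<inter> B = {\<one>}"
proof -
  have s: "subgroup (A \<inter> B) G" by (rule subgroups_Inter_pair[OF A B])
  have d: "card (A \<inter> B) dvd card X" if X: "subgroup X G" "A \<inter> B \<subseteq> X" for X
  proof -
    interpret X: group "G\<lparr>carrier := X\<rparr>" by (rule subgroup_imp_group[OF X(1)])
    have "finite X" using subgroup.subset[OF X(1)] fin finite_subset by blast
    then interpret X: finite_group "G\<lparr>carrier := X\<rparr>" by unfold_locales simp
    have "subgroup (A \<inter> B) (G\<lparr>carrier := X\<rparr>)" by (rule subgroup_incl[OF s X])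
    then show ?thesis using X.subgroup_card_dvd by simp
  qed
  have "card (A \<inter> B) = 1" using d[OF A] d[OF B] c by (meson Int_lower1 Int_lower2 coprime_common_divisor_nat)
  then show ?thesis using subgroup.one_closed[OF s] by (metis card_1_singletonE singletonD)
qed

text \<open>With a Sylow \<open>p\<close>-subgroup \<open>S\<close> one has \<open>G = N S\<close>.  Modulo \<open>[N,G]\<close> the elements of \<open>N\<close> are central, so
  every commutator of \<open>G\<close> is congruent to one of \<open>S\<close>, and \<open>G' = [N,G] S'\<close>.  The factor \<open>S'\<close> is a
  \<open>p\<close>-group meeting \<open>[N,G]\<close> trivially.\<close>

lemma (in finite_group) derived_of_normal_complement:
  assumes p: "prime p" and N: "N \<lhd> G" and card: "card (carrier G) = p ^ k * card N" and cop: "coprime (card N) p"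
  obtains j where "j \<le> k" "card (derived G (carrier G)) = p ^ j * card (commutator_subgroup G N (carrier G))"
proof -
  interpret N: normal N G by fact
  let ?K = "commutator_subgroup G N (carrier G)"
  have KG: "?K \<lhd> G" and KN: "?K \<subseteq> N" using commutator_subgroup_normal[OF N] by auto
  interpret K: normal ?K G by fact
  have "Coset.order G = p ^ k * card N" using card by (simp add: Coset.order_def)
  then obtain S where S: "subgroup S G" "card S = p ^ k" using sylow_thm[OF p is_group _ fin] by blast
  interpret S: subgroup S G by fact
  have NS: "N \<inter> S = {\<one>}"
    by (rule trivial_inter_coprime[OF N.is_subgroup S(1)]) (use cop S(2) in simp)
  have "card (N <#> S) = card (carrier G)"
    using card_set_mult_trivial_inter[OF N.is_subgroup S(1) NS] S(2) card by simp
  moreover have "N <#> S \<subseteq> carrier G" by (rule set_mult_closed[OF N.subset S.subset])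
  ultimately have G: "N <#> S = carrier G" by (intro card_subset_eq) auto
  let ?D = "derived G S"
  have D: "subgroup ?D G" by (rule derived_is_subgroup[OF S.subset])
  have DS: "?D \<subseteq> S" by (rule derived_incl[OF subset_refl S(1)])
  have KD: "?K \<inter> ?D = {\<one>}" using NS KN DS K.one_closed subgroup.one_closed[OF D] by blast
  have M: "subgroup (?K <#> ?D) G" by (rule mult_norm_subgroup[OF KG D])
  interpret Q: group "G Mod ?K" by (rule K.factorgroup_is_group)
  have c: "carrier (G Mod ?K) = (\<lambda>x. ?K #> x) ` carrier G" by (rule carrier_FactGroup)
  have h: "group_hom G (G Mod ?K) (\<lambda>x. ?K #> x)"
    using K.r_coset_hom_Mod Q.is_group is_group by (simp add: group_hom_def group_hom_axioms_def)
  interpret h: group_hom G "G Mod ?K" "\<lambda>x. ?K #> x" by fact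
  \<comment> \<open>\<open>[n,g]\<close> is one of the generators of \<open>?K\<close>.\<close>
  have central: "(?K #> n) \<otimes>\<^bsub>G Mod ?K\<^esub> X = X \<otimes>\<^bsub>G Mod ?K\<^esub> (?K #> n)" if n: "n \<in> N" and X: "X \<in> carrier (G Mod ?K)" for n X
  proof -
    obtain g where g: "g \<in> carrier G" "X = ?K #> g" using X unfolding c by blast
    have nG: "n \<in> carrier G" using n N.subset by auto
    have "n \<otimes> g \<otimes> inv n \<otimes> inv g \<in> ?K"
      unfolding commutator_subgroup_def by (rule generate.incl) (use n g in blast)
    then have "?K #> (n \<otimes> g \<otimes> inv n \<otimes> inv g) = ?K" by (rule K.rcos_const[OF is_group])
    then have "?K #> ((n \<otimes> g \<otimes> inv n \<otimes> inv g) \<otimes> (g \<otimes> n)) = ?K #> (g \<otimes> n)"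
      using g nG K.subset by (metis coset_mult_assoc inv_closed m_closed)
    also have "(n \<otimes> g \<otimes> inv n \<otimes> inv g) \<otimes> (g \<otimes> n) = n \<otimes> g"
      using g nG by (simp add: m_assoc inv_cancel_assoc)
    finally show ?thesis
      unfolding g(2) mult_FactGroup K.rcos_sum[OF nG g(1)] K.rcos_sum[OF g(1) nG] .
  qed
  have "derived_set G (carrier G) \<subseteq> ?K <#> ?D"
  proof
    fix x assume "x \<in> derived_set G (carrier G)"
    then obtain a b where ab: "a \<in> carrier G" "b \<in> carrier G" "x = a \<otimes> b \<otimes> inv a \<otimes> inv b" by auto
    obtain n s where ns: "n \<in> N" "s \<in> S" "a = n \<otimes> s" using ab(1) G[symmetric] by (auto simp: set_mult_def)
    obtain m t where mt: "m \<in> N" "t \<in> S" "b = m \<otimes> t" using ab(2) G[symmetric] by (auto simp: set_mult_def)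
    have in_G: "n \<in> carrier G" "m \<in> carrier G" "s \<in> carrier G" "t \<in> carrier G"
      using ns mt N.subset S.subset by auto
    let ?q = "\<lambda>x. ?K #> x" and ?mul = "\<lambda>X Y. X \<otimes>\<^bsub>G Mod ?K\<^esub> Y" and ?inv = "\<lambda>X. inv\<^bsub>G Mod ?K\<^esub> X"
    have "?q x = ?mul (?mul (?mul (?q a) (?q b)) (?inv (?q a))) (?inv (?q b))"
      using ab by simp
    also have "\<dots> = ?mul (?mul (?mul (?mul (?q n) (?q s)) (?mul (?q m) (?q t))) (?inv (?mul (?q n) (?q s)))) (?inv (?mul (?q m) (?q t)))"
      unfolding ns(3) mt(3) using in_G by (simp only: h.hom_mult)
    also have "\<dots> = ?mul (?mul (?mul (?q s) (?q t)) (?inv (?q s))) (?inv (?q t))"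
      by (rule Q.central_commutator) (use in_G central ns mt h.hom_closed in auto)
    also have "\<dots> = ?q (s \<otimes> t \<otimes> inv s \<otimes> inv t)" using in_G by simp
    finally have e: "?q x = ?q (s \<otimes> t \<otimes> inv s \<otimes> inv t)" .
    have "x \<in> carrier G" using ab by simp
    then have "x \<in> ?q x" by (rule rcos_self[OF _ K.is_subgroup])
    then have "x \<in> ?K #> (s \<otimes> t \<otimes> inv s \<otimes> inv t)" using e by simp
    moreover have "s \<otimes> t \<otimes> inv s \<otimes> inv t \<in> ?D"
      unfolding derived_def by (rule generate.incl) (use ns mt in blast)
    ultimately show "x \<in> ?K <#> ?D" by (auto simp: r_coset_def set_mult_def)
  qed
  then have 1: "derived G (carrier G) \<subseteq> ?K <#> ?D"
    unfolding derived_def by (rule generate_subgroup_incl[OF _ M[unfolded derived_def]])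
  have "?K \<subseteq> derived G (carrier G)"
    unfolding commutator_subgroup_def derived_def by (rule mono_generate) (use N.subset in blast)
  moreover have "?D \<subseteq> derived G (carrier G)" by (rule mono_derived[OF S.subset])
  ultimately have 2: "?K <#> ?D \<subseteq> derived G (carrier G)"
    using subgroup.m_closed[OF derived_is_subgroup[OF subset_refl]] unfolding set_mult_def by blast
  have "card (derived G (carrier G)) = card ?K * card ?D"
    using 1 2 card_set_mult_trivial_inter[OF K.is_subgroup D KD] by simp
  moreover have "card ?D dvd p ^ k"
  proof -
    interpret SG: group "G\<lparr>carrier := S\<rparr>" by (rule subgroup_imp_group[OF S(1)])
    have "finite S" using S.subset fin finite_subset by blast
    then interpret SG: finite_group "G\<lparr>carrier := S\<rparr>" by unfold_locales simp
    show ?thesis using SG.subgroup_card_dvd[OF subgroup_incl[OF D S(1) DS]] S(2) by simp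
  qed
  then obtain j where "j \<le> k" "card ?D = p ^ j" using divides_primepow_nat[OF p] by blast
  ultimately show thesis using that by simp
qed

section \<open>The criterion for a normal complement\<close>

lemma parts_of_prime_power_mult:
  assumes p: "prime p" and m: "\<not> p dvd m"
  shows "p_part p (p ^ k * m) = p ^ k" "p'_part p (p ^ k * m) = m"
proof -
  have "\<not> p ^ Suc k dvd p ^ k * m" using m prime_gt_0_nat[OF p] by simp
  then have "multiplicity p (p ^ k * m) = k" by (intro multiplicity_eqI) auto
  then show "p_part p (p ^ k * m) = p ^ k" by (simp add: p_part_def)
  then show "p'_part p (p ^ k * m) = m" using prime_gt_0_nat[OF p] by (simp add: p'_part_def)
qed

lemma parts_decomposition:
  assumes p: "prime p" and n: "n > 0"
  shows "n = p_part p n * p'_part p n" "\<not> p dvd p'_part p n"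
proof -
  show "n = p_part p n * p'_part p n"
    by (simp add: p_part_def p'_part_def multiplicity_dvd)
  show "\<not> p dvd p'_part p n"
    unfolding p_part_def p'_part_def using n p by (intro multiplicity_decompose) (auto simp: not_prime_unit)
qed

context finite_group
begin

lemma group_index_mult_card:
  assumes "subgroup A G" shows "group_index G A * card A = card (carrier G)"
  using lagrange[OF assms] by (simp add: group_index_def Coset.order_def)

lemma card_subgroup_pos: "subgroup A G \<Longrightarrow> card A > 0"
  using subgroup.subset[of A G] subgroup.one_closed[of A G] finite_subset[OF _ fin] card_gt_0_iff by blast

lemma finite_group_subgroup: "subgroup A G \<Longrightarrow> finite_group (G\<lparr>carrier := A\<rparr>)"
proof -
  assume A: "subgroup A G"
  interpret A: group "G\<lparr>carrier := A\<rparr>" by (rule subgroup_imp_group[OF A])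
  show ?thesis by unfold_locales (use subgroup.subset[OF A] finite_subset[OF _ fin] in auto)
qed

lemma normal_p_complement_iff:
  assumes p: "prime p"
  shows "normal_p_complement p G N \<longleftrightarrow> N \<lhd> G \<and> \<not> p dvd card N \<and> (\<exists>k. card (carrier G) = p ^ k * card N)"
proof (cases "N \<lhd> G")
  case True
  then have N: "subgroup N G" by (rule normal_imp_subgroup)
  have "coprime (card N) p \<longleftrightarrow> \<not> p dvd card N"
    using p by (metis coprime_commute coprime_absorb_left not_prime_unit prime_imp_coprime)
  moreover have "group_index G N = p ^ k \<longleftrightarrow> card (carrier G) = p ^ k * card N" for k
    using group_index_mult_card[OF N] card_subgroup_pos[OF N] by (metis mult_right_cancel neq0_conv)
  ultimately show ?thesis using True by (simp add: normal_p_complement_def)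
qed (simp add: normal_p_complement_def)

text \<open>The descent reduces to \<open>N\<close>, where only linear characters count, as the order of \<open>N\<close> is prime to
  \<open>p\<close>.\<close>

lemma u_inv_of_complement:
  assumes p: "prime p" and N: "N \<lhd> G" and n: "\<not> p dvd card N" and card: "card (carrier G) = p ^ k * card N"
  shows "u_inv p G * card (derived G N) = card (carrier G)"
proof -
  have sN: "subgroup N G" using N by (rule normal_imp_subgroup)
  interpret H: finite_group "G\<lparr>carrier := N\<rparr>" by (rule finite_group_subgroup[OF sN])
  have "u_inv p (G\<lparr>carrier := N\<rparr>) = group_index (G\<lparr>carrier := N\<rparr>) (derived (G\<lparr>carrier := N\<rparr>) N)"
    using H.u_inv_coprime_order[OF p] n H.card_linear_chars by simp
  moreover have "subgroup (derived (G\<lparr>carrier := N\<rparr>) N) (G\<lparr>carrier := N\<rparr>)"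
    by (rule H.derived_is_subgroup) simp
  ultimately have "u_inv p (G\<lparr>carrier := N\<rparr>) * card (derived G N) = card N"
    using H.group_index_mult_card derived_consistent[OF subset_refl sN] by fastforce
  then show ?thesis
    using u_inv_normal_complement_descent[OF finite_group_axioms p N card] card by simp
qed

text \<open>Since \<open>|G'| = p ^ j * |[N,G]|\<close>, the index of \<open>G'\<close> is \<open>p ^ (k - j) * |N:[N,G]|\<close>, and the second factor is
  prime to \<open>p\<close>.\<close>

lemma abelianization_of_complement:
  assumes p: "prime p" and N: "N \<lhd> G" and n: "\<not> p dvd card N" and card: "card (carrier G) = p ^ k * card N"
  shows "p_part p (Coset.order G) * p'_part p (group_index G (derived G (carrier G)))
    * card (commutator_subgroup G N (carrier G)) = card (carrier G)"
proof -
  let ?K = "commutator_subgroup G N (carrier G)" and ?i = "group_index G (derived G (carrier G))"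
  have sN: "subgroup N G" using N by (rule normal_imp_subgroup)
  have KG: "subgroup ?K G" and KN: "?K \<subseteq> N"
    using commutator_subgroup_normal[OF N] normal_imp_subgroup by auto
  interpret H: finite_group "G\<lparr>carrier := N\<rparr>" by (rule finite_group_subgroup[OF sN])
  have "card ?K dvd card N" using H.subgroup_card_dvd[OF subgroup_incl[OF KG sN KN]] by simp
  then obtain q where q: "card N = q * card ?K" by (metis dvd_div_mult_self)
  have "coprime (card N) p" using n p by (metis coprime_commute prime_imp_coprime)
  then obtain j where j: "j \<le> k" "card (derived G (carrier G)) = p ^ j * card ?K"
    by (rule derived_of_normal_complement[OF p N card])
  have "?i * (p ^ j * card ?K) = p ^ k * card N"
    using group_index_mult_card[OF derived_is_subgroup[OF subset_refl]] j(2) card by simp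
  also have "\<dots> = (p ^ (k - j) * q) * (p ^ j * card ?K)"
    using j(1) q by (simp add: power_add[symmetric])
  finally have i: "?i = p ^ (k - j) * q"
    using card_subgroup_pos[OF KG] prime_gt_0_nat[OF p] by simp
  have "\<not> p dvd q" using n q by auto
  then have "p'_part p ?i = q" unfolding i by (rule parts_of_prime_power_mult(2)[OF p])
  moreover have "p_part p (Coset.order G) = p ^ k"
    unfolding Coset.order_def card by (rule parts_of_prime_power_mult(1)[OF p n])
  ultimately show ?thesis using q card by simp
qed

text \<open>Such an \<open>N\<close> is the set of all elements of order prime to \<open>p\<close>, which is invariant under conjugation.\<close>

lemma normal_of_coprime_elements:
  assumes N: "subgroup N G" and n: "coprime (card N) p"
    and all: "\<And>g m. g \<in> carrier G \<Longrightarrow> coprime m p \<Longrightarrow> g [^] (m::nat) = \<one> \<Longrightarrow> g \<in> N"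
  shows "N \<lhd> G"
  unfolding normal_inv_iff
proof (intro conjI ballI N)
  interpret H: finite_group "G\<lparr>carrier := N\<rparr>" by (rule finite_group_subgroup[OF N])
  fix g h assume g: "g \<in> carrier G" and h: "h \<in> N"
  have hG: "h \<in> carrier G" using h subgroup.subset[OF N] by blast
  have "h [^]\<^bsub>G\<lparr>carrier := N\<rparr>\<^esub> card N = \<one>"
    using H.pow_order_eq_1[of h] h by (simp add: Coset.order_def)
  then have h1: "h [^] card N = \<one>" by (simp add: nat_pow_def)
  have "(g \<otimes> h \<otimes> inv g) [^] (m::nat) = g \<otimes> h [^] m \<otimes> inv g" for m
    using g hG by (induction m) (simp_all add: m_assoc inv_cancel_assoc)
  then have "(g \<otimes> h \<otimes> inv g) [^] card N = \<one>" using h1 g by simp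
  then show "g \<otimes> h \<otimes> inv g \<in> N" using all[OF _ n] g hG by simp
qed

lemma derived_subset_commutator_subgroup:
  "N \<subseteq> carrier G \<Longrightarrow> derived G N \<subseteq> commutator_subgroup G N (carrier G)"
  unfolding commutator_subgroup_def derived_def by (rule mono_generate) blast

end

theorem theorem2p2:
  fixes G :: "('a, 'b) monoid_scheme" and p :: nat
  assumes "group G" and "finite (carrier G)" and "prime p"
  shows "u_inv p G
           = p_part p (Coset.order G) * p'_part p (group_index G (derived G (carrier G)))
         \<longleftrightarrow> (\<exists>N. normal_p_complement p G N \<and> commutator_subgroup G N (carrier G) = derived G N)"
    (is "?u = ?r \<longleftrightarrow> _")
proof -
  interpret group G by fact
  interpret finite_group G by unfold_locales fact
  note p = assms(3)
  have criterion: "?u = ?r \<longleftrightarrow> commutator_subgroup G N (carrier G) = derived G N"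
    if compl: "normal_p_complement p G N" for N
  proof -
    let ?K = "commutator_subgroup G N (carrier G)"
    obtain k where N: "N \<lhd> G" "\<not> p dvd card N" "card (carrier G) = p ^ k * card N"
      using compl normal_p_complement_iff[OF p] by blast
    have NG: "N \<subseteq> carrier G" using N(1) by (auto dest: normal_imp_subgroup subgroup.subset)
    have K: "subgroup ?K G" using commutator_subgroup_normal[OF N(1)] normal_imp_subgroup by blast
    \<comment> \<open>Both products are the order of \<open>G\<close>.\<close>
    have e: "?u * card (derived G N) = ?r * card ?K"
      using u_inv_of_complement[OF p N] abelianization_of_complement[OF p N] by simp
    have u0: "?u > 0" using u_inv_of_complement[OF p N] card_pos by (metis mult_0 neq0_conv)
    have "?u = ?r \<longleftrightarrow> card ?K = card (derived G N)"
      using e u0 card_subgroup_pos[OF K] by auto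
    also have "\<dots> \<longleftrightarrow> ?K = derived G N"
      using derived_subset_commutator_subgroup[OF NG] finite_subset[OF subgroup.subset[OF K] fin]
      by (metis card_subset_eq)
    finally show ?thesis .
  qed
  have "\<exists>N. normal_p_complement p G N" if eq: "?u = ?r"
  proof -
    obtain N k where N: "subgroup N G" "card (carrier G) = p ^ k * card N"
      and u: "u_inv p G = p ^ k * u_inv p (G\<lparr>carrier := N\<rparr>)"
      and l: "\<not> p dvd card (linear_chars (G\<lparr>carrier := N\<rparr>))"
      and all: "\<forall>g\<in>carrier G. \<forall>m. coprime m p \<and> g [^]\<^bsub>G\<^esub> m = \<one>\<^bsub>G\<^esub> \<longrightarrow> g \<in> N"
      using descent_to_p_perfect[OF finite_group_axioms p] by blast
    interpret H: finite_group "G\<lparr>carrier := N\<rparr>" by (rule finite_group_subgroup[OF N(1)])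
    obtain j where "u_inv p (G\<lparr>carrier := N\<rparr>) = card (linear_chars (G\<lparr>carrier := N\<rparr>)) + p * j"
      by (rule H.u_inv_cong_linear[OF p])
    then have "\<not> p dvd u_inv p (G\<lparr>carrier := N\<rparr>)" using l by (simp add: dvd_add_left_iff)
    then have "p_part p ?u = p ^ k" unfolding u by (rule parts_of_prime_power_mult(1)[OF p])
    moreover have "p_part p ?r = p_part p (Coset.order G)"
    proof -
      have "group_index G (derived G (carrier G)) > 0"
        using group_index_mult_card[OF derived_is_subgroup[OF subset_refl]] card_pos by (metis mult_0 neq0_conv)
      then show ?thesis
        using parts_of_prime_power_mult(1)[OF p parts_decomposition(2)[OF p]] unfolding p_part_def by blast
    qed
    \<comment> \<open>Both sides of the equation have the same \<open>p\<close>-part: \<open>|G:N|\<close> on the left, \<open>|G|\<^sub>p\<close> on the right.\<close>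
    ultimately have "p ^ k = p_part p (card (carrier G))" using eq by (simp add: Coset.order_def)
    then have "card N = p'_part p (card (carrier G))"
      using N(2) prime_gt_0_nat[OF p] by (simp add: p'_part_def)
    then have n: "\<not> p dvd card N" using parts_decomposition(2)[OF p card_pos] by simp
    then have "coprime (card N) p" using p by (metis coprime_commute prime_imp_coprime)
    then have "N \<lhd> G" by (rule normal_of_coprime_elements[OF N(1)]) (use all in blast)
    then show ?thesis using normal_p_complement_iff[OF p] n N(2) by blast
  qed
  then show ?thesis using criterion by blast
qed

end
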